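(* Assume the data satisfy (H1)–(H4) and let $H$ be a defining function for $Y$. Let $u:X\to\mathbb{R}$ be an upper semicontinuous viscosity subsolution of $$\max\{-g(\nabla u(x))\det(D^2u(x))+f(x),\;-\lambda_1(D^2u(x)),\;H(\nabla u(x))\}=0,\qquad x\in X. \tag{$*$}$$ Then $u$ is uniquely determined on $\operatorname{supp}(f)$ up to an additive constant (any two such subsolutions differ by a constant on $\operatorname{supp}(f)$), and the subgradient map $\partial u$ solves the optimal transport problem $$\min_{T\in\mathcal M}\int_X |x-T(x)|^2 f(x)\,dx,\quad \mathcal M=\Big\{T:X\to Y \;\Big|\; \int_E f\,dx=\int_{T(E)}g\,dy \text{ for all measurable } E\subset X\Big\}.$$
   Context: Standing hypotheses (H1)–(H4): (H1) $X,Y\subset\mathbb{R}^n$ are convex, bounded, open domains. (H2) $f\in L^1(X)$ is non-negative and lower semicontinuous. (H3) $g\in L^1(\mathbb{R}^n)$ is positive on $Y$, vanishes on $\mathbb{R}^n\setminus Y$, and is upper semicontinuous. (H4) $\int_X f\,dx=\int_Y g\,dy$. A defining function for $Y$ is a continuous $H:\mathbb{R}^n\to\mathbb{R}$ with $H<0$ on $Y$, $H=0$ on $\partial Y$, $H>0$ on $\mathbb{R}^n\setminus\bar Y$. $\lambda_1(A)$ denotes the smallest eigenvalue of a symmetric matrix $A$. Write $F(x,p,A)=\max\{-g(p)\det A+f(x),-\lambda_1(A),H(p)\}$. An upper semicontinuous $u$ is a viscosity subsolution of $( * )$ on $X$ if for every $\phi\in C^2$ and every $x\in X$ at which $u-\phi$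 has a local maximum, $F_*(x,\nabla\phi(x),D^2\phi(x))\le 0$, where $F_*$ is the lower semicontinuous envelope of $F$. *)

theory Defs
  imports "HOL-Analysis.Analysis"
begin

definition usc_on :: "'a::topological_space set \<Rightarrow> ('a \<Rightarrow> real) \<Rightarrow> bool" where
  "usc_on S u \<longleftrightarrow> (\<forall>a. openin (top_of_set S) {x \<in> S. u x < a})"

definition lsc_on :: "'a::topological_space set \<Rightarrow> ('a \<Rightarrow> real) \<Rightarrow> bool" where
  "lsc_on S u \<longleftrightarrow> (\<forall>a. openin (top_of_set S) {x \<in> S. u x > a})"

definition lambda_min :: "real^'n^'n \<Rightarrow> real" where
  "lambda_min A = Min {l. \<exists>v. v \<noteq> 0 \<and> A *v v = l *s v}"

definition C2_with :: "(real^'n \<Rightarrow> real) \<Rightarrow> (real^'n \<Rightarrow> real^'n) \<Rightarrow> (real^'n \<Rightarrow> real^'n^'n) \<Rightarrow> bool" where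
  "C2_with phi Dphi D2phi \<longleftrightarrow>
     (\<forall>x. (phi has_derivative (\<lambda>h. Dphi x \<bullet> h)) (at x)) \<and>
     (\<forall>x. (Dphi has_derivative (\<lambda>h. D2phi x *v h)) (at x)) \<and>
     continuous_on UNIV D2phi"

definition defining_fun :: "(real^'n) set \<Rightarrow> (real^'n \<Rightarrow> real) \<Rightarrow> bool" where
  "defining_fun Y H \<longleftrightarrow> continuous_on UNIV H \<and> (\<forall>p\<in>Y. H p < 0) \<and>
     (\<forall>p\<in>frontier Y. H p = 0) \<and> (\<forall>p. p \<notin> closure Y \<longrightarrow> H p > 0)"

definition Fop :: "(real^'n \<Rightarrow> real) \<Rightarrow> (real^'n \<Rightarrow> real) \<Rightarrow> (real^'n \<Rightarrow> real)
    \<Rightarrow> (real^'n) \<times> (real^'n) \<times> (real^'n^'n) \<Rightarrow> real" where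
  "Fop f g H z = (case z of (x, p, A) \<Rightarrow>
      max (max (- g p * det A + f x) (- lambda_min A)) (H p))"

definition Fdom :: "(real^'n) set \<Rightarrow> ((real^'n) \<times> (real^'n) \<times> (real^'n^'n)) set" where
  "Fdom X = {(x, p, A). x \<in> X \<and> transpose A = A}"

definition lsc_env :: "('a::metric_space) set \<Rightarrow> ('a \<Rightarrow> real) \<Rightarrow> 'a \<Rightarrow> ereal" where
  "lsc_env D F z = (SUP e\<in>{0<..}. INF w\<in>D \<inter> ball z e. ereal (F w))"

definition visc_sub :: "(real^'n) set \<Rightarrow> (real^'n \<Rightarrow> real) \<Rightarrow> (real^'n \<Rightarrow> real)
    \<Rightarrow> (real^'n \<Rightarrow> real) \<Rightarrow> (real^'n \<Rightarrow> real) \<Rightarrow> bool" where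
  "visc_sub X f g H u \<longleftrightarrow>
     (\<forall>phi Dphi D2phi x. C2_with phi Dphi D2phi \<and> x \<in> X \<and>
        (\<exists>e>0. \<forall>y\<in>X \<inter> ball x e. u y - phi y \<le> u x - phi x)
        \<longrightarrow> lsc_env (Fdom X) (Fop f g H) (x, Dphi x, D2phi x) \<le> 0)"

definition subgrad :: "(real^'n) set \<Rightarrow> (real^'n \<Rightarrow> real) \<Rightarrow> real^'n \<Rightarrow> (real^'n) set" where
  "subgrad X u x = {p. \<forall>y\<in>X. u y \<ge> u x + p \<bullet> (y - x)}"

text \<open>Support of f (f lower semicontinuous, so this is also the essential support).\<close>
definition fsupp :: "(real^'n) set \<Rightarrow> (real^'n \<Rightarrow> real) \<Rightarrow> (real^'n) set" where
  "fsupp X f = X \<inter> closure {x \<in> X. f x \<noteq> 0}"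

definition transport_maps :: "(real^'n) set \<Rightarrow> (real^'n) set \<Rightarrow> (real^'n \<Rightarrow> real)
    \<Rightarrow> (real^'n \<Rightarrow> real) \<Rightarrow> (real^'n \<Rightarrow> real^'n) set" where
  "transport_maps X Y f g = {T. (\<forall>x\<in>X. T x \<in> Y) \<and> T measurable_on X \<and>
     (\<forall>E. E \<in> sets lebesgue \<and> E \<subseteq> X \<longrightarrow>
        T ` E \<in> sets lebesgue \<and> integral E f = integral (T ` E) g)}"

definition ot_cost :: "(real^'n) set \<Rightarrow> (real^'n \<Rightarrow> real) \<Rightarrow> (real^'n \<Rightarrow> real^'n) \<Rightarrow> real" where
  "ot_cost X f T = integral X (\<lambda>x. (norm (x - T x))\<^sup>2 * f x)"

end

theory Submission
  imports Defs
begin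

text \<open>Touching \<open>u\<close> from above by quadratics shows that a subsolution is convex and that
  \<open>f \<le> g(\<nabla>u) det D\<^sup>2u\<close> wherever \<open>u\<close> has a second order expansion. Instead of invoking
  Alexandrov's theorem, we parametrise the graph of \<open>\<partial>u\<close> by \<open>x = z + p\<close>: the resolvent
  \<open>J x = z\<close> is Lipschitz, hence differentiable almost everywhere by Rademacher's theorem. Where its
  derivative \<open>D\<close> is invertible, \<open>u\<close> has at \<open>z\<close> the Hessian \<open>D\<^sup>-\<^sup>1 - 1\<close>, and the inequality reads
  \<open>f(z) |det D| \<le> g(p) |det (1 - D)|\<close>; the remaining points have negligible image by Sard's lemma.
  The change of variables \<open>x \<mapsto> z\<close> and \<open>x \<mapsto> p\<close> turns it into \<open>\<integral>\<^sub>E f \<le> \<integral>\<^sub>\<partial>\<^sub>u\<^sub>(\<^sub>E\<^sub>) g\<close>, and equality of the total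
  masses forces equality for every \<open>E\<close>.

  Kantorovich duality with the Legendre transform of \<open>u\<close> then gives optimality. For two subsolutions
  \<open>u\<close> and \<open>v\<close> the optimal map of \<open>u\<close> is also a selection of \<open>\<partial>v\<close>, so their Legendre transforms
  have common subgradients on a dense subset of \<open>Y\<close> and differ by a constant on the connected set
  \<open>Y\<close>, although the support of \<open>f\<close> need not be connected.\<close>

section \<open>Change of variables without a well-order on the index type\<close>

text \<open>The maps in \<open>transport_maps\<close> compare \<open>f\<close> on \<open>E\<close>
  with \<open>g\<close> on the image of \<open>E\<close>, so a formula for images is needed, whereas
  \<open>\<partial>u\<close> is multivalued and need not be Lipschitz in \<open>z\<close>. The
  variable \<open>x = z + p\<close> treats both sides alike: monotonicity of
  \<open>\<partial>u\<close> makes \<open>z\<close> and \<open>p\<close> Lipschitz functions of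
  \<open>x\<close>, the two masses become integrals over the same set of parameters with Jacobians
  \<open>det D\<close> and \<open>det (1 - D)\<close>, and the pointwise inequality can simply be
  integrated. Only an inequality is available because \<open>u\<close> is merely a subsolution; (H4)
  supplies the reverse one. The two Jacobians also give injectivity: invertible \<open>D\<close>
  excludes two subgradients at one point, invertible \<open>1 - D\<close> excludes one subgradient
  shared by two points, and where \<open>f > 0\<close> the inequality itself forces the second from
  the first. The delicate point is symmetry of the Hessian \<open>inv D - 1\<close>, which is not
  automatic for the derivative of a Lipschitz map and has to be extracted from convexity.\<close>

text \<open>The library proves Sard's lemma and the change of variables theorem for index types of sort
  wellorder only; \<open>'a idx\<close> is a well-ordered copy of the finite type \<open>'a\<close>.\<close>

typedef 'a idx = "{..<CARD('a::finite)}"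
  by (rule exI[of _ 0]) simp

instance idx :: (finite) finite
proof
  show "finite (UNIV :: 'a idx set)"
    unfolding type_definition.univ[OF type_definition_idx] by simp
qed

instantiation idx :: (finite) linorder
begin
definition "x \<le> y \<longleftrightarrow> Rep_idx x \<le> Rep_idx y"
definition "x < y \<longleftrightarrow> Rep_idx x < Rep_idx y"
instance
  by standard (auto simp: less_eq_idx_def less_idx_def Rep_idx_inject)
end

instance idx :: (finite) wellorder
proof -
  have "wf {(x :: 'a idx, y). x < y}"
    by (rule wf_subset[OF wf_measure[of Rep_idx]]) (auto simp: less_idx_def)
  then show "OFCLASS('a idx, wellorder_class)"
    by (rule wf_wellorderI) intro_classes
qed

lemma card_idx: "CARD('a::finite idx) = CARD('a)"
  unfolding type_definition.univ[OF type_definition_idx]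
  by (subst card_image) (auto simp: inj_on_def Abs_idx_inject)

section \<open>Coordinate relabelling and Lebesgue measure\<close>

definition reindex :: "('m \<Rightarrow> 'n) \<Rightarrow> real^'n \<Rightarrow> real^'m" where
  "reindex b x = (\<chi> i. x $ b i)"

lemma reindex_nth [simp]: "reindex b x $ i = x $ b i"
  by (simp add: reindex_def)

lemma linear_reindex: "linear (reindex b)"
  by (rule linearI) (auto simp: vec_eq_iff)

lemma bounded_linear_reindex: "bounded_linear (reindex (b :: 'm::finite \<Rightarrow> 'n::finite))"
  by (simp add: linear_conv_bounded_linear[symmetric] linear_reindex)

lemma reindex_inv:
  assumes "bij b"
  shows "reindex b (reindex (inv b) x) = x" "reindex (inv b) (reindex b y) = y"
  using assms by (auto simp: vec_eq_iff bij_is_inj bij_is_surj surj_f_inv_f)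

lemma prod_Basis_cart: "(\<Prod>b\<in>(Basis :: (real^'n) set). h (x \<bullet> b)) = (\<Prod>i\<in>UNIV. h (x $ i))"
proof -
  have "bij_betw (\<lambda>i. axis i (1::real)) UNIV (Basis :: (real^'n) set)"
    by (auto simp: bij_betw_def inj_on_def Basis_vec_def axis_eq_axis)
  from prod.reindex_bij_betw[OF this, of "\<lambda>b. h (x \<bullet> b)"]
  show ?thesis by (simp add: inner_axis)
qed

text \<open>\<open>lborel\<close> is determined by its values on boxes; a relabelling pulls a box
  back to a box with the same side lengths in another order, so their product is unchanged.\<close>

lemma distr_lborel_reindex:
  fixes b :: "'m::finite \<Rightarrow> 'n::finite"
  assumes b: "bij b"
  shows "distr lborel lborel (reindex b) = lborel"
proof (rule lborel_eqI[symmetric])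
  have m: "reindex b \<in> borel_measurable borel"
    by (intro borel_measurable_continuous_onI linear_continuous_on bounded_linear_reindex)
  fix l u :: "real^'m"
  assume lu: "\<And>i. i \<in> Basis \<Longrightarrow> l \<bullet> i \<le> u \<bullet> i"
  have lu': "l $ i \<le> u $ i" for i
    using lu[of "axis i 1"] by (simp add: inner_axis axis_in_Basis_iff)
  let ?c = "reindex (inv b)"
  have c: "?c l \<bullet> i \<le> ?c u \<bullet> i" if "i \<in> Basis" for i
    using that lu' by (auto simp: Basis_vec_def inner_axis)
  have "reindex b -` box l u = box (?c l) (?c u)"
    using b by (auto simp: mem_box_cart bij_is_surj surj_f_inv_f)
      (metis bij_inv_eq_iff)+
  then have "emeasure (distr lborel lborel (reindex b)) (box l u) = emeasure lborel (box (?c l) (?c u))"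
    by (subst emeasure_distr) (use m in auto)
  also have "\<dots> = ennreal (\<Prod>i\<in>Basis. (?c u - ?c l) \<bullet> i)"
    by (rule emeasure_lborel_box) (use c in auto)
  also have "(\<Prod>i\<in>Basis. (?c u - ?c l) \<bullet> i) = (\<Prod>i\<in>UNIV. (u - l) $ inv b i)"
    by (subst prod_Basis_cart[where h="\<lambda>t. t"]) simp
  also have "\<dots> = (\<Prod>i\<in>UNIV. (u - l) $ i)"
    by (rule prod.reindex_bij_betw) (use b bij_imp_bij_inv in blast)
  also have "\<dots> = (\<Prod>i\<in>Basis. (u - l) \<bullet> i)"
    by (subst prod_Basis_cart[where h="\<lambda>t. t"]) simp
  finally show "emeasure (distr lborel lborel (reindex b)) (box l u) = ennreal (\<Prod>i\<in>Basis. (u - l) \<bullet> i)" .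
qed simp

lemma negligible_reindex_image:
  fixes b :: "'m::finite \<Rightarrow> 'n::finite"
  assumes b: "bij b" and "negligible N"
  shows "negligible (reindex b ` N)"
proof (rule negligible_differentiable_image_negligible[OF _ \<open>negligible N\<close>])
  show "DIM(real^'n) \<le> DIM(real^'m)"
    using bij_betw_same_card[OF b] by simp
  show "reindex b differentiable_on N"
    by (intro linear_imp_differentiable_on bounded_linear_reindex bounded_linear.linear)
qed

lemma lebesgue_reindex_image:
  fixes b :: "'m::finite \<Rightarrow> 'n::finite"
  assumes b: "bij b" and "S \<in> sets lebesgue"
  shows "reindex b ` S \<in> sets lebesgue"
proof (rule differentiable_image_in_sets_lebesgue[OF \<open>S \<in> sets lebesgue\<close>])
  show "DIM(real^'n) \<le> DIM(real^'m)"
    using bij_betw_same_card[OF b] by simp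
  show "reindex b differentiable_on S"
    by (intro linear_imp_differentiable_on bounded_linear_reindex bounded_linear.linear)
qed

lemma reindex_image_eq_vimage:
  assumes b: "bij b"
  shows "reindex b ` S = reindex (inv b) -` S"
proof (intro equalityI subsetI)
  fix y assume "y \<in> reindex (inv b) -` S"
  then show "y \<in> reindex b ` S"
    by (intro image_eqI[of _ _ "reindex (inv b) y"]) (auto simp: reindex_inv[OF b])
qed (auto simp: reindex_inv[OF b])

lemma reindex_vimage_eq_image:
  assumes b: "bij b"
  shows "reindex b -` S = reindex (inv b) ` S"
  using reindex_image_eq_vimage[OF bij_imp_bij_inv[OF b]] b by (simp add: inv_inv_eq)

lemma measurable_reindex:
  fixes b :: "'m::finite \<Rightarrow> 'n::finite"
  assumes b: "bij b"
  shows "reindex b \<in> lebesgue \<rightarrow>\<^sub>M lebesgue"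
proof (rule measurableI)
  fix A :: "(real^'m) set" assume "A \<in> sets lebesgue"
  then show "reindex b -` A \<inter> space lebesgue \<in> sets lebesgue"
    using lebesgue_reindex_image[OF bij_imp_bij_inv[OF b]]
    by (simp add: reindex_vimage_eq_image[OF b])
qed simp

lemma distr_lebesgue_reindex:
  fixes b :: "'m::finite \<Rightarrow> 'n::finite"
  assumes b: "bij b"
  shows "distr lebesgue lebesgue (reindex b) = lebesgue"
proof -
  have m: "reindex b \<in> borel_measurable borel"
    by (intro borel_measurable_continuous_onI linear_continuous_on bounded_linear_reindex)
  have 1: "distr lebesgue lborel (reindex b) = lborel"
    using distr_completion[of "reindex b" lborel lborel] m distr_lborel_reindex[OF b] by simp
  \<comment> \<open>The Borel image measure is \<open>lborel\<close> itself, so its null sets are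
    those of the target, and completing commutes with taking the image.\<close>
  have "completion (distr lebesgue lborel (reindex b)) = distr lebesgue lebesgue (reindex b)"
    by (rule completion.completion_distr_eq) (use measurable_completion[of "reindex b" lborel lborel] m in \<open>auto simp: 1\<close>)
  then show ?thesis by (simp add: 1)
qed

lemma absolutely_integrable_reindex_imp:
  fixes b :: "'m::finite \<Rightarrow> 'n::finite" and h :: "real^'m \<Rightarrow> 'c::euclidean_space"
  assumes b: "bij b" and h: "h absolutely_integrable_on S"
  shows "(\<lambda>x. h (reindex b x)) absolutely_integrable_on (reindex b -` S)"
    and "integral (reindex b -` S) (\<lambda>x. h (reindex b x)) = integral S h"
proof -
  have i: "integrable lebesgue (\<lambda>x. indicator S x *\<^sub>R h x)"
    using h by (simp add: set_integrable_def)
  have i': "integrable (distr lebesgue lebesgue (reindex b)) (\<lambda>x. indicator S x *\<^sub>R h x)"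
    by (simp add: distr_lebesgue_reindex[OF b] i)
  from integrable_distr[OF measurable_reindex[OF b] i']
  show ai: "(\<lambda>x. h (reindex b x)) absolutely_integrable_on (reindex b -` S)"
    by (simp add: set_integrable_def indicator_def vimage_def o_def)
  have "integral (reindex b -` S) (\<lambda>x. h (reindex b x)) =
      (\<integral>x. indicator S (reindex b x) *\<^sub>R h (reindex b x) \<partial>lebesgue)"
    using set_lebesgue_integral_eq_integral(2)[OF ai]
    by (simp add: set_lebesgue_integral_def indicator_def vimage_def)
  also have "\<dots> = (\<integral>x. indicator S x *\<^sub>R h x \<partial>distr lebesgue lebesgue (reindex b))"
    by (subst integral_distr[OF measurable_reindex[OF b]]) (use i in auto)
  also have "\<dots> = integral S h"
    using set_lebesgue_integral_eq_integral(2)[OF h]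
    by (simp add: distr_lebesgue_reindex[OF b] set_lebesgue_integral_def)
  finally show "integral (reindex b -` S) (\<lambda>x. h (reindex b x)) = integral S h" .
qed

text \<open>Induction over products of transpositions: conjugation by \<open>b\<close> turns the
  transposition of \<open>i\<close> and \<open>j\<close> into that of \<open>b i\<close> and
  \<open>b j\<close>, which has the same sign.\<close>

lemma sign_reindex:
  fixes b :: "'m::finite \<Rightarrow> 'n::finite"
  assumes b: "bij b" and "p permutes UNIV"
  shows "sign (b \<circ> p \<circ> inv b) = sign p"
  using finite assms(2)
proof (induction rule: permutes_rev_induct)
  case (swap i j p)
  have pp: "permutation (b \<circ> p \<circ> inv b)"
    using swap.hyps b by (intro permutation_permutes[THEN iffD2])
      (auto intro!: exI[of _ UNIV] bij_imp_permutes simp: bij_comp bij_imp_bij_inv permutes_bij)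
  have t: "b \<circ> Transposition.transpose i j \<circ> inv b = Transposition.transpose (b i) (b j)"
    using b by (auto simp: fun_eq_iff Transposition.transpose_def) (metis bij_inv_eq_iff)+
  have "b \<circ> (p \<circ> Transposition.transpose i j) \<circ> inv b = (b \<circ> p \<circ> inv b) \<circ> (b \<circ> Transposition.transpose i j \<circ> inv b)"
    using b by (simp add: fun_eq_iff bij_is_inj)
  then have "sign (b \<circ> (p \<circ> Transposition.transpose i j) \<circ> inv b) = sign (b \<circ> p \<circ> inv b) * sign (Transposition.transpose (b i) (b j))"
    by (simp only: t) (rule sign_compose[OF pp permutation_swap_id])
  also have "\<dots> = sign p * sign (Transposition.transpose i j)"
    using swap.IH swap.hyps inj_eq[OF bij_is_inj[OF b]] by (simp add: sign_swap_id del: o_apply)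
  also have "\<dots> = sign (p \<circ> Transposition.transpose i j)"
    using swap.hyps(4) by (intro sign_compose[symmetric] permutation_swap_id)
      (auto simp: permutation_permutes)
  finally show ?case .
next
  case id
  have "b \<circ> id \<circ> inv b = id"
    using b by (simp add: surj_iff[symmetric] bij_is_surj)
  then show ?case by (simp only: sign_id)
qed

text \<open>In the Leibniz sum the substitution \<open>p \<mapsto> b \<circ> p \<circ> inv b\<close>
  runs through all permutations of the other index type and keeps the sign.\<close>

lemma det_reindex:
  fixes b :: "'m::finite \<Rightarrow> 'n::finite" and A :: "real^'n^'n"
  assumes b: "bij b"
  shows "det (\<chi> i j. A $ b i $ b j) = det A"
proof -
  let ?c = "\<lambda>p. b \<circ> p \<circ> inv b"
  have bc: "b (inv b x) = x" "inv b (b y) = y" for x y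
    using b by (auto simp: bij_is_inj bij_is_surj surj_f_inv_f)
  have bij: "bij_betw ?c {p. p permutes UNIV} {p. p permutes UNIV}"
  proof (rule bij_betwI[where g="\<lambda>q. inv b \<circ> q \<circ> b"])
    show "?c \<in> {p. p permutes UNIV} \<rightarrow> {p. p permutes UNIV}"
      using b by (auto intro!: bij_imp_permutes simp: bij_comp bij_imp_bij_inv permutes_bij)
    show "(\<lambda>q. inv b \<circ> q \<circ> b) \<in> {p. p permutes UNIV} \<rightarrow> {p. p permutes UNIV}"
      using b by (auto intro!: bij_imp_permutes simp: bij_comp bij_imp_bij_inv permutes_bij)
  qed (simp_all add: fun_eq_iff bc)
  have "det A = (\<Sum>p | p permutes UNIV. of_int (sign (?c p)) * (\<Prod>i\<in>UNIV. A $ i $ ?c p i))"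
    unfolding det_def by (rule sum.reindex_bij_betw[OF bij, symmetric])
  also have "\<dots> = (\<Sum>p | p permutes UNIV. of_int (sign p) * (\<Prod>i\<in>UNIV. A $ b i $ b (p i)))"
  proof (rule sum.cong)
    fix p :: "'m \<Rightarrow> 'm" assume p: "p \<in> {p. p permutes UNIV}"
    have "(\<Prod>i\<in>UNIV. A $ i $ ?c p i) = (\<Prod>i\<in>UNIV. A $ b i $ ?c p (b i))"
      by (rule prod.reindex_bij_betw[OF b, symmetric])
    then show "of_int (sign (?c p)) * (\<Prod>i\<in>UNIV. A $ i $ ?c p i) = of_int (sign p) * (\<Prod>i\<in>UNIV. A $ b i $ b (p i))"
      using sign_reindex[OF b] p by (simp add: bc)
  qed simp
  finally show ?thesis by (simp add: det_def)
qed

lemma ex_bij_idx: "\<exists>b :: 'n::finite idx \<Rightarrow> 'n. bij b"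
  using finite_same_card_bij[of "UNIV :: 'n idx set" "UNIV :: 'n set"] card_idx[where 'a='n] by auto

section \<open>Transfer of Sard's lemma and of the change of variables formula\<close>

definition conj_idx :: "('m \<Rightarrow> 'n) \<Rightarrow> (real^'n \<Rightarrow> real^'n) \<Rightarrow> real^'m \<Rightarrow> real^'m" where
  "conj_idx b g = (\<lambda>x. reindex b (g (reindex (inv b) x)))"

lemma conj_idx_reindex: "bij b \<Longrightarrow> conj_idx b g (reindex b x) = reindex b (g x)"
  by (simp add: conj_idx_def reindex_inv)

lemma det_conj_idx:
  fixes b :: "'m::finite \<Rightarrow> 'n::finite"
  assumes b: "bij b"
  shows "det (matrix (conj_idx b L)) = det (matrix L)"
proof -
  have ax: "reindex (inv b) (axis j 1) = axis (b j) (1::real)" for j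
    using b by (auto simp: vec_eq_iff axis_def bij_is_inj bij_is_surj surj_f_inv_f)
  have "matrix (conj_idx b L) = (\<chi> i j. matrix L $ b i $ b j)"
    by (simp add: vec_eq_iff matrix_def conj_idx_def ax)
  then show ?thesis using det_reindex[OF b] by metis
qed

lemma has_derivative_conj_idx:
  fixes b :: "'m::finite \<Rightarrow> 'n::finite"
  assumes b: "bij b" and g: "(g has_derivative g') (at x within S)"
  shows "(conj_idx b g has_derivative conj_idx b g') (at (reindex b x) within reindex b ` S)"
proof -
  have im: "reindex (inv b) ` reindex b ` S = S"
    by (simp add: image_image reindex_inv[OF b])
  have 1: "(reindex (inv b) has_derivative reindex (inv b)) (at (reindex b x) within reindex b ` S)"
    by (intro bounded_linear_imp_has_derivative bounded_linear_reindex)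
  have 2: "((g \<circ> reindex (inv b)) has_derivative (g' \<circ> reindex (inv b))) (at (reindex b x) within reindex b ` S)"
    by (rule diff_chain_within[OF 1]) (use g in \<open>simp add: im reindex_inv[OF b]\<close>)
  have "((reindex b \<circ> (g \<circ> reindex (inv b))) has_derivative (reindex b \<circ> (g' \<circ> reindex (inv b)))) (at (reindex b x) within reindex b ` S)"
    by (rule diff_chain_within[OF 2]) (intro bounded_linear_imp_has_derivative bounded_linear_reindex)
  then show ?thesis by (simp add: conj_idx_def o_def)
qed

text \<open>The relabelled map has the same Jacobian determinant, and its vanishing is the rank
  condition of \<open>baby_Sard\<close>; relabelling back keeps the image negligible.\<close>

theorem sard_negligible:
  fixes g :: "real^'n::finite \<Rightarrow> real^'n"
  assumes der: "\<And>x. x \<in> S \<Longrightarrow> (g has_derivative g' x) (at x within S)"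
    and det0: "\<And>x. x \<in> S \<Longrightarrow> det (matrix (g' x)) = 0"
  shows "negligible (g ` S)"
proof -
  obtain b :: "'n idx \<Rightarrow> 'n" where b: "bij b" using ex_bij_idx by blast
  let ?g' = "\<lambda>y. conj_idx b (g' (reindex (inv b) y))"
  have "negligible (conj_idx b g ` (reindex b ` S))"
  proof (rule baby_Sard)
    fix y assume "y \<in> reindex b ` S"
    then obtain x where x: "x \<in> S" "y = reindex b x" by auto
    show "(conj_idx b g has_derivative ?g' y) (at y within reindex b ` S)"
      using has_derivative_conj_idx[OF b der[OF x(1)]] x by (simp add: reindex_inv[OF b])
    show "rank (matrix (?g' y)) < CARD('n idx)"
      using det0[OF x(1)] x det_conj_idx[OF b]
      by (simp add: det_eq_0_rank[symmetric] reindex_inv[OF b])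
  qed simp
  then have "negligible (reindex (inv b) ` conj_idx b g ` (reindex b ` S))"
    by (rule negligible_reindex_image[OF bij_imp_bij_inv[OF b]])
  then show ?thesis
    by (simp add: image_image conj_idx_reindex[OF b] reindex_inv[OF b])
qed

theorem change_of_variables_real:
  fixes g :: "real^'n::finite \<Rightarrow> real^'n" and h :: "real^'n \<Rightarrow> real"
  assumes S: "S \<in> sets lebesgue"
    and der: "\<And>x. x \<in> S \<Longrightarrow> (g has_derivative g' x) (at x within S)"
    and inj: "inj_on g S"
    and h: "h absolutely_integrable_on (g ` S)"
  shows "(\<lambda>x. \<bar>det (matrix (g' x))\<bar> * h (g x)) absolutely_integrable_on S"
    and "integral S (\<lambda>x. \<bar>det (matrix (g' x))\<bar> * h (g x)) = integral (g ` S) h"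
proof -
  obtain b :: "'n idx \<Rightarrow> 'n" where b: "bij b" using ex_bij_idx by blast
  note b' = bij_imp_bij_inv[OF b]
  let ?g' = "\<lambda>y. conj_idx b (g' (reindex (inv b) y))"
  \<comment> \<open>The formula is applied to vector valued integrands, so \<open>h\<close> becomes
    a vector with one component; this is undone at the end by the coordinate projection
    \<open>lin1\<close>.\<close>
  let ?F = "\<lambda>y. vec (h (reindex (inv b) y)) :: real^1"
  have im: "conj_idx b g ` reindex b ` S = reindex b ` g ` S"
    by (simp add: image_image conj_idx_reindex[OF b])
  have lin: "bounded_linear (vec :: real \<Rightarrow> real^1)"
    by (simp add: linear_conv_bounded_linear[symmetric] linear_vec)
  have lin1: "bounded_linear (\<lambda>v :: real^1. v $ 1)"
    by (rule bounded_linear_vec_nth)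
  have h1: "(\<lambda>y. h (reindex (inv b) y)) absolutely_integrable_on (reindex b ` g ` S)"
      "integral (reindex b ` g ` S) (\<lambda>y. h (reindex (inv b) y)) = integral (g ` S) h"
    using absolutely_integrable_reindex_imp[OF b' h] by (simp_all add: reindex_image_eq_vimage[OF b])
  have h2: "?F absolutely_integrable_on (reindex b ` g ` S)"
    using absolutely_integrable_linear[OF h1(1) lin] by (simp add: o_def)
  have h3: "integral (reindex b ` g ` S) ?F = vec (integral (g ` S) h)"
    using integral_linear[OF set_lebesgue_integral_eq_integral(1)[OF h1(1)] lin] h1(2) by (simp add: o_def)
  have "(\<lambda>y. \<bar>det (matrix (?g' y))\<bar> *\<^sub>R ?F (conj_idx b g y)) absolutely_integrable_on (reindex b ` S) \<and>
      integral (reindex b ` S) (\<lambda>y. \<bar>det (matrix (?g' y))\<bar> *\<^sub>R ?F (conj_idx b g y)) = vec (integral (g ` S) h)"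
  proof (subst has_absolute_integral_change_of_variables)
    show "reindex b ` S \<in> sets lebesgue" by (rule lebesgue_reindex_image[OF b S])
    show "inj_on (conj_idx b g) (reindex b ` S)"
      using inj by (auto simp: inj_on_def conj_idx_reindex[OF b]) (metis reindex_inv(2)[OF b])
    fix y assume "y \<in> reindex b ` S"
    then obtain x where x: "x \<in> S" "y = reindex b x" by auto
    show "(conj_idx b g has_derivative ?g' y) (at y within reindex b ` S)"
      using has_derivative_conj_idx[OF b der[OF x(1)]] x by (simp add: reindex_inv[OF b])
  qed (use h2 h3 im in auto)
  then have a: "(\<lambda>y. \<bar>det (matrix (?g' y))\<bar> *\<^sub>R ?F (conj_idx b g y)) absolutely_integrable_on (reindex b ` S)"
     and i: "integral (reindex b ` S) (\<lambda>y. \<bar>det (matrix (?g' y))\<bar> *\<^sub>R ?F (conj_idx b g y)) = vec (integral (g ` S) h)"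
    by auto
  from absolutely_integrable_reindex_imp[OF b a]
  have a2: "(\<lambda>x. \<bar>det (matrix (g' x))\<bar> *\<^sub>R (vec (h (g x)) :: real^1)) absolutely_integrable_on S"
    and i2: "integral S (\<lambda>x. \<bar>det (matrix (g' x))\<bar> *\<^sub>R (vec (h (g x)) :: real^1)) = vec (integral (g ` S) h)"
    using i by (simp_all add: reindex_vimage_eq_image[OF b] image_image reindex_inv[OF b] conj_idx_reindex[OF b]
       det_conj_idx[OF b])
  show "(\<lambda>x. \<bar>det (matrix (g' x))\<bar> * h (g x)) absolutely_integrable_on S"
    using absolutely_integrable_linear[OF a2 lin1] by (simp add: o_def)
  show "integral S (\<lambda>x. \<bar>det (matrix (g' x))\<bar> * h (g x)) = integral (g ` S) h"
    using integral_linear[OF set_lebesgue_integral_eq_integral(1)[OF a2] lin1] i2 by (simp add: o_def)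
qed

text \<open>Allows the points with singular derivative to be removed from a parameter set without
  losing measurability.\<close>

theorem measurable_det_derivative:
  fixes g :: "real^'n::finite \<Rightarrow> real^'n"
  assumes S: "S \<in> sets lebesgue"
    and der: "\<And>x. x \<in> S \<Longrightarrow> (g has_derivative g' x) (at x within S)"
  shows "{x \<in> S. det (matrix (g' x)) = 0} \<in> sets lebesgue"
proof -
  obtain b :: "'n idx \<Rightarrow> 'n" where b: "bij b" using ex_bij_idx by blast
  let ?g' = "\<lambda>y. conj_idx b (g' (reindex (inv b) y))"
  let ?S = "reindex b ` S"
  have leb: "?S \<in> sets lebesgue" by (rule lebesgue_reindex_image[OF b S])
  have "(\<lambda>y. det (matrix (?g' y))) \<in> borel_measurable (lebesgue_on ?S)"
  proof (rule borel_measurable_det_Jacobian[OF leb])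
    fix y assume "y \<in> ?S"
    then obtain x where x: "x \<in> S" "y = reindex b x" by auto
    show "(conj_idx b g has_derivative ?g' y) (at y within ?S)"
      using has_derivative_conj_idx[OF b der[OF x(1)]] x by (simp add: reindex_inv[OF b])
  qed
  then have "(\<lambda>y. det (matrix (?g' y))) -` {0} \<inter> space (lebesgue_on ?S) \<in> sets (lebesgue_on ?S)"
    by (rule measurable_sets) simp
  then have "{y \<in> ?S. det (matrix (?g' y)) = 0} \<in> sets lebesgue"
    using leb by (auto simp: sets_restrict_space_iff vimage_def Collect_conj_eq Int_commute)
  then have "reindex (inv b) ` {y \<in> ?S. det (matrix (?g' y)) = 0} \<in> sets lebesgue"
    by (rule lebesgue_reindex_image[OF bij_imp_bij_inv[OF b]])
  moreover have "reindex (inv b) ` {y \<in> ?S. det (matrix (?g' y)) = 0} = {x \<in> S. det (matrix (g' x)) = 0}"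
    using reindex_inv[OF b] det_conj_idx[OF b] by (fastforce simp: image_iff)
  ultimately show ?thesis by simp
qed

section \<open>Rademacher's theorem\<close>

text \<open>The inverse of a strictly increasing bi-Lipschitz function pushes Lebesgue measure to an
  absolutely continuous measure; its density is the derivative, by Lebesgue differentiation.\<close>

lemma lipschitz_right_derivative_ae:
  fixes F :: "real \<Rightarrow> real"
  assumes lip: "\<And>s t. \<bar>F s - F t\<bar> \<le> L * \<bar>s - t\<bar>"
  obtains N where "negligible N"
    "\<And>s. s \<notin> N \<Longrightarrow> \<exists>l. ((\<lambda>h. (F (s + h) - F s) / h) \<longlongrightarrow> l) (at_right 0)"
proof -
  have L: "L \<ge> 0" using lip[of 0 1] by simp
  \<comment> \<open>The slope \<open>L + 1\<close> makes
    \<open>t - s \<le> G t - G s \<le> (2 * L + 1) * (t - s)\<close> for \<open>s \<le> t\<close>: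
    \<open>G\<close> is a Lipschitz bijection of the line, and its inverse \<open>g\<close> is
    1-Lipschitz.\<close>
  define G where "G s = F s + (L + 1) * s" for s
  have G_lower: "t - s \<le> G t - G s" if "s \<le> t" for s t
    using lip[of t s] that by (simp add: G_def algebra_simps abs_if split: if_splits)
  have G_lip: "\<bar>G t - G s\<bar> \<le> (2 * L + 1) * \<bar>t - s\<bar>" for s t
  proof -
    have "\<bar>G t - G s\<bar> = \<bar>(F t - F s) + (L + 1) * (t - s)\<bar>" by (simp add: G_def algebra_simps)
    also have "\<dots> \<le> \<bar>F t - F s\<bar> + \<bar>(L + 1) * (t - s)\<bar>" by (rule abs_triangle_ineq)
    also have "\<dots> \<le> L * \<bar>t - s\<bar> + (L + 1) * \<bar>t - s\<bar>" using lip[of t s] L by (simp add: abs_mult)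
    finally show ?thesis by (simp add: algebra_simps)
  qed
  have G_less: "G s < G t \<longleftrightarrow> s < t" for s t
    using G_lower[of s t] G_lower[of t s] by (cases "s < t") (auto simp: not_less)
  have G_le: "G s \<le> G t \<longleftrightarrow> s \<le> t" for s t
    using G_less[of t s] by (simp add: not_less[symmetric])
  have inj: "inj G" using G_less by (metis injI linorder_less_linear order_less_irrefl)
  have G_cont: "continuous_on A G" for A
    by (rule lipschitz_on_continuous_on[of "2 * L + 1"], rule lipschitz_onI)
       (use G_lip L in \<open>auto simp: dist_real_def\<close>)
  have surj: "\<exists>s. G s = y" for y
  proof -
    define r where "r = \<bar>y - G 0\<bar>"
    have "G (- r) \<le> y" "y \<le> G r" using G_lower[of 0 r] G_lower[of "-r" 0] by (auto simp: r_def)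
    then show ?thesis
      using IVT'[of G "-r" y r] G_cont[of "{-r..r}"] by (auto simp: r_def)
  qed
  define g where "g = inv G"
  have Gg: "G (g y) = y" "g (G s) = s" for y s
    using inj surj by (auto simp: g_def surj_def f_inv_into_f image_iff) (metis f_inv_into_f rangeI surj)
  have g_le: "g x \<le> g y \<longleftrightarrow> x \<le> y" for x y
    using G_le[of "g x" "g y"] by (simp add: Gg)
  have g_meas[measurable]: "g \<in> borel_measurable borel"
    by (rule borel_measurable_mono) (simp add: mono_def g_le)
  \<comment> \<open>This is the Stieltjes measure of \<open>G\<close>: since \<open>g\<close>
    inverts \<open>G\<close>, the preimage of \<open>[a, b]\<close> is
    \<open>[G a, G b]\<close>.\<close>
  define \<mu> where "\<mu> = distr lborel borel g"
  have vim: "g -` A = G ` A" for A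
    using Gg by (auto simp: image_iff) metis+
  have mu_ivl: "emeasure \<mu> {a..b} = ennreal (G b - G a)" if "a \<le> b" for a b
  proof -
    have "g -` {a..b} = {G a..G b}"
      using g_le[of "G a"] g_le[of _ "G b"] by (auto simp: Gg)
    then show ?thesis using that G_le by (simp add: \<mu>_def emeasure_distr)
  qed
  \<comment> \<open>The preimage of a set under \<open>g\<close> is its image under
    \<open>G\<close>, and Lipschitz images of null sets are null.\<close>
  have "absolutely_continuous lborel \<mu>"
    unfolding absolutely_continuous_def
  proof
    fix A :: "real set" assume A: "A \<in> null_sets lborel"
    then have "negligible A" by (simp add: negligible_iff_null_sets null_sets_completionI)
    then have "negligible (G ` A)"
    proof (rule negligible_locally_Lipschitz_image[rotated])
      fix x assume "x \<in> A"
      show "\<exists>T B. open T \<and> x \<in> T \<and> (\<forall>y\<in>A \<inter> T. norm (G y - G x) \<le> B * norm (y - x))"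
        by (rule exI[of _ UNIV]) (use G_lip in auto)
    qed simp
    then have "G ` A \<in> null_sets lborel"
      using A vim[of A] measurable_sets[OF g_meas, of A]
      by (auto simp: negligible_iff_null_sets null_sets_def emeasure_completion)
    then show "A \<in> null_sets \<mu>"
      using A by (auto simp: \<mu>_def null_sets_def emeasure_distr vim)
  qed
  moreover have "sets \<mu> = sets lborel" by (simp add: \<mu>_def)
  ultimately obtain \<phi> where \<phi>[measurable]: "\<phi> \<in> borel_measurable lborel" and dens: "density lborel \<phi> = \<mu>"
    using sigma_finite_measure.Radon_Nikodym[OF lborel.sigma_finite_measure_axioms] by blast
  have nn: "(\<integral>\<^sup>+x. \<phi> x * indicator {a..b} x \<partial>lborel) = ennreal (G b - G a)" if "a \<le> b" for a b
    using mu_ivl[OF that] by (simp flip: dens add: emeasure_density)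
  \<comment> \<open>The density has finite integral over bounded intervals, hence is finite almost
    everywhere; this permits the passage to the real valued \<open>\<psi>\<close>.\<close>
  have fin: "AE x in lborel. x \<in> {-real n..real n} \<longrightarrow> \<phi> x \<noteq> \<infinity>" for n
  proof -
    have "AE x in lborel. \<phi> x * indicator {-real n..real n} x \<noteq> \<infinity>"
      by (rule nn_integral_PInf_AE) (use nn[of "-real n" "real n"] in \<open>auto\<close>)
    then show ?thesis by eventually_elim (auto simp: indicator_def)
  qed
  have fin': "AE x in lborel. \<phi> x \<noteq> \<infinity>"
  proof -
    have "AE x in lborel. \<forall>n. x \<in> {-real n..real n} \<longrightarrow> \<phi> x \<noteq> \<infinity>"
      unfolding AE_all_countable using fin by blast
    then show ?thesis
    proof eventually_elim
      case (elim x)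
      obtain n where "\<bar>x\<bar> \<le> real n" using real_arch_simple by blast
      then show ?case using elim[rule_format, of n] by (auto simp: abs_le_iff)
    qed
  qed
  define \<psi> where "\<psi> x = enn2real (\<phi> x)" for x
  have int: "(\<psi> has_integral (G b - G a)) {a..b}" if "a \<le> b" for a b
  proof -
    have "(\<integral>\<^sup>+x. ennreal (\<psi> x * indicator {a..b} x) \<partial>lborel) = (\<integral>\<^sup>+x. \<phi> x * indicator {a..b} x \<partial>lborel)"
      using fin' by (intro nn_integral_cong_AE, eventually_elim)
        (auto simp: \<psi>_def indicator_def less_top[symmetric])
    then have "(\<integral>\<^sup>+x. ennreal (\<psi> x * indicator {a..b} x) \<partial>lborel) = ennreal (G b - G a)"
      using nn that by simp
    then have "((\<lambda>x. \<psi> x * indicator {a..b} x) has_integral (G b - G a)) UNIV"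
      using that by (intro nn_integral_has_integral) (auto simp: \<psi>_def[abs_def] G_le)
    then show ?thesis
      by (subst has_integral_restrict_UNIV[symmetric]) (simp add: indicator_def of_bool_def if_distrib cong: if_cong)
  qed
  have "\<psi> integrable_on cbox a b" for a b
    using int[of a b] by (cases "a \<le> b") (auto simp: cbox_interval integrable_on_def)
  then obtain N where N: "negligible N" and leb: "\<And>x e. \<lbrakk>x \<notin> N; 0 < e\<rbrakk> \<Longrightarrow>
     \<exists>d>0. \<forall>h. 0 < h \<and> h < d \<longrightarrow> norm (integral (cbox x (x + h *\<^sub>R One)) \<psi> /\<^sub>R h ^ DIM(real) - \<psi> x) < e"
    using integrable_ccontinuous_explicit[of \<psi>] by blast
  show thesis
  proof (rule that[OF N])
    fix s assume s: "s \<notin> N"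
    \<comment> \<open>The differentiation theorem averages over cubes with lower corner at the
      point, here \<open>[s, s + h]\<close>; this is why the derivative obtained is
      one-sided.\<close>
    have "((\<lambda>h. (G (s + h) - G s) / h) \<longlongrightarrow> \<psi> s) (at_right 0)"
    proof (rule tendstoI)
      fix e :: real assume "e > 0"
      from leb[OF s this] obtain d where d: "d > 0" and
        b: "\<And>h. 0 < h \<Longrightarrow> h < d \<Longrightarrow> norm (integral (cbox s (s + h *\<^sub>R One)) \<psi> /\<^sub>R h ^ DIM(real) - \<psi> s) < e"
        by blast
      show "\<forall>\<^sub>F h in at_right 0. dist ((G (s + h) - G s) / h) (\<psi> s) < e"
        unfolding eventually_at_right_field
      proof (intro exI[of _ d] conjI d allI impI)
        fix h assume "0 < h" "h < d"
        moreover have "integral {s..s + h} \<psi> = G (s + h) - G s"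
          using int[of s "s + h"] \<open>0 < h\<close> by (simp add: integral_unique)
        ultimately show "dist ((G (s + h) - G s) / h) (\<psi> s) < e"
          using b[of h] by (simp add: cbox_interval dist_real_def divide_inverse mult.commute)
      qed
    qed
    then have "((\<lambda>h. (G (s + h) - G s) / h - (L + 1)) \<longlongrightarrow> \<psi> s - (L + 1)) (at_right 0)"
      by (intro tendsto_intros)
    moreover have "\<forall>\<^sub>F h in at_right 0. (G (s + h) - G s) / h - (L + 1) = (F (s + h) - F s) / h"
      by (rule eventually_at_right_less[THEN eventually_mono]) (auto simp: G_def field_simps)
    ultimately show "\<exists>l. ((\<lambda>h. (F (s + h) - F s) / h) \<longlongrightarrow> l) (at_right 0)"
      by (intro exI) (rule Lim_transform_eventually)
  qed
qed

section \<open>Directional derivatives of Lipschitz functions\<close>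

definition dquot :: "('a::euclidean_space \<Rightarrow> real) \<Rightarrow> 'a \<Rightarrow> nat \<Rightarrow> 'a \<Rightarrow> real" where
  "dquot f e k x = real (Suc k) * (f (x + (1 / real (Suc k)) *\<^sub>R e) - f x)"

text \<open>Only the steps \<open>1 / (k + 1)\<close> are used, so that the convergence set and the
  limit are Borel measurable; \<open>dderiv_at_right\<close> recovers the limit over all small
  \<open>h > 0\<close>.\<close>

definition dderiv :: "('a::euclidean_space \<Rightarrow> real) \<Rightarrow> 'a \<Rightarrow> 'a \<Rightarrow> real" where
  "dderiv f e x = lim (\<lambda>k. dquot f e k x)"

context
  fixes f :: "'a::euclidean_space \<Rightarrow> real" and L :: real
  assumes lip: "\<And>x y. \<bar>f x - f y\<bar> \<le> L * norm (x - y)"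
begin

lemma L_nonneg: "L \<ge> 0"
proof -
  have "0 \<le> L * norm (SOME b. b \<in> (Basis :: 'a set))"
    using lip[of "SOME b. b \<in> (Basis :: 'a set)" 0] by simp
  then show ?thesis
    using norm_Basis[OF SOME_Basis] by simp
qed

lemma lip_continuous: "continuous_on A f"
  by (rule lipschitz_on_continuous_on[of L], rule lipschitz_onI)
     (use lip L_nonneg in \<open>auto simp: dist_norm\<close>)

lemma lip_measurable [measurable]: "f \<in> borel_measurable borel"
  by (intro borel_measurable_continuous_onI lip_continuous)

lemma dquot_measurable [measurable]: "dquot f e k \<in> borel_measurable borel"
  unfolding dquot_def[abs_def] by measurable

lemma dquot_bound: "\<bar>dquot f e k x\<bar> \<le> L * norm e"
proof -
  have "\<bar>dquot f e k x\<bar> = real (Suc k) * \<bar>f (x + (1 / real (Suc k)) *\<^sub>R e) - f x\<bar>"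
    by (simp add: dquot_def abs_mult)
  also have "\<dots> \<le> real (Suc k) * (L * norm ((1 / real (Suc k)) *\<^sub>R e))"
    by (intro mult_left_mono) (use lip[of "x + (1 / real (Suc k)) *\<^sub>R e" x] in auto)
  also have "\<dots> = L * norm e" by (simp add: field_simps)
  finally show ?thesis .
qed

text \<open>By the one-dimensional result every line in direction \<open>e\<close> meets the
  exceptional set \<open>C\<close> in a null set. The indicator of \<open>C\<close> at
  \<open>x + t *\<^sub>R e\<close> is integrated over \<open>x\<close> and over \<open>t\<close> in
  \<open>[0, 1]\<close>: one order of integration gives 0, the other, by translation invariance, the
  measure of \<open>C\<close>.\<close>

lemma dquot_convergent_ae: "AE x in lborel. convergent (\<lambda>k. dquot f e k x)"
proof -
  define C where "C = {x. \<not> convergent (\<lambda>k. dquot f e k x)}"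
  have C[measurable]: "C \<in> sets borel"
    unfolding C_def Cauchy_convergent_iff[symmetric] by measurable
  have line: "AE t in lborel. x + t *\<^sub>R e \<notin> C" for x
  proof -
    have "\<bar>f (x + s *\<^sub>R e) - f (x + t *\<^sub>R e)\<bar> \<le> (L * norm e) * \<bar>s - t\<bar>" for s t
      using lip[of "x + s *\<^sub>R e" "x + t *\<^sub>R e"] by (simp flip: scaleR_diff_left add: mult.assoc mult.commute[of "norm e"])
    then obtain N where N: "negligible N" and lim: "\<And>s. s \<notin> N \<Longrightarrow>
        \<exists>l. ((\<lambda>h. (f (x + (s + h) *\<^sub>R e) - f (x + s *\<^sub>R e)) / h) \<longlongrightarrow> l) (at_right 0)"
      using lipschitz_right_derivative_ae[of "\<lambda>t. f (x + t *\<^sub>R e)" "L * norm e"] by blast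
    have "x + s *\<^sub>R e \<notin> C" if s: "s \<notin> N" for s
    proof -
      obtain l where "((\<lambda>h. (f (x + (s + h) *\<^sub>R e) - f (x + s *\<^sub>R e)) / h) \<longlongrightarrow> l) (at_right 0)"
        using lim[OF s] by blast
      moreover have "filterlim (\<lambda>k. 1 / real (Suc k)) (at_right 0) sequentially"
        unfolding filterlim_at using LIMSEQ_inverse_real_of_nat
        by (auto simp: inverse_eq_divide intro!: always_eventually)
      ultimately have "(\<lambda>k. (f (x + (s + 1 / real (Suc k)) *\<^sub>R e) - f (x + s *\<^sub>R e)) / (1 / real (Suc k))) \<longlonglongrightarrow> l"
        by (rule filterlim_compose)
      then have "(\<lambda>k. dquot f e k (x + s *\<^sub>R e)) \<longlonglongrightarrow> l"
        by (simp add: dquot_def algebra_simps)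
      then show ?thesis by (auto simp: C_def convergent_def)
    qed
    then have "AE t in lebesgue. x + t *\<^sub>R e \<notin> C"
      using N by (intro AE_I'[of N]) (auto simp: negligible_iff_null_sets)
    then show ?thesis by (simp add: AE_completion_iff)
  qed
  let ?h = "\<lambda>x t. indicator C (x + t *\<^sub>R e) * indicator {0..1::real} t :: ennreal"
  have "(\<integral>\<^sup>+t. \<integral>\<^sup>+x. ?h x t \<partial>lborel \<partial>lborel) = (\<integral>\<^sup>+x. \<integral>\<^sup>+t. ?h x t \<partial>lborel \<partial>lborel)"
    by (rule lborel_pair.Fubini') measurable
  also have "\<dots> = (\<integral>\<^sup>+x. 0 \<partial>(lborel :: 'a measure))"
  proof (rule nn_integral_cong)
    fix x
    have "(\<integral>\<^sup>+t. ?h x t \<partial>lborel) = (\<integral>\<^sup>+t. 0 \<partial>(lborel :: real measure))"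
      by (rule nn_integral_cong_AE) (use line[of x] in \<open>eventually_elim, simp\<close>)
    then show "(\<integral>\<^sup>+t. ?h x t \<partial>lborel) = 0" by simp
  qed
  finally have "(\<integral>\<^sup>+t. \<integral>\<^sup>+x. ?h x t \<partial>lborel \<partial>lborel) = 0" by simp
  moreover have "(\<integral>\<^sup>+x. ?h x t \<partial>lborel) = emeasure lborel C * indicator {0..1} t" for t
  proof -
    have "(\<integral>\<^sup>+x. indicator C (t *\<^sub>R e + x) \<partial>lborel) = (\<integral>\<^sup>+x. indicator C x \<partial>distr lborel borel ((+) (t *\<^sub>R e)))"
      by (subst nn_integral_distr) auto
    also have "\<dots> = emeasure lborel C" by (simp add: lborel_distr_plus)
    finally show ?thesis by (simp add: nn_integral_multc add.commute)
  qed
  ultimately have "emeasure lborel C = 0"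
    by (simp add: nn_integral_cmult)
  then have "C \<in> null_sets lborel" using C by (intro null_setsI) auto
  then show ?thesis by (rule AE_not_in[THEN eventually_mono]) (simp add: C_def)
qed

lemma dderiv_measurable [measurable]: "dderiv f e \<in> borel_measurable borel"
  unfolding dderiv_def[abs_def] by measurable

text \<open>Every small \<open>h\<close> differs from some \<open>1 / M\<close> by at most
  \<open>h / M\<close>, so the Lipschitz bound changes the quotient only by a multiple of
  \<open>1 / M\<close>.\<close>

lemma dderiv_at_right:
  assumes "convergent (\<lambda>k. dquot f e k x)"
  shows "((\<lambda>h. (f (x + h *\<^sub>R e) - f x) / h) \<longlongrightarrow> dderiv f e x) (at_right 0)"
proof -
  have lim: "(\<lambda>k. dquot f e k x) \<longlonglongrightarrow> dderiv f e x"
    using assms by (simp add: dderiv_def convergent_LIMSEQ_iff)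
  \<comment> \<open>Chosen so that, for \<open>h \<le> 1\<close>, \<open>Suc (m h)\<close> is the
    integer part \<open>M\<close> of \<open>1 / h\<close>, that is
    \<open>1 / (M + 1) < h \<le> 1 / M\<close>; the subtraction undoes the \<open>Suc\<close> in
    \<open>dquot\<close>.\<close>
  define m where "m h = nat \<lfloor>1 / h\<rfloor> - 1" for h :: real
  have inv: "filterlim (\<lambda>h::real. 1 / h) at_top (at_right 0)"
    using filterlim_inverse_at_top_right by (simp add: inverse_eq_divide)
  have m1: "filterlim m sequentially (at_right 0)"
  proof (subst filterlim_at_top, intro allI)
    fix Z :: nat
    have "\<forall>\<^sub>F h::real in at_right 0. 1 / h \<ge> real Z + 1"
      using inv by (simp add: filterlim_at_top)
    then show "\<forall>\<^sub>F h in at_right 0. Z \<le> m h"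
    proof eventually_elim
      case (elim h)
      then have "int Z + 1 \<le> \<lfloor>1 / h\<rfloor>" by (simp add: le_floor_iff)
      then show ?case by (simp add: m_def)
    qed
  qed
  have 1: "((\<lambda>h. dquot f e (m h) x) \<longlongrightarrow> dderiv f e x) (at_right 0)"
    by (rule filterlim_compose[OF lim m1])
  have 2: "((\<lambda>h. (f (x + h *\<^sub>R e) - f x) / h - dquot f e (m h) x) \<longlongrightarrow> 0) (at_right 0)"
  proof (rule Lim_null_comparison)
    show "((\<lambda>h. 2 * L * norm e * inverse (real (Suc (m h)))) \<longlongrightarrow> 0) (at_right 0)"
      using tendsto_mult_right_zero[OF filterlim_compose[OF LIMSEQ_inverse_real_of_nat m1], of "2 * L * norm e"]
      by simp
    have "\<forall>\<^sub>F h::real in at_right 0. h < 1" by (rule eventually_at_right_real[THEN eventually_mono]) auto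
    moreover have "\<forall>\<^sub>F h::real in at_right 0. h > 0" by (rule eventually_at_right_less)
    ultimately show "\<forall>\<^sub>F h in at_right 0. norm ((f (x + h *\<^sub>R e) - f x) / h - dquot f e (m h) x)
        \<le> 2 * L * norm e * inverse (real (Suc (m h)))"
    proof eventually_elim
      case (elim h)
      define M where "M = real (Suc (m h))"
      have "\<lfloor>1 / h\<rfloor> \<ge> 1" using elim by (simp add: le_floor_iff)
      then have M: "M = of_int \<lfloor>1 / h\<rfloor>" by (simp add: M_def m_def del: one_le_floor)
      have "M \<le> 1 / h" "1 / h < M + 1"
        unfolding M by (rule of_int_floor_le, rule real_of_int_floor_add_one_gt)
      moreover have "M \<ge> 1" by (simp add: M_def)
      ultimately have Mh: "M * h \<le> 1" "1 < (M + 1) * h" "M \<ge> 1"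
        using elim by (auto simp: pos_le_divide_eq pos_divide_less_eq)
      \<comment> \<open>The error splits into moving the end point from \<open>1 / M\<close> to
        \<open>h\<close> (this is \<open>?a\<close>) and dividing by \<open>h\<close> instead of
        \<open>1 / M\<close>; each part costs at most \<open>L * norm e / M\<close>.\<close>
      let ?a = "f (x + h *\<^sub>R e) - f (x + (1 / M) *\<^sub>R e)" and ?q = "dquot f e (m h) x"
      have q: "f (x + (1 / M) *\<^sub>R e) - f x = ?q / M" using Mh(3) by (simp add: dquot_def M_def[symmetric] del: of_nat_Suc)
      have "\<bar>?a\<bar> \<le> L * norm ((h - 1 / M) *\<^sub>R e)"
        using lip[of "x + h *\<^sub>R e" "x + (1 / M) *\<^sub>R e"] by (simp add: scaleR_diff_left)
      also have "\<dots> = L * norm e * (1 / M - h)"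
        using Mh by (simp add: abs_if field_simps)
      also have "\<dots> \<le> L * norm e * (h / M)"
      proof (rule mult_left_mono)
        have "1 / M - h = (1 - M * h) / M" using Mh by (simp add: field_simps)
        also have "\<dots> \<le> h / M" using Mh by (intro divide_right_mono) (auto simp: algebra_simps)
        finally show "1 / M - h \<le> h / M" .
      qed (use L_nonneg in simp)
      finally have a: "\<bar>?a\<bar> / h \<le> L * norm e / M" using elim by (simp add: field_simps)
      have b: "\<bar>?q / (M * h) - ?q\<bar> \<le> L * norm e / M"
      proof -
        have "\<bar>?q / (M * h) - ?q\<bar> = \<bar>?q\<bar> * (1 / (M * h) - 1)"
        proof -
          have "?q / (M * h) - ?q = ?q * (1 / (M * h) - 1)" by (simp add: algebra_simps)
          moreover have "1 / (M * h) - 1 \<ge> 0" using Mh elim by (simp add: field_simps)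
          ultimately show ?thesis by (simp add: abs_mult)
        qed
        also have "\<dots> \<le> (L * norm e) * (1 / M)"
        proof (rule mult_mono)
          have "1 / (M * h) - 1 = (1 - M * h) / (M * h)" using Mh elim by (simp add: field_simps)
          also have "\<dots> \<le> h / (M * h)"
            using Mh elim by (intro divide_right_mono) (auto simp: algebra_simps)
          finally show "1 / (M * h) - 1 \<le> 1 / M" using elim by simp
        qed (use dquot_bound Mh L_nonneg elim in auto)
        finally show ?thesis by simp
      qed
      have "f (x + h *\<^sub>R e) - f x = ?a + ?q / M" using q by simp
      then have "(f (x + h *\<^sub>R e) - f x) / h - ?q = ?a / h + (?q / (M * h) - ?q)"
        by (simp only: add_divide_distrib divide_divide_eq_left add_diff_eq)
      also have "\<bar>\<dots>\<bar> \<le> \<bar>?a\<bar> / h + \<bar>?q / (M * h) - ?q\<bar>"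
        using elim by (intro order_trans[OF abs_triangle_ineq]) simp
      also have "\<dots> \<le> 2 * L * norm e * inverse M"
        using add_mono[OF a b] by (simp add: divide_inverse mult_ac)
      finally show ?case by (simp add: M_def)
    qed
  qed
  from tendsto_add[OF 1 2] show ?thesis by simp
qed

text \<open>The quotient for \<open>a + b\<close> is the one for \<open>a\<close> at the moving
  point \<open>x + sh k\<close> plus the one for \<open>b\<close> at \<open>x\<close>, and pointwise
  convergence says nothing at moving points. Integrated over a box, the shift passes to the
  indicator of the box, where dominated convergence applies. Hence the defect \<open>w\<close> has
  integral 0 over all boxes and vanishes almost everywhere.\<close>

lemma dderiv_add_ae: "AE x in lborel. dderiv f (a + b) x = dderiv f a x + dderiv f b x"
proof -
  define w where "w x = dderiv f (a + b) x - dderiv f a x - dderiv f b x" for x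
  have lim: "AE x in lborel. (\<lambda>k. dquot f e k x) \<longlonglongrightarrow> dderiv f e x" for e
    using dquot_convergent_ae[of e] by eventually_elim (simp add: dderiv_def convergent_LIMSEQ_iff)
  have w0: "integrable lborel (\<lambda>x. indicator (cbox c d) x * w x) \<and>
      (\<integral>x. indicator (cbox c d) x * w x \<partial>lborel) = 0" for c d
  proof -
    let ?C = "cbox c d"
    have 1: "integrable lborel (\<lambda>x. indicator ?C x * dderiv f e x)"
        "(\<lambda>k. \<integral>x. indicator ?C x * dquot f e k x \<partial>lborel) \<longlonglongrightarrow> (\<integral>x. indicator ?C x * dderiv f e x \<partial>lborel)"
        "\<And>k. integrable lborel (\<lambda>x. indicator ?C x * dquot f e k x)" for e
    proof -
      have dom: "integrable lborel (\<lambda>x. L * norm e * indicator ?C x)"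
        by (intro integrable_mult_right integrable_real_indicator) (use emeasure_lborel_cbox_finite[of c d] in \<open>auto simp: less_top\<close>)
      have l: "AE x in lborel. (\<lambda>k. indicator ?C x * dquot f e k x) \<longlonglongrightarrow> indicator ?C x * dderiv f e x"
        using lim[of e] by eventually_elim (intro tendsto_intros)
      have bd: "\<And>k. AE x in lborel. norm (indicator ?C x * dquot f e k x) \<le> L * norm e * indicator ?C x"
        using dquot_bound by (auto simp: indicator_def)
      show "integrable lborel (\<lambda>x. indicator ?C x * dderiv f e x)"
        by (rule integrable_dominated_convergence[OF _ _ dom l bd]) measurable
      show "(\<lambda>k. \<integral>x. indicator ?C x * dquot f e k x \<partial>lborel) \<longlonglongrightarrow> (\<integral>x. indicator ?C x * dderiv f e x \<partial>lborel)"
        by (rule integral_dominated_convergence[OF _ _ dom l bd]) measurable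
      show "integrable lborel (\<lambda>x. indicator ?C x * dquot f e k x)" for k
        by (rule integrable_dominated_convergence2[OF _ _ dom l bd]) measurable
    qed
    define sh where "sh k = (1 / real (Suc k)) *\<^sub>R b" for k
    define t where "t k x = indicator ?C (x - sh k) * dquot f a k x" for k x
    obtain R where R: "\<forall>x\<in>?C. norm x \<le> R" using bounded_cbox[of c d] unfolding bounded_iff by blast
    have t: "(\<lambda>k. \<integral>x. t k x \<partial>lborel) \<longlonglongrightarrow> (\<integral>x. indicator ?C x * dderiv f a x \<partial>lborel)"
    proof (rule integral_dominated_convergence)
      \<comment> \<open>All shifted boxes lie in this ball, since
        \<open>norm (sh k) \<le> norm b\<close>; it gives one dominating function for every
        \<open>k\<close>.\<close>
      let ?B = "cball 0 (R + norm b) :: 'a set"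
      show "integrable lborel (\<lambda>x. L * norm a * indicator ?B x)"
        by (intro integrable_mult_right integrable_real_indicator) (use emeasure_lborel_cball_finite[of 0 "R + norm b"] in \<open>auto simp: less_top\<close>)
      show "AE x in lborel. norm (t k x) \<le> L * norm a * indicator ?B x" for k
      proof (rule AE_I2)
        fix x
        have "x \<in> ?B" if "x - sh k \<in> ?C"
        proof -
          have "norm (sh k) \<le> norm b" by (simp add: sh_def field_simps)
          moreover have "norm (x - sh k) \<le> R" using R that by auto
          ultimately show ?thesis using norm_triangle_sub[of x "sh k"] by simp
        qed
        then show "norm (t k x) \<le> L * norm a * indicator ?B x"
          using dquot_bound L_nonneg by (auto simp: t_def indicator_def)
      qed
      \<comment> \<open>Off the boundary of the box the shifted indicators are eventually
        constant.\<close>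
      have "negligible (frontier ?C)" by (simp add: negligible_frontier_interval frontier_cbox)
      then have "AE x in lborel. x \<notin> frontier ?C"
        by (intro AE_I'[of "frontier ?C"]) (auto simp: negligible_iff_null_sets null_sets_def emeasure_completion)
      then show "AE x in lborel. (\<lambda>k. t k x) \<longlonglongrightarrow> indicator ?C x * dderiv f a x"
        using lim[of a]
      proof eventually_elim
        case (elim x)
        have "(\<lambda>k. sh k) \<longlonglongrightarrow> 0 *\<^sub>R b" unfolding sh_def
          using LIMSEQ_inverse_real_of_nat by (intro tendsto_intros) (simp add: inverse_eq_divide)
        then have sh: "(\<lambda>k. x - sh k) \<longlonglongrightarrow> x" by (auto intro!: tendsto_eq_intros)
        have "\<forall>\<^sub>F k in sequentially. (indicator ?C (x - sh k) :: real) = indicator ?C x"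
        proof (cases "x \<in> ?C")
          case True
          then have "x \<in> interior ?C" using elim(1) by (auto simp: frontier_def closure_cbox)
          then have "\<forall>\<^sub>F k in sequentially. x - sh k \<in> interior ?C"
            using sh topological_tendstoD open_interior by blast
          then show ?thesis
            by (rule eventually_mono) (use True box_subset_cbox[of c d] in \<open>auto simp: indicator_def\<close>)
        next
          case False
          then have "\<forall>\<^sub>F k in sequentially. x - sh k \<in> - ?C"
            using topological_tendstoD[OF sh, of "- ?C"] closed_cbox by (auto simp: open_Compl)
          then show ?thesis by (rule eventually_mono) (use False in auto)
        qed
        then have "(\<lambda>k. indicator ?C (x - sh k) :: real) \<longlonglongrightarrow> indicator ?C x"
          by (rule tendsto_eventually)
        then show ?case unfolding t_def by (intro tendsto_mult elim(2))
      qed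
    qed (auto simp: t_def[abs_def])
    have tint: "integrable lborel (\<lambda>x. indicator ?C x * dquot f a k (sh k + x)) \<and>
        (\<integral>x. indicator ?C x * dquot f a k (sh k + x) \<partial>lborel) = (\<integral>x. t k x \<partial>lborel)" for k
    proof -
      have "(\<integral>x. t k x \<partial>lborel) = (\<integral>x. t k x \<partial>distr lborel borel ((+) (sh k)))"
        by (simp add: lborel_distr_plus)
      also have "\<dots> = (\<integral>x. t k (sh k + x) \<partial>lborel)"
        by (subst integral_distr) (auto simp: t_def[abs_def])
      finally have "(\<integral>x. indicator ?C x * dquot f a k (sh k + x) \<partial>lborel) = (\<integral>x. t k x \<partial>lborel)"
        by (simp add: t_def)
      moreover have "integrable lborel (\<lambda>x. indicator ?C x * dquot f a k (sh k + x))"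
      proof (rule Bochner_Integration.integrable_bound)
        show "integrable lborel (\<lambda>x. L * norm a * indicator ?C x)"
          by (intro integrable_mult_right integrable_real_indicator) (use emeasure_lborel_cbox_finite[of c d] in \<open>auto simp: less_top\<close>)
        show "AE x in lborel. norm (indicator ?C x * dquot f a k (sh k + x)) \<le> norm (L * norm a * indicator ?C x)"
          using dquot_bound L_nonneg by (auto simp: indicator_def)
      qed measurable
      ultimately show ?thesis by blast
    qed
    have split: "dquot f (a + b) k x = dquot f a k (sh k + x) + dquot f b k x" for k x
      by (simp add: dquot_def sh_def algebra_simps)
    have "(\<integral>x. indicator ?C x * dquot f (a + b) k x \<partial>lborel)
        = (\<integral>x. t k x \<partial>lborel) + (\<integral>x. indicator ?C x * dquot f b k x \<partial>lborel)" for k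
      using tint[of k] 1(3)[of b k] by (simp add: split distrib_left)
    then have "(\<lambda>k. \<integral>x. indicator ?C x * dquot f (a + b) k x \<partial>lborel) \<longlonglongrightarrow>
        (\<integral>x. indicator ?C x * dderiv f a x \<partial>lborel) + (\<integral>x. indicator ?C x * dderiv f b x \<partial>lborel)"
      using tendsto_add[OF t 1(2)[of b]] by simp
    then have "(\<integral>x. indicator ?C x * dderiv f (a + b) x \<partial>lborel) =
        (\<integral>x. indicator ?C x * dderiv f a x \<partial>lborel) + (\<integral>x. indicator ?C x * dderiv f b x \<partial>lborel)"
      using LIMSEQ_unique 1(2)[of "a + b"] by blast
    then show ?thesis
      using 1(1)[of a] 1(1)[of b] 1(1)[of "a + b"] by (simp add: w_def right_diff_distrib)
  qed
  have wint: "(w has_integral 0) (cbox c d)" for c d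
  proof -
    have "((\<lambda>x. indicator (cbox c d) x * w x) has_integral 0) UNIV"
      using w0[of c d] has_integral_integral_lborel by metis
    moreover have "(\<lambda>x. if x \<in> cbox c d then w x else 0) = (\<lambda>x. indicator (cbox c d) x * w x)"
      by (auto simp: indicator_def)
    ultimately show ?thesis
      by (simp flip: has_integral_restrict_UNIV[of "cbox c d" w])
  qed
  \<comment> \<open>The averages of \<open>w\<close> over small cubes at \<open>x\<close> are all 0,
    and they converge to \<open>w x\<close> for almost every \<open>x\<close>.\<close>
  then have "w integrable_on cbox c d" for c d by blast
  then obtain N where N: "negligible N" and leb: "\<And>x e. \<lbrakk>x \<notin> N; 0 < e\<rbrakk> \<Longrightarrow>
     \<exists>d>0. \<forall>h. 0 < h \<and> h < d \<longrightarrow> norm (integral (cbox x (x + h *\<^sub>R One)) w /\<^sub>R h ^ DIM('a) - w x) < e"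
    using integrable_ccontinuous_explicit[of w] by blast
  have "w x = 0" if x: "x \<notin> N" for x
  proof (rule ccontr)
    assume "w x \<noteq> 0"
    then obtain d where "d > 0" "\<forall>h. 0 < h \<and> h < d \<longrightarrow> norm (integral (cbox x (x + h *\<^sub>R One)) w /\<^sub>R h ^ DIM('a) - w x) < \<bar>w x\<bar>"
      using leb[OF x, of "\<bar>w x\<bar>"] by auto
    from this(1) this(2)[rule_format, of "d / 2"] integral_unique[OF wint[of x "x + (d / 2) *\<^sub>R One"]]
    show False by simp
  qed
  then have "AE x in lebesgue. w x = 0"
    using N by (intro AE_I'[of N]) (auto simp: negligible_iff_null_sets)
  then have "AE x in lborel. w x = 0" by (simp add: AE_completion_iff w_def)
  then show ?thesis by eventually_elim (simp add: w_def)
qed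

lemma dderiv_0 [simp]: "dderiv f 0 x = 0"
  by (simp add: dderiv_def dquot_def)

text \<open>The step sizes \<open>1 / (k + 1)\<close> are not invariant under scaling, so the
  comparison goes through the limit over all \<open>h > 0\<close>, where \<open>h\<close> may be
  replaced by \<open>h * c\<close>.\<close>

lemma dderiv_scale_pos:
  assumes c: "c > 0" and conv: "convergent (\<lambda>k. dquot f b k x)" "convergent (\<lambda>k. dquot f (c *\<^sub>R b) k x)"
  shows "dderiv f (c *\<^sub>R b) x = c * dderiv f b x"
proof -
  have "filterlim (\<lambda>h. h * c) (at_right 0) (at_right 0)"
    using c by (intro filterlim_at_withinI tendsto_eq_intros eventually_at_right_less[THEN eventually_mono]) auto
  from filterlim_compose[OF dderiv_at_right[OF conv(1)] this]
  have "((\<lambda>h. c * ((f (x + (h * c) *\<^sub>R b) - f x) / (h * c))) \<longlongrightarrow> c * dderiv f b x) (at_right 0)"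
    by (rule tendsto_mult_left)
  then have "((\<lambda>h. (f (x + h *\<^sub>R (c *\<^sub>R b)) - f x) / h) \<longlongrightarrow> c * dderiv f b x) (at_right 0)"
    using c by simp
  with dderiv_at_right[OF conv(2)] show ?thesis
    using tendsto_unique trivial_limit_at_right_real by blast
qed

text \<open>For \<open>c < 0\<close>, additivity at \<open>b + - b\<close> gives the derivative
  along \<open>- b\<close>, to which the positive factor \<open>- c\<close> applies.\<close>

lemma dderiv_scale_ae: "AE x in lborel. dderiv f (c *\<^sub>R b) x = c * dderiv f b x"
proof -
  have pos: "AE x in lborel. dderiv f (c *\<^sub>R b) x = c * dderiv f b x" if "c > 0" for c b
    using dquot_convergent_ae[of b] dquot_convergent_ae[of "c *\<^sub>R b"]
    by eventually_elim (rule dderiv_scale_pos[OF that])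
  consider "c > 0" | "c = 0" | "c < 0" by linarith
  then show ?thesis
  proof cases
    case 3
    have "AE x in lborel. dderiv f (b + - b) x = dderiv f b x + dderiv f (- b) x"
      by (rule dderiv_add_ae)
    moreover have "AE x in lborel. dderiv f ((- c) *\<^sub>R (- b)) x = - c * dderiv f (- b) x"
      by (rule pos) (use 3 in simp)
    ultimately show ?thesis
    proof eventually_elim
      case (elim x)
      then have "dderiv f (- b) x = - dderiv f b x" by simp
      with elim(2) show ?case by simp
    qed
  qed (use pos in auto)
qed

lemma dderiv_sum_ae: "AE x in lborel. dderiv f e x = (\<Sum>b\<in>Basis. (e \<bullet> b) * dderiv f b x)"
proof -
  have "AE x in lborel. dderiv f (\<Sum>b\<in>S. (e \<bullet> b) *\<^sub>R b) x = (\<Sum>b\<in>S. (e \<bullet> b) * dderiv f b x)" if "finite S" for S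
    using that
  proof (induction S)
    case (insert b S)
    have "AE x in lborel. dderiv f ((e \<bullet> b) *\<^sub>R b + (\<Sum>b\<in>S. (e \<bullet> b) *\<^sub>R b)) x
        = dderiv f ((e \<bullet> b) *\<^sub>R b) x + dderiv f (\<Sum>b\<in>S. (e \<bullet> b) *\<^sub>R b) x"
      by (rule dderiv_add_ae)
    then show ?case using insert.IH dderiv_scale_ae[of "e \<bullet> b" b]
      by eventually_elim (use insert.hyps in simp)
  qed simp
  from this[OF finite_Basis] show ?thesis by (simp add: euclidean_representation)
qed

text \<open>Off one null set the directional derivatives exist along a countable dense set of
  directions and are given by one vector \<open>G\<close>. Compactness of the unit sphere reduces
  all directions to finitely many of these, and the Lipschitz bound makes the error uniform.\<close>

lemma rademacher_real: "AE x in lborel. f differentiable (at x)"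
proof -
  obtain Q :: "'a set" where Q: "countable Q" "\<And>X. open X \<Longrightarrow> X \<noteq> {} \<Longrightarrow> \<exists>d\<in>Q. d \<in> X"
    using countable_dense_exists by blast
  have "AE x in lborel. \<forall>e\<in>Q. convergent (\<lambda>k. dquot f e k x) \<and> dderiv f e x = (\<Sum>b\<in>Basis. (e \<bullet> b) * dderiv f b x)"
    using Q(1) dquot_convergent_ae dderiv_sum_ae by (auto simp: AE_ball_countable)
  then show ?thesis
  proof eventually_elim
    case (elim x)
    define G where "G = (\<Sum>b\<in>Basis. dderiv f b x *\<^sub>R b)"
    have G: "G \<bullet> e = (\<Sum>b\<in>Basis. (e \<bullet> b) * dderiv f b x)" for e
      by (simp add: G_def inner_sum_right inner_commute[of _ e] mult.commute)
    have lim: "((\<lambda>h. (f (x + h *\<^sub>R e) - f x) / h) \<longlongrightarrow> G \<bullet> e) (at_right 0)" if "e \<in> Q" for e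
      using dderiv_at_right[of e x] elim that G by auto
    have "(f has_derivative (\<lambda>h. G \<bullet> h)) (at x)"
      unfolding has_derivative_at_alt
    proof (intro conjI allI impI bounded_linear_inner_right)
      fix \<epsilon> :: real assume \<epsilon>: "\<epsilon> > 0"
      \<comment> \<open>Replacing a unit direction by one of the net at distance less than
        \<open>\<delta>\<close> costs at most
        \<open>(L + norm G) * \<delta> \<le> \<epsilon> / 2\<close> relative to \<open>h\<close>;
        the added 1 avoids division by 0.\<close>
      define \<delta> where "\<delta> = \<epsilon> / (2 * (L + norm G + 1))"
      have \<delta>: "\<delta> > 0" using \<epsilon> L_nonneg by (simp add: \<delta>_def add_nonneg_pos)
      have "sphere 0 1 \<subseteq> (\<Union>e\<in>Q. ball e \<delta>)"
      proof
        fix z :: 'a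
        have "ball z \<delta> \<noteq> {}" using \<delta> by simp
        from Q(2)[OF open_ball this] show "z \<in> (\<Union>e\<in>Q. ball e \<delta>)" by (auto simp: dist_commute)
      qed
      then obtain S where S: "S \<subseteq> Q" "finite S" "sphere 0 1 \<subseteq> (\<Union>e\<in>S. ball e \<delta>)"
        using compactE_image[of "sphere (0::'a) 1" Q "\<lambda>e. ball e \<delta>"] by auto
      have "\<forall>\<^sub>F h in at_right 0. \<forall>e\<in>S. dist ((f (x + h *\<^sub>R e) - f x) / h) (G \<bullet> e) < \<epsilon> / 2"
        using S(1,2) lim \<epsilon> by (intro eventually_ball_finite ballI tendstoD) auto
      then obtain d where d: "d > 0" and dd: "\<And>h e. 0 < h \<Longrightarrow> h < d \<Longrightarrow> e \<in> S \<Longrightarrow>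
          dist ((f (x + h *\<^sub>R e) - f x) / h) (G \<bullet> e) < \<epsilon> / 2"
        by (auto simp: eventually_at_right_field)
      show "\<exists>d>0. \<forall>y. norm (y - x) < d \<longrightarrow> norm (f y - f x - G \<bullet> (y - x)) \<le> \<epsilon> * norm (y - x)"
      proof (intro exI[of _ d] conjI d allI impI)
        fix y assume y: "norm (y - x) < d"
        show "norm (f y - f x - G \<bullet> (y - x)) \<le> \<epsilon> * norm (y - x)"
        proof (cases "y = x")
          case False
          define h where "h = norm (y - x)"
          have h: "h > 0" using False by (simp add: h_def)
          define e0 where "e0 = (y - x) /\<^sub>R h"
          have "e0 \<in> sphere 0 1" using h by (simp add: e0_def h_def)
          then obtain e where e: "e \<in> S" "norm (e0 - e) < \<delta>" using S(3) by (auto simp: dist_norm norm_minus_commute)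
          have yx: "y = x + h *\<^sub>R e0" using h by (simp add: e0_def)
          have 1: "\<bar>f (x + h *\<^sub>R e) - f x - h * (G \<bullet> e)\<bar> \<le> \<epsilon> / 2 * h"
          proof -
            have "\<bar>f (x + h *\<^sub>R e) - f x - h * (G \<bullet> e)\<bar> = \<bar>(f (x + h *\<^sub>R e) - f x) / h - G \<bullet> e\<bar> * h"
            proof -
              have "f (x + h *\<^sub>R e) - f x - h * (G \<bullet> e) = ((f (x + h *\<^sub>R e) - f x) / h - G \<bullet> e) * h"
                using h by (simp add: field_simps)
              then show ?thesis using h by (simp add: abs_mult)
            qed
            also have "\<dots> \<le> \<epsilon> / 2 * h"
              using dd[OF h _ e(1)] y h by (intro mult_right_mono) (auto simp: h_def dist_real_def)
            finally show ?thesis .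
          qed
          have 2: "\<bar>f (x + h *\<^sub>R e0) - f (x + h *\<^sub>R e)\<bar> \<le> L * (h * \<delta>)"
          proof -
            have "\<bar>f (x + h *\<^sub>R e0) - f (x + h *\<^sub>R e)\<bar> \<le> L * norm (h *\<^sub>R (e0 - e))"
              using lip[of "x + h *\<^sub>R e0" "x + h *\<^sub>R e"] by (simp add: scaleR_diff_right)
            also have "\<dots> \<le> L * (h * \<delta>)"
              using e(2) h L_nonneg by (intro mult_left_mono) auto
            finally show ?thesis .
          qed
          have 3: "\<bar>h * (G \<bullet> e) - G \<bullet> (h *\<^sub>R e0)\<bar> \<le> norm G * (h * \<delta>)"
          proof -
            have "h * (G \<bullet> e) - G \<bullet> (h *\<^sub>R e0) = G \<bullet> (h *\<^sub>R (e - e0))"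
              by (simp add: inner_diff_right algebra_simps)
            also have "\<bar>\<dots>\<bar> \<le> norm G * norm (h *\<^sub>R (e - e0))" by (rule Cauchy_Schwarz_ineq2)
            also have "\<dots> \<le> norm G * (h * \<delta>)"
              using e(2) h by (intro mult_left_mono) (auto simp: norm_minus_commute)
            finally show ?thesis .
          qed
          have "norm (f y - f x - G \<bullet> (y - x)) \<le> \<epsilon> / 2 * h + L * (h * \<delta>) + norm G * (h * \<delta>)"
            using 1 2 3 unfolding yx real_norm_def add_diff_cancel_left' by linarith
          also have "\<dots> = (\<epsilon> / 2 + (L + norm G) * \<delta>) * h" by (simp add: algebra_simps)
          also have "\<dots> \<le> \<epsilon> * h"
          proof (rule mult_right_mono)
            have "(L + norm G) * \<delta> \<le> (L + norm G + 1) * \<delta>" using \<delta> by simp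
            also have "\<dots> = \<epsilon> / 2" using L_nonneg by (simp add: \<delta>_def add_nonneg_eq_0_iff field_simps)
            finally show "\<epsilon> / 2 + (L + norm G) * \<delta> \<le> \<epsilon>" by simp
          qed (use h in simp)
          finally show ?thesis by (simp add: h_def)
        qed simp
      qed
    qed
    then show ?case by (rule differentiableI)
  qed
qed

end

theorem rademacher:
  fixes F :: "'a::euclidean_space \<Rightarrow> 'b::euclidean_space"
  assumes lip: "\<And>x y. norm (F x - F y) \<le> L * norm (x - y)"
  shows "AE x in lborel. F differentiable (at x)"
proof -
  have "AE x in lborel. (\<lambda>x. F x \<bullet> b) differentiable (at x)" if "b \<in> Basis" for b
  proof (rule rademacher_real)
    fix x y
    show "\<bar>F x \<bullet> b - F y \<bullet> b\<bar> \<le> L * norm (x - y)"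
      using Basis_le_norm[OF that, of "F x - F y"] lip[of x y] by (simp add: inner_diff_left)
  qed
  then have "AE x in lborel. \<forall>b\<in>Basis. (\<lambda>x. F x \<bullet> b) differentiable (at x)"
    by (rule AE_finite_allI[OF finite_Basis])
  then show ?thesis
    by eventually_elim (rule differentiable_componentwise_within[THEN iffD2])
qed

section \<open>Viscosity subsolutions and quadratic test functions\<close>

lemma lsc_env_approx:
  assumes "lsc_env D F z \<le> 0" "0 < d" "0 < e"
  shows "\<exists>w\<in>D. dist z w < d \<and> F w < e"
proof -
  have "(INF w\<in>D \<inter> ball z d. ereal (F w)) \<le> lsc_env D F z"
    unfolding lsc_env_def by (rule SUP_upper) (use assms in simp)
  also have "\<dots> < ereal e" using assms by (simp add: order_le_less_trans)
  finally obtain w where "w \<in> D \<inter> ball z d" "ereal (F w) < ereal e"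
    using INF_less_iff[of "\<lambda>w. ereal (F w)"] by blast
  then show ?thesis by auto
qed

section \<open>The smallest eigenvalue as a bound for the quadratic form\<close>

lemma symmetric_matrix_inner:
  fixes A :: "real^'n^'n"
  assumes "transpose A = A"
  shows "(A *v x) \<bullet> y = x \<bullet> (A *v y)"
  by (metis assms dot_lmul_matrix transpose_matrix_vector)

text \<open>\<open>lambda_min\<close> is a \<open>Min\<close> and thus meaningful only for a finite
  set. Eigenvectors for distinct eigenvalues are orthogonal, hence independent.\<close>

lemma finite_eigenvalues_symmetric:
  fixes A :: "real^'n^'n"
  assumes A: "transpose A = A"
  shows "finite {l. \<exists>v. v \<noteq> 0 \<and> A *v v = l *s v}" (is "finite ?E")
proof -
  define ev where "ev l = (SOME v. v \<noteq> 0 \<and> A *v v = l *\<^sub>R v)" for l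
  have ev: "ev l \<noteq> 0" "A *v ev l = l *\<^sub>R ev l" if "l \<in> ?E" for l
    using that someI_ex[of "\<lambda>v. v \<noteq> 0 \<and> A *v v = l *\<^sub>R v"]
    by (auto simp: ev_def scalar_mult_eq_scaleR)
  have orth: "ev l \<bullet> ev m = 0" if "l \<in> ?E" "m \<in> ?E" "l \<noteq> m" for l m
  proof -
    have "l * (ev l \<bullet> ev m) = m * (ev l \<bullet> ev m)"
      using symmetric_matrix_inner[OF A, of "ev l" "ev m"] ev that(1,2) by auto
    then show ?thesis using that(3) by simp
  qed
  have inj: "inj_on ev ?E"
  proof (rule inj_onI, rule ccontr)
    fix l m assume lm: "l \<in> ?E" "m \<in> ?E" "ev l = ev m" "l \<noteq> m"
    show False using orth[OF lm(1,2,4)] lm(3) ev(1)[OF lm(1)] by simp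
  qed
  have "pairwise orthogonal (ev ` ?E)"
    by (auto simp: pairwise_def orthogonal_def intro!: orth)
  moreover have "0 \<notin> ev ` ?E"
    by (rule notI, erule imageE) (use ev(1) in force)
  ultimately have "independent (ev ` ?E)" by (rule pairwise_orthogonal_independent)
  then have "finite (ev ` ?E)" by (rule independent_imp_finite)
  then show ?thesis using inj by (rule finite_imageD)
qed

text \<open>A minimiser \<open>v0\<close> of the quadratic form on the unit sphere is an
  eigenvector, so its value \<open>m\<close> competes in the \<open>Min\<close>.\<close>

lemma lambda_min_lower_bound:
  fixes A :: "real^'n^'n"
  assumes A: "transpose A = A"
  shows "lambda_min A * (norm v)\<^sup>2 \<le> v \<bullet> (A *v v)"
proof -
  have "continuous_on (sphere 0 1) (\<lambda>v. v \<bullet> (A *v v))"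
    by (intro continuous_intros linear_continuous_on linear_conv_bounded_linear[THEN iffD1] matrix_vector_mul_linear)
  moreover have "sphere (0::real^'n) 1 \<noteq> {}" by simp
  ultimately obtain v0 :: "real^'n" where v0: "norm v0 = 1"
    and min: "\<And>v. norm v = 1 \<Longrightarrow> v0 \<bullet> (A *v v0) \<le> v \<bullet> (A *v v)"
    using continuous_attains_inf[OF compact_sphere] by (metis (no_types, lifting) mem_sphere_0)
  define m where "m = v0 \<bullet> (A *v v0)"
  have ray: "m * (norm v)\<^sup>2 \<le> v \<bullet> (A *v v)" for v
  proof (cases "v = 0")
    case False
    have "m \<le> (v /\<^sub>R norm v) \<bullet> (A *v (v /\<^sub>R norm v))"
      unfolding m_def by (rule min) (use False in simp)
    also have "\<dots> = (v \<bullet> (A *v v)) / (norm v)\<^sup>2"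
      by (simp add: matrix_vector_mult_scaleR power2_eq_square divide_inverse)
    finally show ?thesis using False by (simp add: pos_le_divide_eq)
  qed (simp add: m_def)
  define B where "B v = A *v v - m *\<^sub>R v" for v
  have Bpos: "0 \<le> v \<bullet> B v" for v
    using ray[of v] by (simp add: B_def inner_diff_right power2_norm_eq_inner)
  have B0: "v0 \<bullet> B v0 = 0"
    using v0 by (simp add: B_def inner_diff_right m_def[symmetric] norm_eq_1)
  \<comment> \<open>\<open>B\<close> is positive semidefinite and its form vanishes at
    \<open>v0\<close>. If \<open>w = B v0\<close> were nonzero, a suitable step from
    \<open>v0\<close> against \<open>w\<close> would make the form negative.\<close>
  have "B v0 = 0"
  proof (rule ccontr)
    assume nz: "B v0 \<noteq> 0"
    define w s c where "w = B v0" and "s = w \<bullet> w" and "c = w \<bullet> B w"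
    have s: "s > 0" using nz by (simp add: s_def w_def)
    have c: "c \<ge> 0" using Bpos by (simp add: c_def)
    have "v0 \<bullet> B w = B v0 \<bullet> w"
      by (simp add: B_def inner_diff_left inner_diff_right symmetric_matrix_inner[OF A])
    then have v0Bw: "v0 \<bullet> B w = s" by (simp add: s_def w_def)
    have exp: "(v0 + t *\<^sub>R w) \<bullet> B (v0 + t *\<^sub>R w) = 2 * t * s + t\<^sup>2 * c" for t
    proof -
      have "B (v0 + t *\<^sub>R w) = w + t *\<^sub>R B w"
        by (simp add: B_def w_def matrix_vector_right_distrib matrix_vector_mult_scaleR algebra_simps)
      then show ?thesis using v0Bw B0
        by (simp add: inner_add_left inner_add_right w_def[symmetric] s_def[symmetric] c_def[symmetric] power2_eq_square
            inner_commute[of w v0] algebra_simps) 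
    qed
    \<comment> \<open>Close to the minimiser \<open>- s / c\<close> of
      \<open>2 * t * s + t\<^sup>2 * c\<close>; the denominator \<open>c + 1\<close> covers
      \<open>c = 0\<close>.\<close>
    define t where "t = - s / (c + 1)"
    have "t * (c + 1) = - s" using c by (simp add: t_def)
    moreover have "2 * t * s + t\<^sup>2 * c \<ge> 0" using Bpos[of "v0 + t *\<^sub>R w"] by (simp add: exp)
    moreover have "t < 0" using s c by (simp add: t_def)
    ultimately have "2 * s + t * c \<le> 0"
      by (metis (no_types, opaque_lifting) distrib_left linorder_not_less mult.assoc mult.left_commute mult_neg_pos power2_eq_square)
    with \<open>t * (c + 1) = - s\<close> \<open>t < 0\<close> s show False by (simp add: algebra_simps)
  qed
  then have "A *v v0 = m *s v0" by (simp add: B_def scalar_mult_eq_scaleR)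
  then have "lambda_min A \<le> m"
    unfolding lambda_min_def
    by (intro Min_le finite_eigenvalues_symmetric[OF A]) (use v0 in \<open>auto intro!: exI[of _ v0]\<close>)
  then have "lambda_min A * (norm v)\<^sup>2 \<le> m * (norm v)\<^sup>2" by (intro mult_right_mono) auto
  with ray[of v] show ?thesis by linarith
qed

section \<open>Semicontinuity and passage to the envelope\<close>

lemma usc_onD:
  assumes "usc_on S u" "x \<in> S" "u x < a"
  obtains r where "r > 0" "\<And>y. y \<in> S \<Longrightarrow> dist x y < r \<Longrightarrow> u y < a"
proof -
  have "openin (top_of_set S) {x \<in> S. u x < a}" using assms by (simp add: usc_on_def)
  then obtain r where "r > 0" "ball x r \<inter> S \<subseteq> {x \<in> S. u x < a}"
    unfolding openin_contains_ball using assms by blast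
  then show thesis by (intro that[of r]) auto
qed

lemma lsc_onD:
  assumes "lsc_on S u" "x \<in> S" "a < u x"
  obtains r where "r > 0" "\<And>y. y \<in> S \<Longrightarrow> dist x y < r \<Longrightarrow> a < u y"
proof -
  have "openin (top_of_set S) {x \<in> S. u x > a}" using assms by (simp add: lsc_on_def)
  then obtain r where "r > 0" "ball x r \<inter> S \<subseteq> {x \<in> S. u x > a}"
    unfolding openin_contains_ball using assms by blast
  then show thesis by (intro that[of r]) auto
qed

lemma tendsto_matrix_vector_mult_left:
  fixes A :: "'i \<Rightarrow> real^'n^'m"
  assumes "(A \<longlongrightarrow> B) F"
  shows "((\<lambda>i. A i *v v) \<longlongrightarrow> B *v v) F"
  unfolding matrix_vector_mult_def
  by (intro tendsto_vec_lambda tendsto_sum tendsto_mult tendsto_vec_nth tendsto_const assms)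

lemma tendsto_det:
  fixes A :: "'i \<Rightarrow> real^'n^'n"
  assumes "(A \<longlongrightarrow> B) F"
  shows "((\<lambda>i. det (A i)) \<longlongrightarrow> det B) F"
  unfolding det_def
  by (intro tendsto_sum tendsto_mult tendsto_prod tendsto_vec_nth tendsto_const assms)

text \<open>The envelope only yields points \<open>w n\<close> close to \<open>(x, p, A)\<close> at
  which \<open>Fop\<close> is almost nonpositive; lower semicontinuity of \<open>f\<close> and upper
  semicontinuity of \<open>g\<close> are the directions in which the inequality survives the limit.
  The absolute value appears because the matrices \<open>As n\<close> are only almost positive
  semidefinite, so the sign of their determinants is unknown.\<close>

lemma lsc_env_Fop_le_0:
  fixes p :: "real^'n"
  assumes le: "lsc_env (Fdom X) (Fop f g H) (x, p, A) \<le> 0"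
    and x: "x \<in> X" and f: "lsc_on X f" and g: "usc_on UNIV g" "\<And>y. 0 \<le> g y" and H: "continuous_on UNIV H"
  shows "0 \<le> v \<bullet> (A *v v)" and "f x \<le> g p * \<bar>det A\<bar>" and "H p \<le> 0"
proof -
  have "\<exists>w\<in>Fdom X. dist (x, p, A) w < inverse (real (Suc n)) \<and> Fop f g H w < inverse (real (Suc n))" for n
    by (rule lsc_env_approx[OF le]) auto
  then obtain w where w: "\<And>n. w n \<in> Fdom X" "\<And>n. dist (x, p, A) (w n) < inverse (real (Suc n))"
      "\<And>n. Fop f g H (w n) < inverse (real (Suc n))" by metis
  define xs ps As where "xs n = fst (w n)" and "ps n = fst (snd (w n))" and "As n = snd (snd (w n))" for n
  have weq: "w n = (xs n, ps n, As n)" for n by (simp add: xs_def ps_def As_def)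
  have wl: "w \<longlonglongrightarrow> (x, p, A)"
  proof (rule metric_LIMSEQ_I)
    fix r :: real assume "r > 0"
    then obtain N where N: "inverse (real (Suc N)) < r" using reals_Archimedean by blast
    show "\<exists>no. \<forall>n\<ge>no. dist (w n) (x, p, A) < r"
    proof (intro exI[of _ N] allI impI)
      fix n assume "n \<ge> N"
      then have "inverse (real (Suc n)) \<le> inverse (real (Suc N))" by (simp add: field_simps)
      with w(2)[of n] N show "dist (w n) (x, p, A) < r" unfolding dist_commute[of "w n"] by linarith
    qed
  qed
  have xl: "xs \<longlonglongrightarrow> x" using tendsto_fst[OF wl] by (simp add: xs_def[abs_def])
  have pl: "ps \<longlonglongrightarrow> p" using tendsto_fst[OF tendsto_snd[OF wl]] by (simp add: ps_def[abs_def])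
  have Al: "As \<longlonglongrightarrow> A" using tendsto_snd[OF tendsto_snd[OF wl]] by (simp add: As_def[abs_def])
  have xX: "xs n \<in> X" and sym: "transpose (As n) = As n" for n
    using w(1)[of n] by (auto simp: Fdom_def weq)
  have F: "f (xs n) - g (ps n) * det (As n) < inverse (real (Suc n))"
      "- lambda_min (As n) < inverse (real (Suc n))" "H (ps n) < inverse (real (Suc n))" for n
    using w(3)[of n] by (auto simp: Fop_def weq)
  have e0: "(\<lambda>n. inverse (real (Suc n))) \<longlonglongrightarrow> 0" by (rule LIMSEQ_inverse_real_of_nat)
  show "H p \<le> 0"
  proof (rule LIMSEQ_le[OF _ e0])
    show "(\<lambda>n. H (ps n)) \<longlonglongrightarrow> H p"
      using H pl continuous_on_tendsto_compose[of UNIV H ps] by simp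
    show "\<exists>N. \<forall>n\<ge>N. H (ps n) \<le> inverse (real (Suc n))" using F(3) less_imp_le by blast
  qed
  show "0 \<le> v \<bullet> (A *v v)"
  proof -
    have "- 0 * (norm v)\<^sup>2 \<le> v \<bullet> (A *v v)"
    proof (rule LIMSEQ_le)
      show "(\<lambda>n. - inverse (real (Suc n)) * (norm v)\<^sup>2) \<longlonglongrightarrow> - 0 * (norm v)\<^sup>2"
        by (intro tendsto_intros e0)
      show "(\<lambda>n. v \<bullet> (As n *v v)) \<longlonglongrightarrow> v \<bullet> (A *v v)"
        by (intro tendsto_intros tendsto_matrix_vector_mult_left Al)
      have "- inverse (real (Suc n)) * (norm v)\<^sup>2 \<le> v \<bullet> (As n *v v)" for n
      proof -
        have "- inverse (real (Suc n)) * (norm v)\<^sup>2 \<le> lambda_min (As n) * (norm v)\<^sup>2"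
          using F(2)[of n] by (intro mult_right_mono) auto
        with lambda_min_lower_bound[OF sym, of n v] show ?thesis by linarith
      qed
      then show "\<exists>N. \<forall>n\<ge>N. - inverse (real (Suc n)) * (norm v)\<^sup>2 \<le> v \<bullet> (As n *v v)" by blast
    qed
    then show ?thesis by simp
  qed
  \<comment> \<open>The slack \<open>\<eta>\<close> makes both semicontinuity estimates hold for all
    large \<open>n\<close>; it is removed after the limit.\<close>
  have "f x - \<eta> \<le> (g p + \<eta>) * \<bar>det A\<bar>" if \<eta>: "\<eta> > 0" for \<eta>
  proof -
    obtain r1 where r1: "r1 > 0" "\<And>y. y \<in> X \<Longrightarrow> dist x y < r1 \<Longrightarrow> f x - \<eta> < f y"
      using lsc_onD[OF f x, of "f x - \<eta>"] \<eta> by auto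
    obtain r2 where r2: "r2 > 0" "\<And>y. dist p y < r2 \<Longrightarrow> g y < g p + \<eta>"
      using usc_onD[OF g(1) UNIV_I, of p "g p + \<eta>"] \<eta> by auto
    have ev: "\<forall>\<^sub>F n in sequentially. f x - \<eta> \<le> inverse (real (Suc n)) + (g p + \<eta>) * \<bar>det (As n)\<bar>"
      using tendstoD[OF xl r1(1)] tendstoD[OF pl r2(1)]
    proof eventually_elim
      case (elim n)
      have "f x - \<eta> < f (xs n)" using r1(2)[OF xX, of n] elim by (simp add: dist_commute)
      also have "\<dots> < inverse (real (Suc n)) + g (ps n) * det (As n)" using F(1)[of n] by simp
      also have "g (ps n) * det (As n) \<le> g (ps n) * \<bar>det (As n)\<bar>" using g(2) by (intro mult_left_mono) auto
      also have "\<dots> \<le> (g p + \<eta>) * \<bar>det (As n)\<bar>"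
        using r2(2)[of "ps n"] elim by (intro mult_right_mono) (auto simp: dist_commute)
      finally show ?case by simp
    qed
    have "(\<lambda>n. inverse (real (Suc n)) + (g p + \<eta>) * \<bar>det (As n)\<bar>) \<longlonglongrightarrow> 0 + (g p + \<eta>) * \<bar>det A\<bar>"
      by (intro tendsto_intros e0 tendsto_det Al)
    from tendsto_le[OF _ this tendsto_const ev] show ?thesis by simp
  qed
  note approx = this
  show "f x \<le> g p * \<bar>det A\<bar>"
  proof (rule field_le_epsilon)
    fix e :: real assume "e > 0"
    define \<eta> where "\<eta> = e / (1 + \<bar>det A\<bar>)"
    have "\<eta> > 0" using \<open>e > 0\<close> by (simp add: \<eta>_def add_pos_nonneg)
    moreover have "\<eta> * (1 + \<bar>det A\<bar>) = e" using abs_ge_zero[of "det A"] by (simp add: \<eta>_def)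
    ultimately show "f x \<le> g p * \<bar>det A\<bar> + e" using approx[of \<eta>] by (simp add: algebra_simps)
  qed
qed

lemma matrix_apply:
  fixes L :: "real^'n \<Rightarrow> real^'m"
  shows "linear L \<Longrightarrow> matrix L *v x = L x"
  by (simp add: matrix_works linear_matrix_vector_mul_eq)

lemma C2_with_quadratic:
  fixes L :: "real^'n \<Rightarrow> real^'n"
  assumes L: "linear L" and sa: "\<And>x y. L x \<bullet> y = x \<bullet> L y"
  shows "C2_with (\<lambda>y. c + b \<bullet> (y - x0) + (y - x0) \<bullet> L (y - x0) / 2) (\<lambda>y. b + L (y - x0)) (\<lambda>_. matrix L)"
proof -
  have bl: "bounded_linear L" using L by (simp add: linear_conv_bounded_linear)
  have dL: "((\<lambda>y. L (y - x0)) has_derivative L) (at x)" for x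
    by (rule bounded_linear.has_derivative[OF bl, of "\<lambda>y. y - x0" "\<lambda>h. h" "at x"])
      (auto intro!: derivative_eq_intros)
  have id: "((\<lambda>y. y - x0) has_derivative (\<lambda>h. h)) (at x)" for x
    by (auto intro!: derivative_eq_intros)
  have "((\<lambda>y. (y - x0) \<bullet> L (y - x0)) has_derivative (\<lambda>h. (x - x0) \<bullet> L h + h \<bullet> L (x - x0))) (at x)" for x
    by (rule has_derivative_inner[OF id dL])
  from bounded_linear.has_derivative[OF bounded_linear_divide[of 2] this]
  have q: "((\<lambda>y. (y - x0) \<bullet> L (y - x0) / 2) has_derivative (\<lambda>h. ((x - x0) \<bullet> L h + h \<bullet> L (x - x0)) / 2)) (at x)" for x .
  have b: "((\<lambda>y. c + b \<bullet> (y - x0)) has_derivative (\<lambda>h. b \<bullet> h)) (at x)" for x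
    by (auto intro!: derivative_eq_intros)
  have "((\<lambda>y. c + b \<bullet> (y - x0) + (y - x0) \<bullet> L (y - x0) / 2) has_derivative (\<lambda>h. (b + L (x - x0)) \<bullet> h)) (at x)" for x
  proof (rule has_derivative_eq_rhs[OF has_derivative_add[OF b q]], rule ext)
    fix h
    show "b \<bullet> h + ((x - x0) \<bullet> L h + h \<bullet> L (x - x0)) / 2 = (b + L (x - x0)) \<bullet> h"
      using sa[of "x - x0" h] inner_commute[of h "L (x - x0)"] by (simp add: inner_add_left)
  qed
  moreover have "((\<lambda>y. b + L (y - x0)) has_derivative (\<lambda>h. matrix L *v h)) (at x)" for x
    by (rule has_derivative_eq_rhs[OF has_derivative_add[OF has_derivative_const dL]])
      (simp add: fun_eq_iff matrix_apply[OF L])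
  ultimately show ?thesis by (simp add: C2_with_def)
qed

section \<open>Consequences of touching from above by quadratics\<close>

locale viscosity_data =
  fixes X :: "(real^'n) set" and f g H u :: "real^'n \<Rightarrow> real"
  assumes X: "convex X" "open X"
    and f: "lsc_on X f" and g: "usc_on UNIV g" "\<And>y. 0 \<le> g y" and H: "continuous_on UNIV H"
    and u: "usc_on X u" "visc_sub X f g H u"
begin

text \<open>The quadratic is centred at \<open>x0\<close> while contact occurs at \<open>x\<close>:
  in the applications by maximisation, the contact point is not known when the quadratic is
  chosen.\<close>

lemma quadratic_touching:
  assumes L: "linear L" and sa: "\<And>x y. L x \<bullet> y = x \<bullet> L y"
    and x: "x \<in> X" and p: "p = b + L (x - x0)" and e: "e > 0"
    and max: "\<And>y. y \<in> X \<Longrightarrow> dist x y < e \<Longrightarrow>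
      u y - (b \<bullet> (y - x0) + (y - x0) \<bullet> L (y - x0) / 2) \<le> u x - (b \<bullet> (x - x0) + (x - x0) \<bullet> L (x - x0) / 2)"
  shows "0 \<le> v \<bullet> L v" and "f x \<le> g p * \<bar>det (matrix L)\<bar>" and "H p \<le> 0"
proof -
  have "lsc_env (Fdom X) (Fop f g H) (x, b + L (x - x0), matrix L) \<le> 0"
  proof -
    have "\<exists>e>0. \<forall>y\<in>X \<inter> ball x e. u y - (0 + b \<bullet> (y - x0) + (y - x0) \<bullet> L (y - x0) / 2)
        \<le> u x - (0 + b \<bullet> (x - x0) + (x - x0) \<bullet> L (x - x0) / 2)"
      using e max by (intro exI[of _ e]) auto
    with C2_with_quadratic[OF L sa, of 0 b x0] x u(2) show ?thesis
      unfolding visc_sub_def by blast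
  qed
  from lsc_env_Fop_le_0[OF this x f g H]
  show "0 \<le> v \<bullet> L v" "f x \<le> g p * \<bar>det (matrix L)\<bar>" "H p \<le> 0"
    by (simp_all add: p matrix_apply[OF L])
qed

text \<open>Were no point maximal, each \<open>x\<close> would be beaten on a whole neighbourhood by
  some \<open>Y x\<close>. Among the finitely many \<open>Y x\<close> of a subcover, the best would
  itself be beaten by another of them.\<close>

lemma usc_attains_max:
  assumes K: "compact K" "K \<noteq> {}" "K \<subseteq> X" and \<phi>: "continuous_on UNIV \<phi>"
  obtains x where "x \<in> K" "\<And>y. y \<in> K \<Longrightarrow> u y - \<phi> y \<le> u x - \<phi> x"
proof (rule ccontr)
  let ?w = "\<lambda>x. u x - \<phi> x"
  assume "\<not> thesis"
  then have "\<forall>x\<in>K. \<exists>y\<in>K. ?w x < ?w y" using that by (meson not_le)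
  then obtain Y where Y: "\<And>x. x \<in> K \<Longrightarrow> Y x \<in> K" "\<And>x. x \<in> K \<Longrightarrow> ?w x < ?w (Y x)" by metis
  have "\<exists>r>0. \<forall>z\<in>K. dist x z < r \<longrightarrow> ?w z < ?w (Y x)" if x: "x \<in> K" for x
  proof -
    define \<eta> where "\<eta> = (?w (Y x) - ?w x) / 2"
    have \<eta>: "\<eta> > 0" using Y(2)[OF x] by (simp add: \<eta>_def)
    obtain r1 where r1: "r1 > 0" "\<And>y. y \<in> X \<Longrightarrow> dist x y < r1 \<Longrightarrow> u y < u x + \<eta>"
      using usc_onD[OF u(1), of x "u x + \<eta>"] x K \<eta> by auto
    obtain r2 where r2: "r2 > 0" "\<And>y. dist y x < r2 \<Longrightarrow> dist (\<phi> y) (\<phi> x) < \<eta>"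
      using \<phi>[unfolded continuous_on_iff] \<eta> by (metis UNIV_I)
    have "?w z < ?w (Y x)" if "z \<in> K" "dist x z < min r1 r2" for z
    proof -
      have "u z < u x + \<eta>" using r1(2)[of z] that K by auto
      moreover have "\<phi> z > \<phi> x - \<eta>" using r2(2)[of z] that by (auto simp: dist_commute dist_real_def)
      ultimately show ?thesis by (simp add: \<eta>_def field_simps)
    qed
    then show ?thesis using r1(1) r2(1) by (intro exI[of _ "min r1 r2"]) auto
  qed
  then obtain r where r: "\<And>x. x \<in> K \<Longrightarrow> r x > 0" "\<And>x z. x \<in> K \<Longrightarrow> z \<in> K \<Longrightarrow> dist x z < r x \<Longrightarrow> ?w z < ?w (Y x)"
    by metis
  have "K \<subseteq> (\<Union>x\<in>K. ball x (r x))" using r(1) by force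
  then obtain S where S: "S \<subseteq> K" "finite S" "K \<subseteq> (\<Union>x\<in>S. ball x (r x))"
    using compactE_image[OF K(1), of K "\<lambda>x. ball x (r x)"] by auto
  have "S \<noteq> {}" using S(3) K(2) by auto
  then obtain x where x: "x \<in> S" "\<And>y. y \<in> S \<Longrightarrow> ?w (Y y) \<le> ?w (Y x)"
  proof -
    have "Max ((\<lambda>x. ?w (Y x)) ` S) \<in> (\<lambda>x. ?w (Y x)) ` S"
      using S(2) \<open>S \<noteq> {}\<close> by (intro Max_in) auto
    then obtain x where x: "x \<in> S" "Max ((\<lambda>x. ?w (Y x)) ` S) = ?w (Y x)" by (rule imageE)
    have "?w (Y y) \<le> ?w (Y x)" if "y \<in> S" for y
      unfolding x(2)[symmetric] by (rule Max_ge) (use S(2) that in auto)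
    with x(1) show thesis by (rule that)
  qed
  have "Y x \<in> K" using x(1) S(1) Y(1) by blast
  then obtain y where "y \<in> S" "dist y (Y x) < r y" using S(3) by auto
  then have "?w (Y x) < ?w (Y y)" using r(2) S(1) \<open>Y x \<in> K\<close> by blast
  with x(2)[OF \<open>y \<in> S\<close>] show False by simp
qed

text \<open>Serves to exclude an empty \<open>Y\<close>, for which \<open>H\<close> would be
  positive everywhere. A steep paraboloid touches \<open>u\<close> from above in the interior of a
  ball, and its gradient at the contact point is the required \<open>p\<close>.\<close>

lemma H_nonpositive_somewhere:
  assumes "X \<noteq> {}"
  shows "\<exists>p. H p \<le> 0"
proof -
  obtain x0 r where x0: "x0 \<in> X" and r: "r > 0" "cball x0 r \<subseteq> X"
    using assms X(2) open_contains_cball by blast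
  obtain xm where "xm \<in> cball x0 r" and C: "\<And>y. y \<in> cball x0 r \<Longrightarrow> u y \<le> u xm"
    using usc_attains_max[of "cball x0 r" "\<lambda>_. 0"] r by auto
  \<comment> \<open>On the sphere of radius \<open>r\<close> the difference is at most
    \<open>u xm - M * r\<^sup>2 = u x0 - 1\<close>, below its value at the centre, so the maximum is
    interior.\<close>
  define M where "M = (u xm - u x0 + 1) / r\<^sup>2"
  define L :: "real^'n \<Rightarrow> real^'n" where "L v = (2 * M) *\<^sub>R v" for v
  have L: "linear L" "\<And>x y. L x \<bullet> y = x \<bullet> L y"
    unfolding L_def[abs_def] by (auto intro!: linearI simp: algebra_simps)
  have q: "0 \<bullet> (y - x0) + (y - x0) \<bullet> L (y - x0) / 2 = M * (norm (y - x0))\<^sup>2" for y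
    by (simp add: L_def power2_norm_eq_inner)
  obtain x where x: "x \<in> cball x0 r"
    and max: "\<And>y. y \<in> cball x0 r \<Longrightarrow> u y - M * (norm (y - x0))\<^sup>2 \<le> u x - M * (norm (x - x0))\<^sup>2"
  proof (rule usc_attains_max[of "cball x0 r" "\<lambda>y. M * (norm (y - x0))\<^sup>2"])
    show "continuous_on UNIV (\<lambda>y. M * (norm (y - x0))\<^sup>2)" by (intro continuous_intros)
  qed (use r in auto)
  have "norm (x - x0) \<noteq> r"
  proof
    assume n: "norm (x - x0) = r"
    have "u x0 \<le> u x - M * r\<^sup>2" using max[of x0] n r by simp
    also have "M * r\<^sup>2 = u xm - u x0 + 1" using r by (simp add: M_def)
    finally show False using C[OF x] by simp
  qed
  then have "dist x0 x < r" using x by (simp add: dist_norm norm_minus_commute)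
  then have e: "r - dist x0 x > 0" by simp
  have "H (0 + L (x - x0)) \<le> 0"
  proof (rule quadratic_touching(3)[OF L _ refl e])
    show "x \<in> X" using x r by auto
    fix y assume "dist x y < r - dist x0 x"
    then have "y \<in> cball x0 r" using dist_triangle[of x0 y x] by simp
    then show "u y - (0 \<bullet> (y - x0) + (y - x0) \<bullet> L (y - x0) / 2) \<le> u x - (0 \<bullet> (x - x0) + (x - x0) \<bullet> L (x - x0) / 2)"
      unfolding q by (rule max)
  qed
  then show ?thesis by blast
qed

text \<open>If \<open>u\<close> exceeds its chord somewhere, then on a thin tube around the chord \<open>u\<close> is touched from
  above at an interior point by a quadratic that is strictly concave along the chord.\<close>

lemma convex_on_X: "convex_on X u"
proof (rule ccontr)
  assume "\<not> convex_on X u"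
  then obtain t x0 x1 where t: "0 < t" "t < 1" and x01: "x0 \<in> X" "x1 \<in> X"
    and gt: "(1 - t) * u x0 + t * u x1 < u ((1 - t) *\<^sub>R x0 + t *\<^sub>R x1)"
    using convex_onI[OF _ X(1), of u] by (meson not_le)
  define d where "d = x1 - x0"
  have d0: "d \<noteq> 0"
  proof
    assume "d = 0"
    then have "x1 = x0" by (simp add: d_def)
    then show False using gt by (simp add: algebra_simps flip: scaleR_left_distrib)
  qed
  \<comment> \<open>\<open>e\<close> is dual to \<open>d\<close>: \<open>s\<close> is the coordinate
    along the chord, 0 at \<open>x0\<close> and 1 at \<open>x1\<close>, and \<open>z\<close> is the
    component orthogonal to the chord.\<close>
  define e where "e = d /\<^sub>R (norm d)\<^sup>2"
  have de: "d \<bullet> e = 1" using d0 by (simp add: e_def power2_norm_eq_inner)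
  define s where "s y = (y - x0) \<bullet> e" for y
  define z where "z y = y - x0 - s y *\<^sub>R d" for y
  have sd: "(y - x0) \<bullet> d = s y * (norm d)\<^sup>2" for y
    using d0 by (simp add: s_def e_def)
  have nz: "(norm (z y))\<^sup>2 = (norm (y - x0))\<^sup>2 - (s y)\<^sup>2 * (norm d)\<^sup>2" for y
  proof -
    have "(norm (a - c *\<^sub>R d))\<^sup>2 = (norm a)\<^sup>2 - 2 * c * (a \<bullet> d) + c\<^sup>2 * (norm d)\<^sup>2" for a c
      unfolding power2_norm_eq_inner
      by (simp add: inner_diff_left inner_diff_right inner_commute power2_eq_square algebra_simps)
    from this[of "y - x0" "s y"] show ?thesis
      unfolding z_def sd by (simp add: power2_eq_square)
  qed
  define \<eta> where "\<eta> = u ((1 - t) *\<^sub>R x0 + t *\<^sub>R x1) - ((1 - t) * u x0 + t * u x1)"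
  have \<eta>: "\<eta> > 0" using gt by (simp add: \<eta>_def)
  have near: "\<exists>r>0. \<forall>v. norm v \<le> r \<longrightarrow> a + v \<in> X \<and> u (a + v) < u a + \<eta> / 2" if a: "a \<in> X" for a
  proof -
    obtain r1 where r1: "r1 > 0" "\<And>y. y \<in> X \<Longrightarrow> dist a y < r1 \<Longrightarrow> u y < u a + \<eta> / 2"
      using usc_onD[OF u(1) a, of "u a + \<eta> / 2"] \<eta> by auto
    obtain r2 where r2: "r2 > 0" "cball a r2 \<subseteq> X" using a X(2) open_contains_cball by blast
    show ?thesis
    proof (intro exI[of _ "min (r1 / 2) r2"] conjI allI impI)
      fix v :: "real^'n" assume v: "norm v \<le> min (r1 / 2) r2"
      then have "a + v \<in> cball a r2" by (simp add: dist_norm)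
      then show "a + v \<in> X" using r2 by auto
      then show "u (a + v) < u a + \<eta> / 2" using r1 v by (auto simp: dist_norm)
    qed (use r1 r2 in auto)
  qed
  obtain r0 r1 where r0: "r0 > 0" "\<And>v. norm v \<le> r0 \<Longrightarrow> x0 + v \<in> X \<and> u (x0 + v) < u x0 + \<eta> / 2"
    and r1: "r1 > 0" "\<And>v. norm v \<le> r1 \<Longrightarrow> x1 + v \<in> X \<and> u (x1 + v) < u x1 + \<eta> / 2"
    using near[OF x01(1)] near[OF x01(2)] by metis
  define r where "r = min r0 r1"
  have r: "r > 0" using r0 r1 by (simp add: r_def)
  define K where "K = {y. 0 \<le> s y \<and> s y \<le> 1 \<and> norm (z y) \<le> r}"
  have conts: "continuous_on UNIV s" "continuous_on UNIV z"
    unfolding s_def[abs_def] z_def[abs_def] by (intro continuous_intros)+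
  have yz: "y = x0 + s y *\<^sub>R d + z y" for y by (simp add: z_def)
  have KX: "K \<subseteq> X"
  proof
    fix y assume y: "y \<in> K"
    then have "x0 + z y \<in> X" "x1 + z y \<in> X" using r0(2)[of "z y"] r1(2)[of "z y"] by (auto simp: K_def r_def)
    then have "(1 - s y) *\<^sub>R (x0 + z y) + s y *\<^sub>R (x1 + z y) \<in> X"
      using X(1) y by (auto simp: K_def convex_alt)
    also have "(1 - s y) *\<^sub>R (x0 + z y) + s y *\<^sub>R (x1 + z y) = x0 + s y *\<^sub>R d + z y"
      by (simp add: d_def algebra_simps)
    finally show "y \<in> X" using yz[of y] by simp
  qed
  have "closed K"
    unfolding K_def by (intro closed_Collect_conj closed_Collect_le continuous_intros continuous_on_norm conts)
  moreover have "bounded K"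
  proof (rule boundedI)
    fix y assume y: "y \<in> K"
    have "norm y \<le> norm x0 + norm (s y *\<^sub>R d) + norm (z y)"
      by (subst yz[of y]) (rule order_trans[OF norm_triangle_ineq add_right_mono[OF norm_triangle_ineq]])
    also have "\<dots> \<le> norm x0 + norm d + r"
      using y by (intro add_mono) (auto simp: K_def intro: mult_left_le_one_le)
    finally show "norm y \<le> norm x0 + norm d + r" .
  qed
  ultimately have compK: "compact K" by (simp add: compact_eq_bounded_closed)
  define xt where "xt = (1 - t) *\<^sub>R x0 + t *\<^sub>R x1"
  have xtd: "xt - x0 = t *\<^sub>R d" by (simp add: xt_def d_def algebra_simps)
  have xts: "s xt = t" "z xt = 0" by (simp_all add: s_def z_def xtd de)
  have xtK: "xt \<in> K" using t r by (simp add: K_def xts)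
  obtain xm where C: "\<And>y. y \<in> K \<Longrightarrow> u y \<le> u xm"
    using usc_attains_max[OF compK _ KX continuous_on_const[of _ 0]] xtK by auto
  \<comment> \<open>Makes \<open>M * r\<^sup>2\<close> so large that the lateral boundary of the
    tube cannot carry the maximum.\<close>
  define M where "M = (\<bar>u xm\<bar> + \<bar>u x0\<bar> + \<bar>u x1\<bar>) / r\<^sup>2"
  have M: "M * r\<^sup>2 = \<bar>u xm\<bar> + \<bar>u x0\<bar> + \<bar>u x1\<bar>" using r by (simp add: M_def)
  have M0: "M \<ge> 0" using r by (simp add: M_def)
  \<comment> \<open>\<open>b\<close> and \<open>L\<close> produce the form of \<open>\<phi>\<close>
    proved below: interpolation of the end values up to a constant, a bump
    \<open>\<eta> * s * (1 - s)\<close> that is concave along the chord, and a steep penalty for the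
    distance from the chord.\<close>
  define b where "b = (u x1 - u x0 + \<eta>) *\<^sub>R e"
  define L :: "real^'n \<Rightarrow> real^'n" where "L v = (2 * M) *\<^sub>R v - ((2 * \<eta> + 2 * M * (norm d)\<^sup>2) * (v \<bullet> e)) *\<^sub>R e" for v
  have L: "linear L" "\<And>x y. L x \<bullet> y = x \<bullet> L y"
    unfolding L_def[abs_def]
    by (auto intro!: linearI simp: algebra_simps inner_add_left inner_diff_left inner_diff_right inner_commute)
  define \<phi> where "\<phi> y = b \<bullet> (y - x0) + (y - x0) \<bullet> L (y - x0) / 2" for y
  have \<phi>: "\<phi> y = s y * (u x1 - u x0) + \<eta> * s y * (1 - s y) + M * (norm (z y))\<^sup>2" for y
  proof -
    have "b \<bullet> a + a \<bullet> L a / 2 = (a \<bullet> e) * (u x1 - u x0) + \<eta> * (a \<bullet> e) * (1 - a \<bullet> e)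
        + M * ((norm a)\<^sup>2 - (a \<bullet> e)\<^sup>2 * (norm d)\<^sup>2)" for a
    proof -
      have 1: "b \<bullet> a = (u x1 - u x0 + \<eta>) * (a \<bullet> e)" by (simp add: b_def inner_commute)
      have 2: "a \<bullet> L a = 2 * M * (norm a)\<^sup>2 - (2 * \<eta> + 2 * M * (norm d)\<^sup>2) * (a \<bullet> e)\<^sup>2"
        by (simp add: L_def inner_diff_right power2_norm_eq_inner) (simp add: power2_eq_square)
      show ?thesis unfolding 1 2 by (simp add: power2_eq_square field_simps)
    qed
    then show ?thesis by (simp only: nz \<phi>_def s_def)
  qed
  have "continuous_on UNIV (\<lambda>y. s y * (u x1 - u x0) + \<eta> * s y * (1 - s y) + M * (norm (z y))\<^sup>2)"
    by (intro continuous_intros continuous_on_norm conts)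
  then have "continuous_on UNIV \<phi>" using \<phi> by presburger
  then obtain x where x: "x \<in> K" and max: "\<And>y. y \<in> K \<Longrightarrow> u y - \<phi> y \<le> u x - \<phi> x"
    using usc_attains_max[OF compK _ KX, of \<phi>] xtK by auto
  have "u xt = \<eta> + ((1 - t) * u x0 + t * u x1)" by (simp add: \<eta>_def xt_def)
  \<comment> \<open>At \<open>xt\<close> the function exceeds the chord by \<open>\<eta>\<close> and
    the bump takes back less than half of it, so more than \<open>\<eta> / 2\<close> remains; on the
    two end caps \<open>near\<close> leaves less than that.\<close>
  then have "u xt - \<phi> xt - u x0 = \<eta> * (1 - t * (1 - t))"
    by (simp add: \<phi> xts algebra_simps)
  moreover have "t * (1 - t) < 1 / 2"
  proof -
    have "0 \<le> (t - 1 / 2)\<^sup>2" by simp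
    then show ?thesis by (simp add: power2_eq_square algebra_simps)
  qed
  ultimately have "\<eta> / 2 < u xt - \<phi> xt - u x0" using \<eta> by simp
  with max[OF xtK] have big: "\<eta> / 2 < u x - \<phi> x - u x0" by simp
  have xx: "0 \<le> s x" "s x \<le> 1" "norm (z x) \<le> r" using x by (auto simp: K_def)
  have "s x \<noteq> 0"
  proof
    assume s0: "s x = 0"
    then have "u x < u x0 + \<eta> / 2" using r0(2)[of "z x"] xx yz[of x] by (simp add: r_def)
    moreover have "\<phi> x \<ge> 0" using M0 by (simp add: \<phi> s0)
    ultimately show False using big by simp
  qed
  moreover have "s x \<noteq> 1"
  proof
    assume s1: "s x = 1"
    then have "u x < u x1 + \<eta> / 2" using r1(2)[of "z x"] xx yz[of x] by (simp add: r_def d_def)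
    moreover have "\<phi> x \<ge> u x1 - u x0" using M0 by (simp add: \<phi> s1)
    ultimately show False using big by simp
  qed
  moreover have "norm (z x) \<noteq> r"
  proof
    assume n: "norm (z x) = r"
    have "s x * (u x1 - u x0) + u x0 = s x * u x1 + (1 - s x) * u x0" by (simp add: algebra_simps)
    moreover have "\<bar>s x * u x1 + (1 - s x) * u x0\<bar> \<le> \<bar>u x1\<bar> + \<bar>u x0\<bar>"
      using xx by (intro order_trans[OF abs_triangle_ineq] add_mono) (auto simp: abs_mult intro: mult_left_le_one_le)
    moreover have "\<eta> * s x * (1 - s x) \<ge> 0" using \<eta> xx by simp
    ultimately have "\<phi> x + u x0 \<ge> \<bar>u xm\<bar>" using n M by (simp add: \<phi>)
    with big C[OF x] \<eta> show False by simp
  qed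
  ultimately have "x \<in> {y. 0 < s y \<and> s y < 1 \<and> norm (z y) < r}" using xx by auto
  moreover have "open {y. 0 < s y \<and> s y < 1 \<and> norm (z y) < r}"
    by (intro open_Collect_conj open_Collect_less continuous_intros continuous_on_norm conts)
  ultimately obtain \<epsilon> where \<epsilon>: "\<epsilon> > 0" "ball x \<epsilon> \<subseteq> {y. 0 < s y \<and> s y < 1 \<and> norm (z y) < r}"
    using open_contains_ball by blast
  have "0 \<le> d \<bullet> L d"
  proof (rule quadratic_touching(1)[OF L _ refl \<epsilon>(1)])
    show "x \<in> X" using x KX by auto
    fix y assume "dist x y < \<epsilon>"
    then have "y \<in> K" using \<epsilon>(2) by (force simp: K_def)
    then show "u y - (b \<bullet> (y - x0) + (y - x0) \<bullet> L (y - x0) / 2) \<le> u x - (b \<bullet> (x - x0) + (x - x0) \<bullet> L (x - x0) / 2)"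
      using max by (simp add: \<phi>_def)
  qed
  moreover have "d \<bullet> L d = - 2 * \<eta>"
    by (simp add: L_def inner_diff_right de power2_norm_eq_inner algebra_simps)
  ultimately show False using \<eta> by simp
qed

end

section \<open>Subgradients and Minty's parametrisation\<close>

text \<open>McShane's extension: the lower envelope of the cones of slope \<open>L\<close> with
  vertices on the graph.\<close>

lemma mcshane_real:
  fixes f :: "'a::metric_space \<Rightarrow> real"
  assumes lip: "\<And>x y. x \<in> S \<Longrightarrow> y \<in> S \<Longrightarrow> \<bar>f x - f y\<bar> \<le> L * dist x y" and L: "0 \<le> L"
  obtains F where "\<And>x. x \<in> S \<Longrightarrow> F x = f x" "\<And>x y. \<bar>F x - F y\<bar> \<le> L * dist x y"
proof (cases "S = {}")
  case True
  then show ?thesis using that[of "\<lambda>_. 0"] L by simp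
next
  case False
  define F where "F x = (INF y\<in>S. f y + L * dist x y)" for x
  have low: "f z - L * dist x z \<le> f y + L * dist x y" if "y \<in> S" "z \<in> S" for x y z
  proof -
    have "f z - f y \<le> L * dist z y" using lip[OF that(2,1)] by simp
    also have "\<dots> \<le> L * (dist x z + dist x y)"
      using L by (intro mult_left_mono) (metis dist_commute dist_triangle2)
    finally show ?thesis by (simp add: algebra_simps)
  qed
  have bdd: "bdd_below ((\<lambda>y. f y + L * dist x y) ` S)" for x
  proof -
    obtain z where "z \<in> S" using False by blast
    then show ?thesis using low[of _ z x] by (intro bdd_belowI2) auto
  qed
  show ?thesis
  proof (rule that[of F])
    fix x assume x: "x \<in> S"
    show "F x = f x"
    proof (rule antisym)
      show "F x \<le> f x" unfolding F_def by (rule cINF_lower2[OF bdd x]) simp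
      show "f x \<le> F x" unfolding F_def using low[OF _ x, of _ x] False by (intro cINF_greatest) auto
    qed
  next
    fix x y
    have le: "F x \<le> F y + L * dist x y" for x y
    proof -
      have "F x - L * dist x y \<le> F y" unfolding F_def[of y]
      proof (rule cINF_greatest[OF False])
        fix z assume z: "z \<in> S"
        have "F x \<le> f z + L * dist x z" unfolding F_def by (rule cINF_lower[OF bdd z])
        also have "\<dots> \<le> f z + L * (dist x y + dist y z)"
          using L by (intro add_left_mono mult_left_mono dist_triangle) auto
        finally show "F x - L * dist x y \<le> f z + L * dist y z" by (simp add: algebra_simps)
      qed
      then show ?thesis by simp
    qed
    show "\<bar>F x - F y\<bar> \<le> L * dist x y"
      using le[of x y] le[of y x] by (simp add: abs_le_iff dist_commute)
  qed
qed

text \<open>Extension component by component; the resulting factor \<open>DIM('b)\<close> is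
  harmless, since any Lipschitz constant will do later.\<close>

lemma lipschitz_extension:
  fixes f :: "'a::real_normed_vector \<Rightarrow> 'b::euclidean_space"
  assumes lip: "\<And>x y. x \<in> S \<Longrightarrow> y \<in> S \<Longrightarrow> norm (f x - f y) \<le> L * norm (x - y)" and L: "0 \<le> L"
  obtains F where "\<And>x. x \<in> S \<Longrightarrow> F x = f x"
    "\<And>x y. norm (F x - F y) \<le> (real DIM('b) * L) * norm (x - y)"
proof -
  have "\<exists>F. (\<forall>x\<in>S. F x = f x \<bullet> b) \<and> (\<forall>x y. \<bar>F x - F y\<bar> \<le> L * norm (x - y))" if b: "b \<in> Basis" for b
  proof -
    have "\<bar>f x \<bullet> b - f y \<bullet> b\<bar> \<le> L * dist x y" if "x \<in> S" "y \<in> S" for x y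
      using Basis_le_norm[OF b, of "f x - f y"] lip[OF that] by (simp add: inner_diff_left dist_norm)
    from mcshane_real[OF this L] show ?thesis by (metis dist_norm)
  qed
  then obtain F where F: "\<And>b x. b \<in> Basis \<Longrightarrow> x \<in> S \<Longrightarrow> F b x = f x \<bullet> b"
    "\<And>b x y. b \<in> Basis \<Longrightarrow> \<bar>F b x - F b y\<bar> \<le> L * norm (x - y)" by metis
  define G where "G x = (\<Sum>b\<in>Basis. F b x *\<^sub>R b)" for x
  have G: "G x \<bullet> b = F b x" if "b \<in> Basis" for b x using that by (simp add: G_def)
  show ?thesis
  proof (rule that[of G])
    show "G x = f x" if "x \<in> S" for x by (rule euclidean_eqI) (simp add: G F that)
    fix x y
    have "norm (G x - G y) \<le> (\<Sum>b\<in>Basis. \<bar>(G x - G y) \<bullet> b\<bar>)" by (rule norm_le_l1)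
    also have "\<dots> \<le> (\<Sum>b\<in>(Basis::'b set). L * norm (x - y))"
      by (rule sum_mono) (use F(2) in \<open>simp add: inner_diff_left G\<close>)
    finally show "norm (G x - G y) \<le> (real DIM('b) * L) * norm (x - y)" by simp
  qed
qed

lemma quadratic_nonneg_linear_zero:
  fixes a b :: real
  assumes "\<And>s. 0 \<le> s * a + s\<^sup>2 * b"
  shows "a = 0"
proof (rule ccontr)
  assume a: "a \<noteq> 0"
  define s where "s = - a / (\<bar>b\<bar> + 1)"
  have s: "s * (\<bar>b\<bar> + 1) = - a" by (simp add: s_def add_pos_nonneg abs_add_one_gt_zero less_imp_neq[symmetric])
  have s0: "s \<noteq> 0" using a s by auto
  have "s * a + s\<^sup>2 * b \<le> s * a + s\<^sup>2 * \<bar>b\<bar>" by (simp add: mult_left_mono)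
  also have "\<dots> = s * (a + s * \<bar>b\<bar>)" by (simp add: power2_eq_square algebra_simps)
  also have "a + s * \<bar>b\<bar> = - s" using s by (simp add: algebra_simps)
  also have "s * (- s) < 0" using s0 by (simp add: zero_less_mult_iff less_le)
  finally show False using assms[of s] by simp
qed

text \<open>A discrete substitute for integration along a segment, valid for arbitrary
  \<open>G\<close>: over \<open>Suc n\<close> equal steps the \<open>G\<close> terms telescope and
  carry a factor \<open>1 / Suc n\<close>, so only \<open>c\<close> survives. It serves the second
  order expansion, with \<open>c\<close> the error, and the comparison of conjugates, with
  \<open>c = 0\<close>.\<close>

lemma increment_bound:
  fixes \<phi> G :: "real \<Rightarrow> real"
  assumes inc: "\<And>s t. 0 \<le> s \<Longrightarrow> s \<le> t \<Longrightarrow> t \<le> 1 \<Longrightarrow> \<bar>\<phi> t - \<phi> s\<bar> \<le> (t - s) * (G t - G s + c)"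
  shows "\<bar>\<phi> 1 - \<phi> 0\<bar> \<le> c"
proof -
  have tot: "\<bar>\<phi> 1 - \<phi> 0\<bar> \<le> (G 1 - G 0) * inverse (real (Suc n)) + c" for n
  proof -
    define N where "N = real (Suc n)"
    have N: "N > 0" by (simp add: N_def)
    let ?t = "\<lambda>k. real k / N"
    have tel: "(\<Sum>k<Suc n. h (?t (Suc k)) - h (?t k)) = h 1 - h 0" for h :: "real \<Rightarrow> real"
      using sum_lessThan_telescope[of "\<lambda>k. h (?t k)" "Suc n"] N
      by (simp add: N_def[symmetric] del: of_nat_Suc sum.lessThan_Suc)
    have "\<bar>\<phi> 1 - \<phi> 0\<bar> \<le> (\<Sum>k<Suc n. \<bar>\<phi> (?t (Suc k)) - \<phi> (?t k)\<bar>)"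
      unfolding tel[symmetric] by (rule sum_abs)
    also have "\<dots> \<le> (\<Sum>k<Suc n. (1 / N) * ((G (?t (Suc k)) - G (?t k)) + c))"
    proof (rule sum_mono)
      fix k assume k: "k \<in> {..<Suc n}"
      have d: "?t (Suc k) - ?t k = 1 / N" by (simp add: diff_divide_distrib[symmetric])
      have "\<bar>\<phi> (?t (Suc k)) - \<phi> (?t k)\<bar> \<le> (?t (Suc k) - ?t k) * (G (?t (Suc k)) - G (?t k) + c)"
        using k N by (intro inc) (auto simp: N_def divide_right_mono divide_le_eq)
      then show "\<bar>\<phi> (?t (Suc k)) - \<phi> (?t k)\<bar> \<le> (1 / N) * ((G (?t (Suc k)) - G (?t k)) + c)"
        by (simp only: d)
    qed
    also have "\<dots> = (1 / N) * ((G 1 - G 0) + N * c)"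
      by (simp only: sum_distrib_left[symmetric] sum.distrib tel) (simp add: N_def)
    also have "\<dots> = (G 1 - G 0) * inverse N + c" using N by (simp add: field_simps)
    finally show ?thesis by (simp add: N_def)
  qed
  have "(\<lambda>n. (G 1 - G 0) * inverse (real (Suc n)) + c) \<longlonglongrightarrow> (G 1 - G 0) * 0 + c"
    by (intro tendsto_intros LIMSEQ_inverse_real_of_nat)
  then have "\<bar>\<phi> 1 - \<phi> 0\<bar> \<le> (G 1 - G 0) * 0 + c"
    by (rule LIMSEQ_le_const) (use tot in blast)
  then show ?thesis by simp
qed

section \<open>Subgradients of a convex function on an open set\<close>

locale convex_function =
  fixes X :: "(real^'n) set" and u :: "real^'n \<Rightarrow> real"
  assumes open_X: "open X" and convex_u: "convex_on X u"
begin

lemma convex_X: "convex X"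
  using convex_u by (simp add: convex_on_def)

lemma cont_u: "continuous_on X u"
  using convex_on_continuous[OF open_X convex_u] .

lemma subgradD: "p \<in> subgrad X u z \<Longrightarrow> y \<in> X \<Longrightarrow> u z + p \<bullet> (y - z) \<le> u y"
  by (simp add: subgrad_def)

text \<open>Separates the epigraph from the vertical ray strictly below \<open>(x, u x)\<close>.
  Openness of \<open>X\<close> excludes a vertical hyperplane, and dividing by its last component
  gives the subgradient.\<close>

lemma subgrad_exists:
  assumes x: "x \<in> X"
  shows "\<exists>p. p \<in> subgrad X u x"
proof -
  let ?E = "epigraph X u" and ?T = "{x} \<times> {..<u x}"
  have "(x, u x) \<in> ?E" "(x, u x - 1) \<in> ?T" using x by (auto simp: epigraph_def)
  moreover have "?E \<inter> ?T = {}" by (auto simp: epigraph_def)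
  moreover have "convex ?E" using convex_u by (simp add: convex_epigraph convex_X)
  moreover have "convex ?T" by (intro convex_Times convex_singleton convex_real_interval)
  ultimately obtain c b where c: "c \<noteq> 0" "\<And>w. w \<in> ?E \<Longrightarrow> c \<bullet> w \<le> b" "\<And>w. w \<in> ?T \<Longrightarrow> b \<le> c \<bullet> w"
    using separating_hyperplane_sets[of ?E ?T] by (metis empty_iff)
  obtain \<alpha> \<beta> where ab: "c = (\<alpha>, \<beta>)" by (cases c)
  have 1: "\<alpha> \<bullet> y + \<beta> * r \<le> b" if "y \<in> X" "u y \<le> r" for y r
    using c(2)[of "(y, r)"] that by (simp add: ab epigraph_def)
  have 2: "b \<le> \<alpha> \<bullet> x + \<beta> * r" if "r < u x" for r
    using c(3)[of "(x, r)"] that by (simp add: ab)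
  have bu: "b \<le> \<alpha> \<bullet> x + \<beta> * u x"
  proof (rule field_le_epsilon)
    fix e :: real assume "e > 0"
    have "b \<le> \<alpha> \<bullet> x + \<beta> * (u x - e / (\<bar>\<beta>\<bar> + 1))" by (rule 2) (use \<open>e > 0\<close> in \<open>simp add: add_nonneg_pos\<close>)
    also have "\<dots> = \<alpha> \<bullet> x + \<beta> * u x - \<beta> / (\<bar>\<beta>\<bar> + 1) * e" by (simp add: algebra_simps)
    also have "\<dots> \<le> \<alpha> \<bullet> x + \<beta> * u x + e"
    proof -
      have "- (\<beta> / (\<bar>\<beta>\<bar> + 1)) \<le> 1" by (simp add: field_simps abs_if)
      then have "- (\<beta> / (\<bar>\<beta>\<bar> + 1)) * e \<le> 1 * e" using \<open>e > 0\<close> by (intro mult_right_mono) auto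
      then show ?thesis by simp
    qed
    finally show "b \<le> \<alpha> \<bullet> x + \<beta> * u x + e" .
  qed
  have "\<beta> \<le> 0"
    using order_trans[OF 1[OF x, of "u x + 1"] bu] by (simp add: algebra_simps)
  moreover have "\<beta> \<noteq> 0"
  proof
    assume b0: "\<beta> = 0"
    then have a0: "\<alpha> \<noteq> 0" using c(1) by (auto simp: ab zero_prod_def)
    obtain r where r: "r > 0" "cball x r \<subseteq> X" using open_X x open_contains_cball by blast
    have "x + (r / norm \<alpha>) *\<^sub>R \<alpha> \<in> X" using r a0 by (intro subsetD[OF r(2)]) (simp add: dist_norm)
    from order_trans[OF 1[OF this order_refl] bu] b0 have "(r / norm \<alpha>) * (\<alpha> \<bullet> \<alpha>) \<le> 0"
      by (simp add: inner_add_right)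
    moreover have "(r / norm \<alpha>) * (\<alpha> \<bullet> \<alpha>) > 0" using r a0 by simp
    ultimately show False by simp
  qed
  ultimately have bneg: "\<beta> < 0" by simp
  have "(1 / - \<beta>) *\<^sub>R \<alpha> \<in> subgrad X u x"
    unfolding subgrad_def
  proof (clarsimp)
    fix y assume y: "y \<in> X"
    have "\<alpha> \<bullet> (y - x) \<le> (- \<beta>) * (u y - u x)"
      using order_trans[OF 1[OF y order_refl] bu] by (simp add: inner_diff_right algebra_simps)
    then have "\<alpha> \<bullet> (y - x) / (- \<beta>) \<le> u y - u x"
      using bneg by (subst pos_divide_le_eq) (simp_all add: mult.commute)
    then show "u x - \<alpha> \<bullet> (y - x) / \<beta> \<le> u y" by simp
  qed
  then show ?thesis ..
qed

lemma subgrad_monotone: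
  assumes "z \<in> X" "w \<in> X" "p \<in> subgrad X u z" "q \<in> subgrad X u w"
  shows "0 \<le> (p - q) \<bullet> (z - w)"
  using subgradD[OF assms(3,2)] subgradD[OF assms(4,1)] by (simp add: inner_diff_left inner_diff_right)

lemma subgrad_convex: "convex (subgrad X u z)"
proof -
  have "subgrad X u z = (\<Inter>y\<in>X. {p. (y - z) \<bullet> p \<le> u y - u z})"
    by (auto simp: subgrad_def inner_commute algebra_simps)
  then show ?thesis by (simp add: convex_INT convex_halfspace_le)
qed

lemma subgrad_limit:
  assumes z: "z \<in> X" "\<And>n. zs n \<in> X" "zs \<longlonglongrightarrow> z" and p: "\<And>n. ps n \<in> subgrad X u (zs n)" "ps \<longlonglongrightarrow> p"
  shows "p \<in> subgrad X u z"
  unfolding subgrad_def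
proof (clarify)
  fix y assume y: "y \<in> X"
  have "(\<lambda>n. u (zs n)) \<longlonglongrightarrow> u z"
    using continuous_on_tendsto_compose[OF cont_u z(3,1)] z(2) by simp
  then have "(\<lambda>n. u (zs n) + ps n \<bullet> (y - zs n)) \<longlonglongrightarrow> u z + p \<bullet> (y - z)"
    by (intro tendsto_intros z p)
  then show "u z + p \<bullet> (y - z) \<le> u y"
    by (rule LIMSEQ_le_const2) (use subgradD[OF p(1) y] in blast)
qed

text \<open>A step of length \<open>r / 2\<close> in the direction of \<open>p\<close> raises
  \<open>u\<close> by at least \<open>r / 2 * norm p\<close>, while \<open>u\<close> varies by at
  most \<open>2 * B\<close> on the larger ball.\<close>

lemma subgrad_locally_bounded:
  assumes z0: "z0 \<in> X"
  obtains r C where "r > 0" "ball z0 r \<subseteq> X" "\<And>z p. z \<in> ball z0 r \<Longrightarrow> p \<in> subgrad X u z \<Longrightarrow> norm p \<le> C"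
proof -
  obtain r where r: "r > 0" "cball z0 r \<subseteq> X" using open_X z0 open_contains_cball by blast
  have "compact (u ` cball z0 r)"
    by (intro compact_continuous_image continuous_on_subset[OF cont_u r(2)] compact_cball)
  then obtain B where B: "\<And>y. y \<in> cball z0 r \<Longrightarrow> \<bar>u y\<bar> \<le> B"
  proof -
    from compact_imp_bounded[OF \<open>compact (u ` cball z0 r)\<close>] obtain B where "\<forall>x\<in>u ` cball z0 r. norm x \<le> B"
      unfolding bounded_iff by blast
    then show thesis by (intro that[of B]) auto
  qed
  show ?thesis
  proof (rule that[of "r / 2"])
    show "ball z0 (r / 2) \<subseteq> X" using r by (intro order_trans[OF _ r(2)]) auto
    fix z p assume z: "z \<in> ball z0 (r / 2)" and p: "p \<in> subgrad X u z"
    show "norm p \<le> 4 * B / r"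
    proof (cases "p = 0")
      case True
      then show ?thesis using B[of z0] r by (simp add: order_trans[OF abs_ge_zero])
    next
      case False
      define y where "y = z + (r / 2 / norm p) *\<^sub>R p"
      have "dist z y = r / 2" using False r by (simp add: y_def dist_norm)
      then have y: "y \<in> cball z0 r" using z dist_triangle[of z0 y z] by simp
      have "u z + p \<bullet> (y - z) \<le> u y" by (rule subgradD[OF p]) (use y r in auto)
      moreover have "p \<bullet> (y - z) = r / 2 * norm p" using False by (simp add: y_def dot_square_norm power2_eq_square)
      moreover have "\<bar>u z\<bar> \<le> B" "\<bar>u y\<bar> \<le> B" using B y z r by auto
      ultimately have "r / 2 * norm p \<le> 2 * B" by linarith
      then show ?thesis using r by (simp add: field_simps)
    qed
  qed (use r in auto)
qed

section \<open>Resolvent of the subdifferential\<close>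

definition minty :: "(real^'n) set" where
  "minty = {z + p | z p. z \<in> X \<and> p \<in> subgrad X u z}"

text \<open>The resolvent, inverse to \<open>1 + \<partial>u\<close>; the choice is unique by
  \<open>prox_eq\<close>.\<close>

definition prox :: "real^'n \<Rightarrow> real^'n" where
  "prox x = (SOME z. z \<in> X \<and> x - z \<in> subgrad X u z)"

lemma prox:
  assumes "x \<in> minty"
  shows "prox x \<in> X" "x - prox x \<in> subgrad X u (prox x)"
proof -
  have "\<exists>z. z \<in> X \<and> x - z \<in> subgrad X u z" using assms by (auto simp: minty_def)
  from someI_ex[OF this] show "prox x \<in> X" "x - prox x \<in> subgrad X u (prox x)"
    by (auto simp: prox_def)
qed

text \<open>Monotonicity makes the mixed term in the expanded square nonnegative.\<close>

lemma minty_contraction: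
  assumes "z \<in> X" "w \<in> X" "p \<in> subgrad X u z" "q \<in> subgrad X u w"
  shows "norm (z - w) \<le> norm (z + p - (w + q))"
proof -
  have "(norm (z - w))\<^sup>2 \<le> (norm (z - w))\<^sup>2 + 2 * ((p - q) \<bullet> (z - w)) + (norm (p - q))\<^sup>2"
    using subgrad_monotone[OF assms] by simp
  also have "\<dots> = (norm ((z - w) + (p - q)))\<^sup>2"
    unfolding power2_norm_eq_inner by (simp add: inner_add_left inner_add_right inner_commute)
  also have "(z - w) + (p - q) = z + p - (w + q)" by simp
  finally show ?thesis by (rule power2_le_imp_le) simp
qed

lemma prox_eq:
  assumes "z \<in> X" "p \<in> subgrad X u z"
  shows "z + p \<in> minty" "prox (z + p) = z"
proof -
  show m: "z + p \<in> minty" using assms by (auto simp: minty_def)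
  from minty_contraction[OF prox(1)[OF m] assms(1) prox(2)[OF m] assms(2)]
  show "prox (z + p) = z" by simp
qed

lemma prox_lipschitz: "x \<in> minty \<Longrightarrow> y \<in> minty \<Longrightarrow> norm (prox x - prox y) \<le> 1 * norm (x - y)"
  using minty_contraction[OF prox(1) prox(1) prox(2) prox(2), of x y] by simp

text \<open>\<open>minty\<close> need not be the whole space; the resolvent is extended so that
  Rademacher's theorem applies and its derivative at a point of \<open>minty\<close> is a full
  derivative.\<close>

definition proxx :: "real^'n \<Rightarrow> real^'n" where
  "proxx = (SOME F. (\<forall>x\<in>minty. F x = prox x) \<and> (\<forall>x y. norm (F x - F y) \<le> (real DIM(real^'n) * 1) * norm (x - y)))"

lemma proxx:
  shows "x \<in> minty \<Longrightarrow> proxx x = prox x"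
    and "norm (proxx x - proxx y) \<le> real CARD('n) * norm (x - y)"
proof -
  obtain F where F: "\<And>x. x \<in> minty \<Longrightarrow> F x = prox x"
    "\<And>x y. norm (F x - F y) \<le> (real DIM(real^'n) * 1) * norm (x - y)"
    by (rule lipschitz_extension[of minty prox 1, OF prox_lipschitz]) auto
  have "(\<forall>x\<in>minty. proxx x = prox x) \<and> (\<forall>x y. norm (proxx x - proxx y) \<le> (real DIM(real^'n) * 1) * norm (x - y))"
    unfolding proxx_def by (rule someI[of _ F]) (use F in simp)
  then have 1: "\<forall>x\<in>minty. proxx x = prox x" and 2: "\<forall>x y. norm (proxx x - proxx y) \<le> (real DIM(real^'n) * 1) * norm (x - y)"
    by blast+
  show "x \<in> minty \<Longrightarrow> proxx x = prox x" by (rule 1[rule_format])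
  show "norm (proxx x - proxx y) \<le> real CARD('n) * norm (x - y)"
    using 2[rule_format, of x y] by simp
qed

lemma proxx_minty:
  assumes "x \<in> minty"
  shows "proxx x \<in> X" "x - proxx x \<in> subgrad X u (proxx x)"
  using prox assms proxx(1) by auto

lemma proxx_eq: "z \<in> X \<Longrightarrow> p \<in> subgrad X u z \<Longrightarrow> proxx (z + p) = z"
  using prox_eq proxx(1) by metis

lemma proxx_continuous: "continuous_on A proxx"
  by (rule lipschitz_on_continuous_on[of "real CARD('n)"], rule lipschitz_onI)
     (use proxx(2) in \<open>auto simp: dist_norm\<close>)

lemma proxx_differentiable_ae: "AE x in lborel. proxx differentiable (at x)"
  by (rule rademacher[of proxx "real CARD('n)"]) (rule proxx(2))

text \<open>On the open set where \<open>proxx\<close> takes values in \<open>X\<close>, membership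
  in \<open>minty\<close> is a family of closed conditions, one for each \<open>y\<close> in
  \<open>X\<close>. The intersection over an empty family would be the whole space, so empty
  \<open>X\<close> is split off.\<close>

lemma minty_borel: "minty \<in> sets borel"
proof (cases "X = {}")
  case True
  then have "minty = {}" unfolding minty_def by blast
  then show ?thesis by simp
next
  case False
  define W where "W = {x. proxx x \<in> X}"
  have W: "open W"
    using open_vimage[OF open_X proxx_continuous] by (simp add: W_def vimage_def)
  have "minty = (\<Inter>y\<in>X. W \<inter> (\<lambda>x. u (proxx x) + (x - proxx x) \<bullet> (y - proxx x) - u y) -` {..0})" (is "_ = ?R")
  proof (intro equalityI subsetI)
    fix x assume "x \<in> minty"
    then show "x \<in> ?R" using proxx_minty[of x] by (auto simp: W_def subgrad_def)
  next
    fix x assume x: "x \<in> ?R"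
    then have "proxx x \<in> X" "x - proxx x \<in> subgrad X u (proxx x)"
      using False by (auto simp: W_def subgrad_def)
    then show "x \<in> minty" unfolding minty_def by (intro CollectI exI[of _ "proxx x"] exI[of _ "x - proxx x"]) auto
  qed
  moreover have "closedin (top_of_set W) ?R"
  proof (rule closedin_INT[OF False], rule continuous_closedin_preimage)
    fix y
    have "continuous_on W (\<lambda>x. u (proxx x))"
      by (rule continuous_on_compose2[OF cont_u proxx_continuous]) (auto simp: W_def)
    then show "continuous_on W (\<lambda>x. u (proxx x) + (x - proxx x) \<bullet> (y - proxx x) - u y)"
      by (intro continuous_intros proxx_continuous)
  qed simp
  ultimately obtain T where "closed T" "minty = W \<inter> T" using closedin_closed by metis
  with W show ?thesis by auto
qed

subsection \<open>Second order expansion at points where the resolvent is invertibly differentiable\<close>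

context
  fixes x0 D
  assumes x0: "x0 \<in> minty" and D: "(proxx has_derivative D) (at x0)" and injD: "inj D"
begin

abbreviation "z0 \<equiv> proxx x0"
abbreviation "p0 \<equiv> x0 - proxx x0"

lemma linear_D: "linear D" using D by (rule has_derivative_linear)

lemma D_lower: "\<exists>c>0. \<forall>h. c * norm h \<le> norm (D h)"
  using linear_inj_bounded_below_pos[OF linear_D injD] by (metis mult.commute)

lemma derivative_bound:
  assumes "\<epsilon> > 0"
  shows "\<exists>d>0. \<forall>x. norm (x - x0) < d \<longrightarrow> norm (proxx x - z0 - D (x - x0)) \<le> \<epsilon> * norm (x - x0)"
  using D assms unfolding has_derivative_at_alt by blast

text \<open>Were \<open>\<partial>u z0\<close> to contain a second subgradient, it would contain a whole segment from \<open>p0\<close>,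
  on which the resolvent is constant; this contradicts injectivity of its derivative.\<close>

lemma subgrad_unique:
  assumes p: "p \<in> subgrad X u z0"
  shows "p = p0"
proof (rule ccontr)
  assume ne: "p \<noteq> p0"
  obtain c where c: "c > 0" "\<And>h. c * norm h \<le> norm (D h)" using D_lower by blast
  obtain d where d: "d > 0" "\<And>x. norm (x - x0) < d \<Longrightarrow> norm (proxx x - z0 - D (x - x0)) \<le> c / 2 * norm (x - x0)"
    using derivative_bound[of "c / 2"] c by auto
  define s where "s = min 1 (d / (2 * norm (p - p0)))"
  have n: "norm (p - p0) > 0" using ne by simp
  have s: "0 < s" "s \<le> 1" "s * norm (p - p0) < d"
  proof -
    show "0 < s" "s \<le> 1" using d n by (auto simp: s_def)
    have "s * norm (p - p0) \<le> d / (2 * norm (p - p0)) * norm (p - p0)"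
      by (rule mult_right_mono) (auto simp: s_def)
    also have "\<dots> < d" using n d by simp
    finally show "s * norm (p - p0) < d" .
  qed
  define x where "x = x0 + s *\<^sub>R (p - p0)"
  have "(1 - s) *\<^sub>R p0 + s *\<^sub>R p \<in> subgrad X u z0"
    using subgrad_convex[of z0] proxx_minty(2)[OF x0] p s by (simp add: convex_alt)
  from proxx_eq[OF proxx_minty(1)[OF x0] this] have "proxx x = z0"
    by (simp add: x_def algebra_simps)
  then have "norm (D (x - x0)) \<le> c / 2 * norm (x - x0)"
    using d(2)[of x] s by (simp add: x_def)
  with c(2)[of "x - x0"] have "c * norm (x - x0) \<le> 0" by simp
  then show False using c(1) s n by (simp add: x_def mult_le_0_iff)
qed

text \<open>\<open>\<partial>u\<close> has closed graph and is locally bounded, so uniqueness of the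
  subgradient at \<open>z0\<close> makes it continuous there; otherwise a subsequence would converge
  to a subgradient other than \<open>p0\<close>.\<close>

lemma subgrad_near:
  assumes "\<rho> > 0"
  shows "\<exists>\<delta>>0. \<forall>z\<in>X. \<forall>p\<in>subgrad X u z. norm (z - z0) < \<delta> \<longrightarrow> norm (z + p - x0) < \<rho>"
proof (rule ccontr)
  assume "\<not> ?thesis"
  then have "\<forall>n. \<exists>z p. z \<in> X \<and> p \<in> subgrad X u z \<and> norm (z - z0) < inverse (real (Suc n)) \<and> \<rho> \<le> norm (z + p - x0)"
    by (metis inverse_positive_iff_positive of_nat_0_less_iff zero_less_Suc not_le)
  then obtain zs ps where zp: "\<And>n. zs n \<in> X" "\<And>n. ps n \<in> subgrad X u (zs n)"
      "\<And>n. norm (zs n - z0) < inverse (real (Suc n))" "\<And>n. \<rho> \<le> norm (zs n + ps n - x0)" by metis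
  have zl: "zs \<longlonglongrightarrow> z0"
  proof (rule Lim_transform_bound[OF _ LIMSEQ_inverse_real_of_nat, THEN LIM_zero_cancel])
    show "\<forall>\<^sub>F n in sequentially. norm (zs n - z0) \<le> norm (inverse (real (Suc n)))"
      using zp(3) by (auto intro!: always_eventually less_imp_le simp del: of_nat_Suc)
  qed
  obtain r C where r: "r > 0" "\<And>z p. z \<in> ball z0 r \<Longrightarrow> p \<in> subgrad X u z \<Longrightarrow> norm p \<le> C"
    using subgrad_locally_bounded[OF proxx_minty(1)[OF x0]] by metis
  obtain N where N: "\<And>n. n \<ge> N \<Longrightarrow> dist (zs n) z0 < r"
    using metric_LIMSEQ_D[OF zl r(1)] by blast
  have "\<forall>n. ps (n + N) \<in> cball 0 C"
  proof
    fix n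
    have "zs (n + N) \<in> ball z0 r" using N[of "n + N"] by (simp add: dist_commute)
    from r(2)[OF this zp(2)] show "ps (n + N) \<in> cball 0 C" by simp
  qed
  then obtain l \<sigma> where l: "l \<in> cball 0 C" "strict_mono \<sigma>" "((\<lambda>n. ps (n + N)) \<circ> \<sigma>) \<longlonglongrightarrow> l"
    using compact_cball[of 0 C] unfolding compact_def by metis
  define k where "k n = \<sigma> n + N" for n
  have pk: "(\<lambda>n. ps (k n)) \<longlonglongrightarrow> l" using l(3) by (simp add: k_def o_def)
  have "strict_mono k" using l(2) by (simp add: k_def[abs_def] strict_mono_def)
  then have zk: "(\<lambda>n. zs (k n)) \<longlonglongrightarrow> z0" using LIMSEQ_subseq_LIMSEQ[OF zl] by (simp add: o_def)
  have "l \<in> subgrad X u z0"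
    by (rule subgrad_limit[OF proxx_minty(1)[OF x0] _ zk _ pk]) (use zp in auto)
  then have "l = p0" by (rule subgrad_unique)
  have "(\<lambda>n. norm (zs (k n) + ps (k n) - x0)) \<longlonglongrightarrow> norm (z0 + l - x0)"
    by (intro tendsto_intros zk pk)
  moreover have "norm (z0 + l - x0) = 0" using \<open>l = p0\<close> by simp
  ultimately have lim0: "(\<lambda>n. norm (zs (k n) + ps (k n) - x0)) \<longlonglongrightarrow> 0" by simp
  have "\<rho> \<le> 0"
    by (rule LIMSEQ_le_const[OF lim0]) (use zp(4) in blast)
  then show False using assms by simp
qed

text \<open>Since \<open>x = z + p\<close>, the relation \<open>z - z0 \<approx> D (x - x0)\<close>
  inverts to \<open>p - p0 \<approx> (inv D - 1) (z - z0)\<close>: the candidate Hessian of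
  \<open>u\<close> at \<open>z0\<close>.\<close>

definition hess :: "real^'n \<Rightarrow> real^'n" where "hess v = inv D v - v"

lemma bij_D: "bij D"
  using linear_injective_imp_surjective[OF linear_D injD] injD by (simp add: bij_def)

lemma linear_hess: "linear hess"
proof -
  have "linear (inv D)" using linear_D bij_D injD by (metis inj_linear_imp_inv_linear)
  then show ?thesis unfolding hess_def[abs_def] by (intro linear_compose_sub linear_id[unfolded id_def])
qed

lemma hess_D: "hess (D v) = v - D v"
  using injD by (simp add: hess_def)

lemma subgrad_expansion:
  assumes \<eta>: "\<eta> > 0"
  shows "\<exists>\<delta>>0. \<forall>z\<in>X. \<forall>p\<in>subgrad X u z. norm (z - z0) < \<delta> \<longrightarrow> norm (p - p0 - hess (z - z0)) \<le> \<eta> * norm (z - z0)"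
proof -
  obtain c where c: "c > 0" "\<And>h. c * norm h \<le> norm (D h)" using D_lower by blast
  \<comment> \<open>The first bound allows \<open>c / 2 * norm h\<close> to be estimated by
    \<open>norm (z - z0)\<close>. The second pays for two divisions by \<open>c\<close>: one for
    applying \<open>inv D\<close>, one for passing from \<open>h\<close> to
    \<open>z - z0\<close>.\<close>
  define \<kappa> where "\<kappa> = min (c / 2) (\<eta> * c\<^sup>2 / 2)"
  have \<kappa>: "\<kappa> > 0" "\<kappa> \<le> c / 2" "\<kappa> \<le> \<eta> * c\<^sup>2 / 2" using c \<eta> by (auto simp: \<kappa>_def)
  obtain d where d: "d > 0" "\<And>x. norm (x - x0) < d \<Longrightarrow> norm (proxx x - z0 - D (x - x0)) \<le> \<kappa> * norm (x - x0)"
    using derivative_bound[OF \<kappa>(1)] by auto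
  obtain \<delta> where \<delta>: "\<delta> > 0" "\<And>z p. z \<in> X \<Longrightarrow> p \<in> subgrad X u z \<Longrightarrow> norm (z - z0) < \<delta> \<Longrightarrow> norm (z + p - x0) < d"
    using subgrad_near[OF d(1)] by blast
  show ?thesis
  proof (intro exI[of _ \<delta>] conjI \<delta>(1) ballI impI)
    fix z p assume z: "z \<in> X" "p \<in> subgrad X u z" "norm (z - z0) < \<delta>"
    define h where "h = z + p - x0"
    have "norm (z - z0 - D h) \<le> \<kappa> * norm h"
      using d(2)[OF \<delta>(2)[OF z]] proxx_eq[OF z(1,2)] by (simp add: h_def)
    note e = this
    have "c * norm h \<le> norm (D h)" by (rule c)
    also have "\<dots> \<le> norm (z - z0) + norm (z - z0 - D h)"
      using norm_triangle_ineq4[of "z - z0" "z - z0 - D h"] by simp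
    also have "\<dots> \<le> norm (z - z0) + c / 2 * norm h"
      using e mult_right_mono[OF \<kappa>(2) norm_ge_zero[of h]] by linarith
    finally have hz: "c / 2 * norm h \<le> norm (z - z0)" by simp
    define w where "w = inv D (z - z0) - h"
    have Dw: "D w = z - z0 - D h"
      using bij_D linear_D by (simp add: w_def linear_diff bij_is_surj surj_f_inv_f)
    have "c * norm w \<le> \<kappa> * norm h" using c(2)[of w] e Dw by simp
    also have "\<dots> \<le> \<eta> * c\<^sup>2 / 2 * norm h" using \<kappa>(3) by (intro mult_right_mono) auto
    also have "\<dots> = c * (\<eta> * (c / 2 * norm h))" by (simp add: power2_eq_square)
    also have "\<dots> \<le> c * (\<eta> * norm (z - z0))" using hz \<eta> c by (intro mult_left_mono) auto
    finally have "norm w \<le> \<eta> * norm (z - z0)" using c by simp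
    moreover have "p - p0 - hess (z - z0) = - w" by (simp add: hess_def w_def h_def)
    ultimately show "norm (p - p0 - hess (z - z0)) \<le> \<eta> * norm (z - z0)" by simp
  qed
qed

text \<open>The expansion of the subgradients is summed along the segment from \<open>z0\<close> to
  \<open>z0 + h\<close>: each increment of \<open>u\<close> lies between the values given by the
  subgradients at its two ends.\<close>

lemma second_order_expansion:
  assumes \<eta>: "\<eta> > 0"
  shows "\<exists>\<delta>>0. ball z0 \<delta> \<subseteq> X \<and> (\<forall>h. norm h < \<delta> \<longrightarrow>
     \<bar>u (z0 + h) - u z0 - p0 \<bullet> h - hess h \<bullet> h / 2\<bar> \<le> \<eta> * (norm h)\<^sup>2)"
proof -
  obtain \<delta>1 where \<delta>1: "\<delta>1 > 0" "\<And>z p. z \<in> X \<Longrightarrow> p \<in> subgrad X u z \<Longrightarrow> norm (z - z0) < \<delta>1 \<Longrightarrow>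
     norm (p - p0 - hess (z - z0)) \<le> \<eta> * norm (z - z0)"
    using subgrad_expansion[OF \<eta>] by blast
  obtain \<delta>2 where \<delta>2: "\<delta>2 > 0" "ball z0 \<delta>2 \<subseteq> X"
    using open_X proxx_minty(1)[OF x0] open_contains_ball by blast
  define \<delta> where "\<delta> = min \<delta>1 \<delta>2"
  have X: "ball z0 \<delta> \<subseteq> X" using \<delta>2 by (auto simp: \<delta>_def)
  have bd: "\<bar>u (z0 + h) - u z0 - p0 \<bullet> h - hess h \<bullet> h / 2\<bar> \<le> \<eta> * (norm h)\<^sup>2" if h: "norm h < \<delta>" for h
  proof -
    define A B where "A = hess h \<bullet> h" and "B = \<eta> * (norm h)\<^sup>2"
    define P where "P t = (SOME p. p \<in> subgrad X u (z0 + t *\<^sub>R h))" for t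
    have inX: "z0 + t *\<^sub>R h \<in> X" and th: "norm (t *\<^sub>R h) < \<delta>1" if "0 \<le> t" "t \<le> 1" for t
    proof -
      have "norm (t *\<^sub>R h) \<le> norm h" using that by (simp add: mult_left_le_one_le)
      then show "z0 + t *\<^sub>R h \<in> X" "norm (t *\<^sub>R h) < \<delta>1"
        using h X by (auto simp: \<delta>_def dist_norm intro!: subsetD[OF X])
    qed
    have P: "P t \<in> subgrad X u (z0 + t *\<^sub>R h)" if "0 \<le> t" "t \<le> 1" for t
      unfolding P_def by (rule someI_ex[OF subgrad_exists[OF inX[OF that]]])
    have Ph: "\<bar>P t \<bullet> h - p0 \<bullet> h - t * A\<bar> \<le> B" if t: "0 \<le> t" "t \<le> 1" for t
    proof -
      have "P t \<bullet> h - p0 \<bullet> h - t * A = (P t - p0 - hess (t *\<^sub>R h)) \<bullet> h"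
        by (simp add: A_def inner_diff_left linear_cmul[OF linear_hess])
      also have "\<bar>\<dots>\<bar> \<le> norm (P t - p0 - hess (t *\<^sub>R h)) * norm h" by (rule Cauchy_Schwarz_ineq2)
      also have "\<dots> \<le> (\<eta> * norm (t *\<^sub>R h)) * norm h"
        using \<delta>1(2)[OF inX[OF t] P[OF t]] th[OF t] by (intro mult_right_mono) auto
      also have "\<dots> = t * B" using t by (simp add: B_def power2_eq_square)
      also have "\<dots> \<le> B" using t \<eta> by (intro mult_left_le_one_le) (auto simp: B_def)
      finally show ?thesis .
    qed
    define \<psi> where "\<psi> t = u (z0 + t *\<^sub>R h)" for t
    have inc: "(t - s) * (P s \<bullet> h) \<le> \<psi> t - \<psi> s" if "0 \<le> s" "s \<le> 1" "0 \<le> t" "t \<le> 1" for s t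
      using subgradD[OF P[OF that(1,2)] inX[OF that(3,4)]]
      by (simp add: \<psi>_def flip: scaleR_diff_left)
    have step: "\<bar>\<psi> t - \<psi> s - (t - s) * (p0 \<bullet> h) - (t\<^sup>2 - s\<^sup>2) / 2 * A\<bar> \<le> (t - s) * B + (t - s)\<^sup>2 / 2 * \<bar>A\<bar>"
      if st: "0 \<le> s" "s \<le> t" "t \<le> 1" for s t
    proof -
      have "(t - s) * (p0 \<bullet> h + s * A - B) \<le> (t - s) * (P s \<bullet> h)"
        using Ph[of s] st by (intro mult_left_mono) auto
      also have "\<dots> \<le> \<psi> t - \<psi> s" using inc[of s t] st by simp
      finally have lo: "(t - s) * (p0 \<bullet> h + s * A - B) \<le> \<psi> t - \<psi> s" .
      have "\<psi> t - \<psi> s \<le> (t - s) * (P t \<bullet> h)" using inc[of t s] st by (simp add: algebra_simps)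
      also have "\<dots> \<le> (t - s) * (p0 \<bullet> h + t * A + B)"
        using Ph[of t] st by (intro mult_left_mono) auto
      finally have up: "\<psi> t - \<psi> s \<le> (t - s) * (p0 \<bullet> h + t * A + B)" .
      have e1: "(t - s) * (p0 \<bullet> h + s * A - B) = (t - s) * (p0 \<bullet> h) + (t\<^sup>2 - s\<^sup>2) / 2 * A - (t - s)\<^sup>2 / 2 * A - (t - s) * B"
        and e2: "(t - s) * (p0 \<bullet> h + t * A + B) = (t - s) * (p0 \<bullet> h) + (t\<^sup>2 - s\<^sup>2) / 2 * A + (t - s)\<^sup>2 / 2 * A + (t - s) * B"
        by (simp_all add: power2_eq_square field_simps)
      have "\<bar>(t - s)\<^sup>2 / 2 * A\<bar> = (t - s)\<^sup>2 / 2 * \<bar>A\<bar>" by (simp add: abs_mult)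
      then show ?thesis using lo up unfolding e1 e2 by linarith
    qed
    let ?\<Delta> = "\<lambda>t. \<psi> t - t * (p0 \<bullet> h) - t\<^sup>2 / 2 * A"
    \<comment> \<open>The quadratic error of a step is \<open>t - s\<close> times an increment of
      \<open>t / 2 * \<bar>A\<bar>\<close>, so it disappears under fine subdivision and only
      \<open>B\<close> remains.\<close>
    have "\<bar>?\<Delta> 1 - ?\<Delta> 0\<bar> \<le> B"
    proof (rule increment_bound[of ?\<Delta> "\<lambda>t. t / 2 * \<bar>A\<bar>"])
      fix s t :: real assume st: "0 \<le> s" "s \<le> t" "t \<le> 1"
      have "?\<Delta> t - ?\<Delta> s = \<psi> t - \<psi> s - (t - s) * (p0 \<bullet> h) - (t\<^sup>2 - s\<^sup>2) / 2 * A"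
        by (simp add: algebra_simps diff_divide_distrib)
      moreover have "(t - s) * B + (t - s)\<^sup>2 / 2 * \<bar>A\<bar> = (t - s) * (t / 2 * \<bar>A\<bar> - s / 2 * \<bar>A\<bar> + B)"
        by (simp add: power2_eq_square field_simps)
      ultimately show "\<bar>?\<Delta> t - ?\<Delta> s\<bar> \<le> (t - s) * (t / 2 * \<bar>A\<bar> - s / 2 * \<bar>A\<bar> + B)"
        using step[OF st] by presburger
    qed
    then show ?thesis by (simp add: \<psi>_def A_def B_def)
  qed
  show ?thesis
    by (intro exI[of _ \<delta>] conjI allI impI X bd) (use \<delta>1 \<delta>2 in \<open>auto simp: \<delta>_def\<close>)
qed

text \<open>The subgradient inequality for the quadratic \<open>hess h \<bullet> h / 2\<close> with
  \<open>hess h\<close> in the role of its gradient, although symmetry of \<open>hess\<close> is not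
  yet known. It arises from the subgradient inequality of \<open>u\<close> between
  \<open>z0 + t *\<^sub>R h\<close> and \<open>z0 + t *\<^sub>R k\<close> after division by
  \<open>t\<^sup>2\<close>.\<close>

lemma hess_convex_quadratic: "0 \<le> hess k \<bullet> k / 2 - hess h \<bullet> h / 2 - hess h \<bullet> (k - h)"
proof (rule ccontr)
  assume neg: "\<not> ?thesis"
  define a where "a = - (hess k \<bullet> k / 2 - hess h \<bullet> h / 2 - hess h \<bullet> (k - h))"
  have a: "a > 0" using neg by (simp add: a_def)
  \<comment> \<open>Collects the factors of the three errors: the expansions of \<open>u\<close> at
    \<open>k\<close> and at \<open>h\<close>, and that of the subgradient at \<open>h\<close>. The
    extra 1 makes the final inequality strict.\<close>
  define C where "C = (norm k)\<^sup>2 + (norm h)\<^sup>2 + norm h * norm (k - h) + 1"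
  have C: "C > 0" by (simp add: C_def add_nonneg_pos)
  define \<eta> where "\<eta> = a / C"
  have \<eta>: "\<eta> > 0" using a C by (simp add: \<eta>_def)
  obtain \<delta>1 where \<delta>1: "\<delta>1 > 0" "\<And>z p. z \<in> X \<Longrightarrow> p \<in> subgrad X u z \<Longrightarrow> norm (z - z0) < \<delta>1 \<Longrightarrow>
     norm (p - p0 - hess (z - z0)) \<le> \<eta> * norm (z - z0)"
    using subgrad_expansion[OF \<eta>] by blast
  obtain \<delta>2 where \<delta>2: "\<delta>2 > 0" "ball z0 \<delta>2 \<subseteq> X" "\<And>h. norm h < \<delta>2 \<Longrightarrow>
     \<bar>u (z0 + h) - u z0 - p0 \<bullet> h - hess h \<bullet> h / 2\<bar> \<le> \<eta> * (norm h)\<^sup>2"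
    using second_order_expansion[OF \<eta>] by blast
  define t where "t = min \<delta>1 \<delta>2 / (norm h + norm k + 1)"
  have t: "t > 0" using \<delta>1 \<delta>2 by (simp add: t_def add_nonneg_pos)
  have tm: "t * (norm h + norm k + 1) = min \<delta>1 \<delta>2" by (simp add: t_def add_nonneg_eq_0_iff)
  have "t * norm h < t * (norm h + norm k + 1)" "t * norm k < t * (norm h + norm k + 1)"
    using t by (auto intro!: mult_strict_left_mono add_nonneg_pos add_strict_increasing2 simp: add_pos_nonneg add.commute add.assoc)
  then have th: "norm (t *\<^sub>R h) < \<delta>1" "norm (t *\<^sub>R h) < \<delta>2" "norm (t *\<^sub>R k) < \<delta>2" using t tm by auto
  have hX: "z0 + t *\<^sub>R h \<in> X" and kX: "z0 + t *\<^sub>R k \<in> X"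
    using th by (auto intro!: subsetD[OF \<delta>2(2)] simp: dist_norm)
  obtain p where p: "p \<in> subgrad X u (z0 + t *\<^sub>R h)" using subgrad_exists[OF hX] by blast
  define e where "e = p - p0 - t *\<^sub>R hess h"
  have e: "norm e \<le> \<eta> * (t * norm h)"
    using \<delta>1(2)[OF hX p] th(1) t by (simp add: e_def linear_cmul[OF linear_hess])
  have pe: "p = p0 + t *\<^sub>R hess h + e" by (simp add: e_def)
  have 1: "u (z0 + t *\<^sub>R k) \<le> u z0 + t * (p0 \<bullet> k) + t\<^sup>2 * (hess k \<bullet> k) / 2 + \<eta> * t\<^sup>2 * (norm k)\<^sup>2"
    using \<delta>2(3)[OF th(3)] t by (simp add: linear_cmul[OF linear_hess] power2_eq_square abs_le_iff mult.assoc mult.left_commute)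
  have 2: "u (z0 + t *\<^sub>R h) \<ge> u z0 + t * (p0 \<bullet> h) + t\<^sup>2 * (hess h \<bullet> h) / 2 - \<eta> * t\<^sup>2 * (norm h)\<^sup>2"
    using \<delta>2(3)[OF th(2)] t by (simp add: linear_cmul[OF linear_hess] power2_eq_square abs_le_iff mult.assoc mult.left_commute)
  have 3: "u (z0 + t *\<^sub>R h) + t * (p \<bullet> (k - h)) \<le> u (z0 + t *\<^sub>R k)"
    using subgradD[OF p kX] by (simp flip: scaleR_diff_right)
  have 4: "- (\<eta> * t * norm h * norm (k - h)) \<le> e \<bullet> (k - h)"
  proof -
    have "\<bar>e \<bullet> (k - h)\<bar> \<le> norm e * norm (k - h)" by (rule Cauchy_Schwarz_ineq2)
    also have "\<dots> \<le> \<eta> * (t * norm h) * norm (k - h)" using e by (rule mult_right_mono) simp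
    finally show ?thesis by (simp add: mult.assoc)
  qed
  have 5: "- (\<eta> * t\<^sup>2 * norm h * norm (k - h)) \<le> t * (e \<bullet> (k - h))"
    using mult_left_mono[OF 4, of t] t by (simp add: power2_eq_square mult_ac)
  have 6: "t * (p \<bullet> (k - h)) = t * (p0 \<bullet> k) - t * (p0 \<bullet> h) + t\<^sup>2 * (hess h \<bullet> (k - h)) + t * (e \<bullet> (k - h))"
    unfolding pe by (simp add: inner_add_left inner_diff_right power2_eq_square algebra_simps)
  have "t\<^sup>2 * a \<le> \<eta> * t\<^sup>2 * (norm k)\<^sup>2 + \<eta> * t\<^sup>2 * (norm h)\<^sup>2 + \<eta> * t\<^sup>2 * norm h * norm (k - h)"
  proof -
    have "t\<^sup>2 * a = - (t\<^sup>2 * (hess k \<bullet> k) / 2 - t\<^sup>2 * (hess h \<bullet> h) / 2 - t\<^sup>2 * (hess h \<bullet> (k - h)))"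
      by (simp add: a_def algebra_simps)
    then show ?thesis using 1 2 3 5 6 by linarith
  qed
  also have "\<dots> = t\<^sup>2 * (\<eta> * (C - 1))" by (simp add: C_def algebra_simps)
  finally have "t\<^sup>2 * a \<le> t\<^sup>2 * (\<eta> * (C - 1))" .
  then have "a \<le> \<eta> * (C - 1)" using t by (simp only: mult_le_cancel_left_pos zero_less_power)
  moreover have "\<eta> * C = a" using C by (simp add: \<eta>_def)
  ultimately show False using \<eta> by (simp add: right_diff_distrib)
qed

text \<open>With \<open>h = v\<close> and \<open>k = v + s *\<^sub>R w\<close> the previous
  inequality leaves \<open>s\<close> times the antisymmetric part plus a term in
  \<open>s\<^sup>2\<close>; nonnegativity for both signs of \<open>s\<close> kills the linear term.
  Symmetry is what admits \<open>hess\<close> as the Hessian of a test function.\<close>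

lemma hess_selfadjoint: "hess v \<bullet> w = v \<bullet> hess w"
proof -
  have "0 \<le> s * (hess w \<bullet> v - hess v \<bullet> w) + s\<^sup>2 * (hess w \<bullet> w)" for s
  proof -
    have "hess (v + s *\<^sub>R w) = hess v + s *\<^sub>R hess w"
      by (simp add: linear_add[OF linear_hess] linear_cmul[OF linear_hess])
    then have "hess (v + s *\<^sub>R w) \<bullet> (v + s *\<^sub>R w) / 2 - hess v \<bullet> v / 2 - hess v \<bullet> ((v + s *\<^sub>R w) - v)
       = (s * (hess w \<bullet> v - hess v \<bullet> w) + s\<^sup>2 * (hess w \<bullet> w)) / 2"
      by (simp add: inner_add_left inner_add_right power2_eq_square field_simps)
    then show ?thesis using hess_convex_quadratic[of "v + s *\<^sub>R w" v] by simp
  qed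
  from quadratic_nonneg_linear_zero[OF this] show ?thesis by (simp add: inner_commute)
qed

end

end

section \<open>The density inequality\<close>

sublocale viscosity_data \<subseteq> convex_function X u
  using X(2) convex_on_X by unfold_locales

context viscosity_data
begin

lemma density_inequality_hess:
  assumes x0: "x0 \<in> minty" and D: "(proxx has_derivative D) (at x0)" and injD: "inj D"
  shows "f (proxx x0) \<le> g (x0 - proxx x0) * \<bar>det (matrix (hess D))\<bar>"
proof -
  note ctx = x0 D injD
  let ?M = "hess D" and ?z = "proxx x0" and ?p = "x0 - proxx x0"
  \<comment> \<open>The multiple of the identity absorbs the error of the expansion, so that the
    quadratic touches \<open>u\<close> from above; it tends to 0 afterwards.\<close>
  let ?L = "\<lambda>\<eta> v. ?M v + \<eta> *\<^sub>R v"
  have le: "f ?z \<le> g ?p * \<bar>det (matrix (?L \<eta>))\<bar>" if \<eta>: "\<eta> > 0" for \<eta>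
  proof -
    obtain \<delta> where \<delta>: "\<delta> > 0" "ball ?z \<delta> \<subseteq> X" "\<And>h. norm h < \<delta> \<Longrightarrow>
       \<bar>u (?z + h) - u ?z - ?p \<bullet> h - ?M h \<bullet> h / 2\<bar> \<le> \<eta> / 2 * (norm h)\<^sup>2"
      using second_order_expansion[OF ctx, of "\<eta> / 2"] \<eta> by auto
    show ?thesis
    proof (rule quadratic_touching(2)[of "?L \<eta>" ?z ?p ?p ?z \<delta>])
      show "linear (?L \<eta>)"
        by (intro linear_compose_add linear_hess[OF ctx] linear_compose_scale_right linear_id[unfolded id_def])
      show "?L \<eta> x \<bullet> y = x \<bullet> ?L \<eta> y" for x y
        by (simp add: inner_add_left inner_add_right hess_selfadjoint[OF ctx])
      show "?p = ?p + ?L \<eta> (?z - ?z)" by (simp add: linear_0[OF linear_hess[OF ctx]])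
      fix y assume y: "dist ?z y < \<delta>"
      have "\<bar>u y - u ?z - ?p \<bullet> (y - ?z) - ?M (y - ?z) \<bullet> (y - ?z) / 2\<bar> \<le> \<eta> / 2 * (norm (y - ?z))\<^sup>2"
        using \<delta>(3)[of "y - ?z"] y by (simp add: dist_norm norm_minus_commute)
      moreover have "(y - ?z) \<bullet> ?L \<eta> (y - ?z) = ?M (y - ?z) \<bullet> (y - ?z) + \<eta> * (norm (y - ?z))\<^sup>2"
        by (simp only: inner_add_right inner_scaleR_right power2_norm_eq_inner inner_commute)
      ultimately show "u y - (?p \<bullet> (y - ?z) + (y - ?z) \<bullet> ?L \<eta> (y - ?z) / 2)
          \<le> u ?z - (?p \<bullet> (?z - ?z) + (?z - ?z) \<bullet> ?L \<eta> (?z - ?z) / 2)"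
        by (simp add: field_simps abs_le_iff)
    qed (use \<delta> proxx_minty(1)[OF x0] in auto)
  qed
  have "((\<lambda>\<eta>. matrix (?L \<eta>)) \<longlongrightarrow> matrix (?L 0)) (at_right 0)"
    unfolding matrix_def by (intro tendsto_vec_lambda tendsto_intros tendsto_vec_nth)
  then have "((\<lambda>\<eta>. g ?p * \<bar>det (matrix (?L \<eta>))\<bar>) \<longlongrightarrow> g ?p * \<bar>det (matrix (?L 0))\<bar>) (at_right 0)"
    by (intro tendsto_intros tendsto_det)
  then have "f ?z \<le> g ?p * \<bar>det (matrix (?L 0))\<bar>"
  proof (rule tendsto_lowerbound)
    show "\<forall>\<^sub>F \<eta> in at_right 0. f ?z \<le> g ?p * \<bar>det (matrix (?L \<eta>))\<bar>"
      by (rule eventually_mono[OF eventually_at_right_less]) (rule le)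
  qed simp
  then show ?thesis by simp
qed

text \<open>Multiplication by \<open>\<bar>det (matrix D)\<bar>\<close> moves the inequality to the
  variable \<open>x\<close>, because \<open>1 - D\<close> is \<open>hess\<close> composed with
  \<open>D\<close>. Both sides now carry Jacobians, of \<open>x \<mapsto> z\<close> and of
  \<open>x \<mapsto> p\<close>.\<close>

lemma density_inequality:
  assumes x0: "x0 \<in> minty" and D: "(proxx has_derivative D) (at x0)" and injD: "inj D"
  shows "f (proxx x0) * \<bar>det (matrix D)\<bar> \<le> g (x0 - proxx x0) * \<bar>det (matrix (\<lambda>v. v - D v))\<bar>"
proof -
  note ctx = x0 D injD
  have "(\<lambda>v. v - D v) = hess D \<circ> D" by (simp add: fun_eq_iff hess_D[OF ctx])
  then have "matrix (\<lambda>v. v - D v) = matrix (hess D) ** matrix D"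
    using matrix_compose[OF linear_D[OF ctx] linear_hess[OF ctx]] by simp
  then have eq: "\<bar>det (matrix (\<lambda>v. v - D v))\<bar> = \<bar>det (matrix (hess D))\<bar> * \<bar>det (matrix D)\<bar>"
    by (simp add: det_mul abs_mult)
  with mult_right_mono[OF density_inequality_hess[OF ctx] abs_ge_zero[of "det (matrix D)"]]
  show ?thesis by (simp add: eq mult.assoc)
qed

end

section \<open>The optimal map\<close>

lemma negligible_of_AE:
  assumes "AE x in lebesgue. x \<notin> N"
  shows "negligible N"
proof -
  obtain Z where "Z \<in> null_sets lebesgue" "{x \<in> space lebesgue. \<not> x \<notin> N} \<subseteq> Z"
    using assms unfolding eventually_ae_filter by blast
  then show ?thesis
    by (intro negligible_subset[of Z N]) (auto simp: negligible_iff_null_sets)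
qed

lemma negligible_of_integral_zero:
  fixes h :: "'a::euclidean_space \<Rightarrow> real"
  assumes h: "h absolutely_integrable_on S" and pos: "\<And>x. x \<in> S \<Longrightarrow> h x > 0" and 0: "integral S h = 0"
  shows "negligible S"
proof -
  have i: "integrable lebesgue (\<lambda>x. indicator S x *\<^sub>R h x)" using h by (simp add: set_integrable_def)
  have "(\<integral>x. indicator S x *\<^sub>R h x \<partial>lebesgue) = 0"
    using set_lebesgue_integral_eq_integral(2)[OF h] 0 by (simp add: set_lebesgue_integral_def)
  moreover have "AE x in lebesgue. 0 \<le> indicator S x *\<^sub>R h x"
    using pos by (auto simp: indicator_def less_imp_le)
  ultimately have "AE x in lebesgue. indicator S x *\<^sub>R h x = 0"
    using integral_nonneg_eq_0_iff_AE[OF i] by blast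
  then have "AE x in lebesgue. x \<notin> S"
    by eventually_elim (use pos in \<open>force simp: indicator_def\<close>)
  then show ?thesis by (rule negligible_of_AE)
qed

lemma open_of_lsc_on:
  assumes "lsc_on X f" "open X"
  shows "open {x \<in> X. f x > a}"
  using assms openin_open_eq by (auto simp: lsc_on_def)

section \<open>Measurability and injectivity in the parameter\<close>

context convex_function
begin

text \<open>A subgradient common to both end points forces \<open>u\<close> to follow its supporting
  affine function along the segment.\<close>

lemma subgrad_segment:
  assumes z: "z1 \<in> X" "z2 \<in> X" and p: "p \<in> subgrad X u z1" "p \<in> subgrad X u z2" and s: "0 \<le> s" "s \<le> 1"
  shows "p \<in> subgrad X u (z1 + s *\<^sub>R (z2 - z1))"
  unfolding subgrad_def
proof (clarify)
  fix y assume y: "y \<in> X"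
  have e: "u z2 = u z1 + p \<bullet> (z2 - z1)"
    using subgradD[OF p(1) z(2)] subgradD[OF p(2) z(1)] by (simp add: inner_diff_right)
  have "z1 + s *\<^sub>R (z2 - z1) = (1 - s) *\<^sub>R z1 + s *\<^sub>R z2" by (simp add: algebra_simps)
  then have "u (z1 + s *\<^sub>R (z2 - z1)) \<le> (1 - s) * u z1 + s * u z2"
    using convex_onD[OF convex_u s z] by simp
  also have "\<dots> = u z1 + s * (p \<bullet> (z2 - z1))" by (simp add: e algebra_simps)
  finally show "u (z1 + s *\<^sub>R (z2 - z1)) + p \<bullet> (y - (z1 + s *\<^sub>R (z2 - z1))) \<le> u y"
    using subgradD[OF p(1) y] by (simp add: inner_diff_right inner_add_right)
qed

definition diff_minty :: "(real^'n) set" where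
  "diff_minty = {x \<in> minty. proxx differentiable (at x)}"

definition Dprox :: "real^'n \<Rightarrow> real^'n \<Rightarrow> real^'n" where
  "Dprox x = frechet_derivative proxx (at x)"

lemma negligible_nondiff: "negligible {x. \<not> proxx differentiable (at x)}"
proof -
  have "AE x in lebesgue. proxx differentiable (at x)"
    by (rule AE_completion[OF proxx_differentiable_ae])
  then show ?thesis by (intro negligible_of_AE) simp
qed

lemma diff_minty_lebesgue: "diff_minty \<in> sets lebesgue"
proof -
  have "diff_minty = minty - {x. \<not> proxx differentiable (at x)}" by (auto simp: diff_minty_def)
  then show ?thesis
    using minty_borel negligible_nondiff negligible_imp_sets by (metis sets.Diff sets_completionI_sets sets_lborel)
qed

lemma Dprox:
  assumes "x \<in> diff_minty"
  shows "(proxx has_derivative Dprox x) (at x)" "((\<lambda>x. x - proxx x) has_derivative (\<lambda>v. v - Dprox x v)) (at x)"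
proof -
  show 1: "(proxx has_derivative Dprox x) (at x)"
    using assms frechet_derivative_works[of proxx "at x"] by (simp add: diff_minty_def Dprox_def)
  show "((\<lambda>x. x - proxx x) has_derivative (\<lambda>v. v - Dprox x v)) (at x)"
    by (intro has_derivative_diff has_derivative_ident 1)
qed

lemma linear_Dprox:
  assumes "x \<in> diff_minty"
  shows "linear (Dprox x)" "linear (\<lambda>v. v - Dprox x v)"
  by (rule has_derivative_linear[OF Dprox(1)[OF assms]], rule has_derivative_linear[OF Dprox(2)[OF assms]])

text \<open>The counterpart of \<open>subgrad_unique\<close> with \<open>z\<close> and
  \<open>p\<close> exchanged: if \<open>p\<close> is shared by two points, the resolvent moves like
  the identity between the two parameters, so \<open>D h = h\<close> and \<open>1 - D\<close> is not
  injective.\<close>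

lemma subgrad_image_unique:
  assumes x: "x1 \<in> diff_minty" "x2 \<in> minty" and det: "det (matrix (\<lambda>v. v - Dprox x1 v)) \<noteq> 0"
    and eq: "x1 - proxx x1 = x2 - proxx x2"
  shows "x1 = x2"
proof (rule ccontr)
  assume ne: "x1 \<noteq> x2"
  define h p where "h = x2 - x1" and "p = x1 - proxx x1"
  have h: "h = proxx x2 - proxx x1" "norm h > 0" using eq ne by (auto simp: h_def algebra_simps)
  have m1: "x1 \<in> minty" using x(1) by (simp add: diff_minty_def)
  have p: "p \<in> subgrad X u (proxx x1)" "p \<in> subgrad X u (proxx x2)"
    using proxx_minty(2)[OF m1] proxx_minty(2)[OF x(2)] eq by (simp_all add: p_def)
  have ray: "proxx (x1 + s *\<^sub>R h) - proxx x1 = s *\<^sub>R h" if s: "0 \<le> s" "s \<le> 1" for s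
  proof -
    have "proxx x1 + s *\<^sub>R h \<in> X"
    proof -
      have "(1 - s) *\<^sub>R proxx x1 + s *\<^sub>R proxx x2 \<in> X"
        using convex_X proxx_minty(1)[OF m1] proxx_minty(1)[OF x(2)] s by (simp add: convex_alt)
      then show ?thesis by (simp add: h algebra_simps)
    qed
    moreover have "p \<in> subgrad X u (proxx x1 + s *\<^sub>R h)"
      unfolding h(1) by (rule subgrad_segment[OF proxx_minty(1)[OF m1] proxx_minty(1)[OF x(2)] p s])
    ultimately have "proxx (proxx x1 + s *\<^sub>R h + p) = proxx x1 + s *\<^sub>R h" by (rule proxx_eq)
    then show ?thesis by (simp add: p_def algebra_simps)
  qed
  have "norm (h - Dprox x1 h) \<le> 0 + \<epsilon>" if \<epsilon>: "\<epsilon> > 0" for \<epsilon>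
  proof -
    have "\<epsilon> / norm h > 0" using \<epsilon> h by simp
    then obtain d where d: "d > 0" "\<And>y. norm (y - x1) < d \<Longrightarrow>
        norm (proxx y - proxx x1 - Dprox x1 (y - x1)) \<le> \<epsilon> / norm h * norm (y - x1)"
      using Dprox(1)[OF x(1)] unfolding has_derivative_at_alt by blast
    define s where "s = min 1 (d / (2 * norm h))"
    have s: "0 < s" "s \<le> 1" using d h by (auto simp: s_def)
    have "s * norm h \<le> d / (2 * norm h) * norm h" by (rule mult_right_mono) (auto simp: s_def)
    also have "\<dots> < d" using h d by simp
    finally have "norm (proxx (x1 + s *\<^sub>R h) - proxx x1 - Dprox x1 (s *\<^sub>R h)) \<le> \<epsilon> / norm h * (s * norm h)"
      using d(2)[of "x1 + s *\<^sub>R h"] s by simp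
    moreover have "proxx (x1 + s *\<^sub>R h) - proxx x1 - Dprox x1 (s *\<^sub>R h) = s *\<^sub>R (h - Dprox x1 h)"
      using ray[of s] s by (simp add: linear_cmul[OF linear_Dprox(1)[OF x(1)]] scaleR_diff_right)
    ultimately have "s * norm (h - Dprox x1 h) \<le> s * \<epsilon>" using s h by simp
    then show ?thesis using s by simp
  qed
  then have "norm (h - Dprox x1 h) \<le> 0" by (rule field_le_epsilon)
  then have "(\<lambda>v. v - Dprox x1 v) h = (\<lambda>v. v - Dprox x1 v) 0"
    by (simp add: linear_0[OF linear_Dprox(1)[OF x(1)]])
  then have "h = 0"
    using iffD1[OF det_nz_iff_inj[OF linear_Dprox(2)[OF x(1)]] det] unfolding inj_def by blast
  then show False using h by simp
qed

end

section \<open>Balance of masses and the transport map\<close>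

locale monge_data = viscosity_data X f g H u
  for X :: "(real^'n) set" and f g H u :: "real^'n \<Rightarrow> real" +
  fixes Y :: "(real^'n) set"
  assumes bounded_X: "bounded X" and Y: "convex Y" "bounded Y" "open Y"
    and f_int: "f absolutely_integrable_on X" and f_nonneg: "\<And>x. x \<in> X \<Longrightarrow> 0 \<le> f x"
    and g_int: "g absolutely_integrable_on UNIV" and g_pos: "\<And>y. y \<in> Y \<Longrightarrow> 0 < g y"
    and g_zero: "\<And>y. y \<notin> Y \<Longrightarrow> g y = 0"
    and mass: "integral X f = integral Y g"
    and defining: "defining_fun Y H"
begin

lemma X_lebesgue: "X \<in> sets lebesgue" and Y_lebesgue: "Y \<in> sets lebesgue"
  using X(2) Y(3) by auto

lemma f_int_subset: "S \<in> sets lebesgue \<Longrightarrow> S \<subseteq> X \<Longrightarrow> f absolutely_integrable_on S"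
  by (rule set_integrable_subset[OF f_int])

lemma g_int_subset: "S \<in> sets lebesgue \<Longrightarrow> g absolutely_integrable_on S"
  by (rule set_integrable_subset[OF g_int]) auto

lemma Y_nonempty: "X \<noteq> {} \<Longrightarrow> Y \<noteq> {}"
proof
  assume "X \<noteq> {}" "Y = {}"
  then obtain p where "H p \<le> 0" using H_nonpositive_somewhere by blast
  moreover have "0 < H p" using defining \<open>Y = {}\<close> by (simp add: defining_fun_def)
  ultimately show False by simp
qed

definition Xpos :: "(real^'n) set" where "Xpos = {x \<in> X. f x > 0}"

lemma open_Xpos: "open Xpos"
  unfolding Xpos_def by (rule open_of_lsc_on[OF f X(2)])

text \<open>The parameters where both changes of variables are legitimate: invertibility of
  \<open>1 - D\<close> follows there from the density inequality because
  \<open>f (proxx x) > 0\<close>.\<close>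

definition B :: "(real^'n) set" where
  "B = {x \<in> diff_minty. det (matrix (Dprox x)) \<noteq> 0 \<and> proxx x \<in> Xpos}"

abbreviation "J \<equiv> proxx"
abbreviation q :: "real^'n \<Rightarrow> real^'n" where "q x \<equiv> x - proxx x"

lemma B_lebesgue: "B \<in> sets lebesgue"
proof -
  have "{x \<in> diff_minty. det (matrix (Dprox x)) = 0} \<in> sets lebesgue"
    by (rule measurable_det_derivative[OF diff_minty_lebesgue has_derivative_at_withinI[OF Dprox(1)]])
  moreover have "J -` Xpos \<in> sets lebesgue"
    using open_vimage[OF open_Xpos proxx_continuous] by auto
  moreover have "B = diff_minty \<inter> J -` Xpos - {x \<in> diff_minty. det (matrix (Dprox x)) = 0}"
    by (auto simp: B_def)
  ultimately show ?thesis using diff_minty_lebesgue by (simp add: sets.Int sets.Diff)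
qed

lemma B:
  assumes "x \<in> B"
  shows "x \<in> diff_minty" "x \<in> minty" "det (matrix (Dprox x)) \<noteq> 0" "inj (Dprox x)" "J x \<in> X" "f (J x) > 0"
    "q x \<in> subgrad X u (J x)"
    "f (J x) * \<bar>det (matrix (Dprox x))\<bar> \<le> g (q x) * \<bar>det (matrix (\<lambda>v. v - Dprox x v))\<bar>"
    "q x \<in> Y" "det (matrix (\<lambda>v. v - Dprox x v)) \<noteq> 0"
proof -
  show 1: "x \<in> diff_minty" "det (matrix (Dprox x)) \<noteq> 0" "J x \<in> X" "f (J x) > 0"
    using assms by (auto simp: B_def Xpos_def)
  then show 2: "x \<in> minty" by (simp add: diff_minty_def)
  show inj: "inj (Dprox x)" by (rule iffD1[OF det_nz_iff_inj[OF linear_Dprox(1)[OF 1(1)]] 1(2)])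
  show "q x \<in> subgrad X u (J x)" by (rule proxx_minty[OF 2])
  show le: "f (J x) * \<bar>det (matrix (Dprox x))\<bar> \<le> g (q x) * \<bar>det (matrix (\<lambda>v. v - Dprox x v))\<bar>"
    by (rule density_inequality[OF 2 Dprox(1)[OF 1(1)] inj])
  \<comment> \<open>Positivity on the left forces both factors on the right to be nonzero; as
    \<open>g\<close> vanishes off \<open>Y\<close>, this places the subgradient in
    \<open>Y\<close>.\<close>
  have "0 < f (J x) * \<bar>det (matrix (Dprox x))\<bar>" using 1 by simp
  with le have "0 < g (q x) * \<bar>det (matrix (\<lambda>v. v - Dprox x v))\<bar>" by linarith
  then have "g (q x) \<noteq> 0" "det (matrix (\<lambda>v. v - Dprox x v)) \<noteq> 0" by auto
  then show "q x \<in> Y" "det (matrix (\<lambda>v. v - Dprox x v)) \<noteq> 0" using g_zero by blast+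
qed

lemma inj_J: "inj_on J B"
proof (rule inj_onI)
  fix x1 x2 assume x: "x1 \<in> B" "x2 \<in> B" "J x1 = J x2"
  have "q x2 = q x1"
    using subgrad_unique[OF B(2)[OF x(1)] Dprox(1)[OF B(1)[OF x(1)]] B(4)[OF x(1)]] B(7)[OF x(2)] x(3) by simp
  then show "x1 = x2" using x(3) by simp
qed

lemma inj_q: "inj_on q B"
  by (rule inj_onI, rule subgrad_image_unique) (use B in auto)

lemma der_J: "x \<in> B \<Longrightarrow> (J has_derivative Dprox x) (at x within C)"
  and der_q: "x \<in> B \<Longrightarrow> (q has_derivative (\<lambda>v. v - Dprox x v)) (at x within C)"
  using Dprox[OF B(1)] by (auto intro: has_derivative_at_withinI)

lemma image_lebesgue:
  assumes C: "C \<in> sets lebesgue" "C \<subseteq> B"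
  shows "J ` C \<in> sets lebesgue" "q ` C \<in> sets lebesgue"
proof -
  have "J differentiable_on C" "q differentiable_on C"
    using C der_J der_q unfolding differentiable_on_def differentiable_def by blast+
  then show "J ` C \<in> sets lebesgue" "q ` C \<in> sets lebesgue"
    using differentiable_image_in_sets_lebesgue[OF C(1) order_refl] by auto
qed

text \<open>A point of \<open>Xpos\<close> not reached from \<open>B\<close> comes from a parameter
  where \<open>J\<close> is not differentiable, a null set with null Lipschitz image, or where its
  derivative is singular, and there Sard's lemma applies.\<close>

lemma negligible_Xpos_minus: "negligible (Xpos - J ` B)"
proof -
  let ?Nd = "{x. \<not> J differentiable (at x)}" and ?Z = "{x \<in> diff_minty. det (matrix (Dprox x)) = 0}"
  have "negligible (J ` ?Nd)"
  proof (rule negligible_locally_Lipschitz_image[OF order_refl negligible_nondiff])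
    fix x
    show "\<exists>T C. open T \<and> x \<in> T \<and> (\<forall>y\<in>?Nd \<inter> T. norm (J y - J x) \<le> C * norm (y - x))"
      by (intro exI[of _ UNIV] exI[of _ "real CARD('n)"]) (use proxx(2) in auto)
  qed
  moreover have "negligible (J ` ?Z)"
    by (rule sard_negligible[where g'=Dprox]) (auto intro: has_derivative_at_withinI Dprox(1))
  moreover have "Xpos - J ` B \<subseteq> J ` ?Nd \<union> J ` ?Z"
  proof
    fix z assume z: "z \<in> Xpos - J ` B"
    then have zX: "z \<in> X" by (simp add: Xpos_def)
    obtain p where p: "p \<in> subgrad X u z" using subgrad_exists[OF zX] by blast
    have J: "J (z + p) = z" "z + p \<in> minty" using proxx_eq[OF zX p] prox_eq[OF zX p] by auto
    have "z + p \<notin> B"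
    proof
      assume "z + p \<in> B"
      then have "J (z + p) \<in> J ` B" by (rule imageI)
      then show False using z J(1) by simp
    qed
    then have "z + p \<in> ?Nd \<union> ?Z" using z J by (auto simp: B_def diff_minty_def)
    then have "J (z + p) \<in> J ` (?Nd \<union> ?Z)" by (rule imageI)
    then show "z \<in> J ` ?Nd \<union> J ` ?Z" by (simp only: J(1) image_Un)
  qed
  ultimately show ?thesis by (meson negligible_Un negligible_subset)
qed

lemma J_image_subset: "C \<subseteq> B \<Longrightarrow> J ` C \<subseteq> X" and q_image_subset: "C \<subseteq> B \<Longrightarrow> q ` C \<subseteq> Y"
  using B by auto

lemma mass_le:
  assumes C: "C \<in> sets lebesgue" "C \<subseteq> B"
  shows "integral (J ` C) f \<le> integral (q ` C) g"
proof -
  have fi: "f absolutely_integrable_on (J ` C)"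
    by (rule f_int_subset[OF image_lebesgue(1)[OF C] J_image_subset[OF C(2)]])
  have gi: "g absolutely_integrable_on (q ` C)"
    by (rule g_int_subset[OF image_lebesgue(2)[OF C]])
  have inj: "inj_on J C" "inj_on q C" using inj_J inj_q C(2) inj_on_subset by blast+
  have dJ: "\<And>x. x \<in> C \<Longrightarrow> (J has_derivative Dprox x) (at x within C)"
    and dq: "\<And>x. x \<in> C \<Longrightarrow> (q has_derivative (\<lambda>v. v - Dprox x v)) (at x within C)"
    using der_J der_q C(2) by auto
  note cf = change_of_variables_real[OF C(1) dJ inj(1) fi]
  note cg = change_of_variables_real[OF C(1) dq inj(2) gi]
  have "integral (J ` C) f = integral C (\<lambda>x. \<bar>det (matrix (Dprox x))\<bar> * f (J x))" using cf(2) by simp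
  also have "\<dots> \<le> integral C (\<lambda>x. \<bar>det (matrix (\<lambda>v. v - Dprox x v))\<bar> * g (q x))"
  proof (rule integral_le)
    fix x assume "x \<in> C"
    then show "\<bar>det (matrix (Dprox x))\<bar> * f (J x) \<le> \<bar>det (matrix (\<lambda>v. v - Dprox x v))\<bar> * g (q x)"
      using B(8) C(2) by (auto simp: mult.commute)
  qed (use cf(1) cg(1) set_lebesgue_integral_eq_integral(1) in blast)+
  also have "\<dots> = integral (q ` C) g" using cg(2) by simp
  finally show ?thesis .
qed

lemma integral_f_J:
  assumes E: "E \<subseteq> X"
  shows "integral (E \<inter> J ` B) f = integral E f"
proof (rule integral_spike_set)
  have "{x \<in> E - E \<inter> J ` B. f x \<noteq> 0} \<subseteq> Xpos - J ` B"
    using E f_nonneg by (force simp: Xpos_def less_le)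
  then show "negligible {x \<in> E - E \<inter> J ` B. f x \<noteq> 0}"
    using negligible_Xpos_minus negligible_subset by blast
qed (auto intro: negligible_subset)

text \<open>\<open>mass_le\<close> holds for \<open>C\<close> and for \<open>B - C\<close>, while
  the total for \<open>g\<close> is at most that for \<open>f\<close>: the image of \<open>B\<close>
  under \<open>q\<close> lies in \<open>Y\<close>, and the image under \<open>J\<close> carries all
  mass of \<open>f\<close>. Hence neither inequality can be strict.\<close>

lemma mass_eq:
  assumes C: "C \<in> sets lebesgue" "C \<subseteq> B"
  shows "integral (J ` C) f = integral (q ` C) g"
proof -
  have BC: "B - C \<in> sets lebesgue" "B - C \<subseteq> B" using B_lebesgue C by auto
  have fi: "f integrable_on J ` C'" and gi: "g integrable_on q ` C'" if "C' \<in> sets lebesgue" "C' \<subseteq> B" for C'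
    using f_int_subset[OF image_lebesgue(1)[OF that] J_image_subset[OF that(2)]] g_int_subset[OF image_lebesgue(2)[OF that]]
    by (auto dest: set_lebesgue_integral_eq_integral(1))
  have "J ` C \<inter> J ` (B - C) = {}" "q ` C \<inter> q ` (B - C) = {}"
    using inj_J inj_q C(2) by (auto simp: inj_on_def)
  then have "integral (J ` C \<union> J ` (B - C)) f = integral (J ` C) f + integral (J ` (B - C)) f"
    and "integral (q ` C \<union> q ` (B - C)) g = integral (q ` C) g + integral (q ` (B - C)) g"
    using fi[OF C] fi[OF BC] gi[OF C] gi[OF BC] by (auto intro!: integral_Un)
  moreover have "J ` C \<union> J ` (B - C) = J ` B" "q ` C \<union> q ` (B - C) = q ` B" using C(2) by auto
  moreover have "integral (q ` B) g \<le> integral (J ` B) f"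
  proof -
    have "integral (q ` B) g \<le> integral Y g"
      using gi[OF B_lebesgue order_refl] g_int_subset[OF Y_lebesgue] g_pos
      by (intro integral_subset_le q_image_subset) (auto simp: less_imp_le dest: set_lebesgue_integral_eq_integral(1))
    also have "\<dots> = integral (X \<inter> J ` B) f" using mass integral_f_J[of X] by simp
    also have "X \<inter> J ` B = J ` B" using J_image_subset by blast
    finally show ?thesis .
  qed
  ultimately show ?thesis using mass_le[OF C] mass_le[OF BC] by simp
qed

text \<open>For Borel sets continuity of \<open>J\<close> suffices; the issue is a null set. The
  preimage \<open>W\<close> of a Borel null set has null image, so the Jacobian of \<open>J\<close>
  has integral 0 over \<open>W\<close>; being nonzero on \<open>B\<close>, it forces
  \<open>W\<close> to be null.\<close>

lemma preimage_lebesgue: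
  assumes E: "E \<in> sets lebesgue"
  shows "{x \<in> B. J x \<in> E} \<in> sets lebesgue"
proof -
  obtain E' N where E': "E' \<in> sets borel" "negligible N" "E' \<union> N = E"
    using sets_lebesgue_almost_borel[OF E] by blast
  have J: "J \<in> borel_measurable borel" by (rule borel_measurable_continuous_onI[OF proxx_continuous])
  have pre: "{x \<in> B. J x \<in> A} \<in> sets lebesgue" if "A \<in> sets borel" for A
  proof -
    have "J -` A \<in> sets borel" using measurable_sets[OF J that] by simp
    moreover have "{x \<in> B. J x \<in> A} = B \<inter> J -` A" by auto
    ultimately show ?thesis using B_lebesgue by auto
  qed
  obtain N' where N': "N' \<in> null_sets lborel" "N \<subseteq> N'"
    using E'(2) unfolding negligible_iff_null_sets null_sets_completion_iff2 by blast
  define W where "W = {x \<in> B. J x \<in> N'}"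
  have W: "W \<in> sets lebesgue" "W \<subseteq> B" using pre[of N'] N' by (auto simp: W_def)
  have "negligible (J ` W)"
  proof (rule negligible_subset)
    show "negligible N'" using N' by (simp add: negligible_iff_null_sets null_sets_completionI)
  qed (auto simp: W_def)
  then have 1: "(\<lambda>_. 1::real) absolutely_integrable_on (J ` W)" "integral (J ` W) (\<lambda>_. 1::real) = 0"
    by (auto intro: absolutely_integrable_negligible integral_negligible)
  have "\<And>x. x \<in> W \<Longrightarrow> (J has_derivative Dprox x) (at x within W)" using der_J W(2) by auto
  from change_of_variables_real[OF W(1) this inj_on_subset[OF inj_J W(2)] 1(1)]
  have "(\<lambda>x. \<bar>det (matrix (Dprox x))\<bar>) absolutely_integrable_on W" "integral W (\<lambda>x. \<bar>det (matrix (Dprox x))\<bar>) = 0"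
    using 1(2) by auto
  then have "negligible W"
    by (intro negligible_of_integral_zero[where h="\<lambda>x. \<bar>det (matrix (Dprox x))\<bar>"]) (use B(3) W(2) in auto)
  then have "{x \<in> B. J x \<in> N} \<in> sets lebesgue"
    by (rule negligible_imp_sets[OF negligible_subset]) (use N'(2) in \<open>auto simp: W_def\<close>)
  moreover have "{x \<in> B. J x \<in> E} = {x \<in> B. J x \<in> E'} \<union> {x \<in> B. J x \<in> N}" using E'(3) by auto
  ultimately show ?thesis using pre[OF E'(1)] by simp
qed

theorem transport_map_exists:
  "\<exists>T\<in>transport_maps X Y f g. \<forall>x\<in>J ` B. T x \<in> subgrad X u x"
proof -
  obtain y0 where y0: "X \<noteq> {} \<Longrightarrow> y0 \<in> Y" using Y_nonempty by blast
  \<comment> \<open>\<open>q\<close> after the inverse of \<open>J\<close>. Off the image of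
    \<open>B\<close>, where \<open>f\<close> vanishes almost everywhere, the constant
    \<open>y0\<close> keeps the values in \<open>Y\<close> and adds at most one point to any
    image.\<close>
  define T where "T z = (if z \<in> J ` B then q (inv_into B J z) else y0)" for z
  have TJ: "T (J x) = q x" if "x \<in> B" for x using that by (simp add: T_def inv_into_f_f[OF inj_J])
  have Tim: "T ` E = q ` {x \<in> B. J x \<in> E} \<union> (if E \<subseteq> J ` B then {} else {y0})" for E
  proof -
    have "E = J ` {x \<in> B. J x \<in> E} \<union> (E - J ` B)" by auto
    then have "T ` E = T ` J ` {x \<in> B. J x \<in> E} \<union> T ` (E - J ` B)" by (metis image_Un)
    moreover have "T ` J ` {x \<in> B. J x \<in> E} = q ` {x \<in> B. J x \<in> E}"
      unfolding image_image by (rule image_cong) (auto simp: TJ)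
    moreover have "T ` (E - J ` B) = (if E \<subseteq> J ` B then {} else {y0})" by (auto simp: T_def)
    ultimately show ?thesis by simp
  qed
  have "T \<in> transport_maps X Y f g"
    unfolding transport_maps_def
  proof (intro CollectI conjI ballI allI impI)
    fix z assume z: "z \<in> X"
    show "T z \<in> Y"
    proof (cases "z \<in> J ` B")
      case True
      then show ?thesis using TJ B(9) by auto
    next
      case False
      then show ?thesis using y0 z by (auto simp: T_def)
    qed
  next
    have "T \<in> borel_measurable (lebesgue_on X)"
    proof (rule borel_measurableI)
      fix S :: "(real^'n) set" assume S: "open S"
      have "continuous_on UNIV q" by (intro continuous_intros proxx_continuous)
      then have "open (q -` S)" using S open_vimage by blast
      then have C: "B \<inter> q -` S \<in> sets lebesgue" using B_lebesgue by auto
      have "J ` (B \<inter> q -` S) \<in> sets lebesgue" by (rule image_lebesgue[OF C]) auto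
      moreover have "X - J ` B \<in> sets lebesgue" using X_lebesgue image_lebesgue(1)[OF B_lebesgue] by auto
      moreover have "T -` S \<inter> X = J ` (B \<inter> q -` S) \<union> (if y0 \<in> S then X - J ` B else {})"
      proof (intro equalityI subsetI)
        fix x assume x: "x \<in> T -` S \<inter> X"
        show "x \<in> J ` (B \<inter> q -` S) \<union> (if y0 \<in> S then X - J ` B else {})"
        proof (cases "x \<in> J ` B")
          case True
          then obtain b where b: "b \<in> B" "x = J b" by blast
          then have "b \<in> B \<inter> q -` S" using x TJ by simp
          then show ?thesis using b(2) by blast
        next
          case False
          then show ?thesis using x by (simp add: T_def)
        qed
      next
        fix x assume x: "x \<in> J ` (B \<inter> q -` S) \<union> (if y0 \<in> S then X - J ` B else {})"
        show "x \<in> T -` S \<inter> X"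
        proof (cases "x \<in> J ` B")
          case True
          then obtain b where "b \<in> B" "q b \<in> S" "x = J b" using x by (auto split: if_splits)
          then show ?thesis using TJ B(5) by simp
        next
          case False
          then show ?thesis using x by (auto simp: T_def split: if_splits)
        qed
      qed
      ultimately have "T -` S \<inter> X \<in> sets lebesgue" by auto
      then show "T -` S \<inter> space (lebesgue_on X) \<in> sets (lebesgue_on X)"
        using X_lebesgue by (simp add: sets_restrict_space_iff)
    qed
    then show "T measurable_on X" using measurable_on_iff_borel_measurable[OF X_lebesgue] by blast
  next
    fix E assume E: "E \<in> sets lebesgue \<and> E \<subseteq> X"
    let ?C = "{x \<in> B. J x \<in> E}"
    have C: "?C \<in> sets lebesgue" "?C \<subseteq> B" using preimage_lebesgue E by auto
    show "T ` E \<in> sets lebesgue"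
      unfolding Tim using image_lebesgue(2)[OF C] by (intro sets.Un) auto
    have "integral E f = integral (E \<inter> J ` B) f" using integral_f_J E by simp
    also have "E \<inter> J ` B = J ` ?C" by auto
    also have "integral (J ` ?C) f = integral (q ` ?C) g" by (rule mass_eq[OF C])
    also have "\<dots> = integral (T ` E) g"
      unfolding Tim by (rule integral_subset_negligible) (auto intro: negligible_subset[OF negligible_sing[of y0]])
    finally show "integral E f = integral (T ` E) g" .
  qed
  moreover have "T x \<in> subgrad X u x" if "x \<in> J ` B" for x
    using that TJ B(7) by auto
  ultimately show ?thesis by blast
qed

end

section \<open>Duality\<close>

text \<open>Common subgradients at two points confine the increments of \<open>U\<close> and of
  \<open>V\<close> to the same interval, of length
  \<open>(t - s) * (P t \<bullet> d - P s \<bullet> d)\<close>. Such bounds telescope under fine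
  subdivision.\<close>

lemma difference_constant_of_common_subgradients:
  fixes U V :: "'a::real_inner \<Rightarrow> real"
  assumes Y: "convex Y" and y: "y0 \<in> Y" "y1 \<in> Y"
    and sub: "\<And>y. y \<in> Y \<Longrightarrow> \<exists>x. norm x \<le> R \<and> (\<forall>y'. U y + x \<bullet> (y' - y) \<le> U y') \<and> (\<forall>y'. V y + x \<bullet> (y' - y) \<le> V y')"
  shows "U y1 - V y1 = U y0 - V y0"
proof -
  define d where "d = y1 - y0"
  define P where "P t = (SOME x. norm x \<le> R \<and> (\<forall>y'. U (y0 + t *\<^sub>R d) + x \<bullet> (y' - (y0 + t *\<^sub>R d)) \<le> U y') \<and>
      (\<forall>y'. V (y0 + t *\<^sub>R d) + x \<bullet> (y' - (y0 + t *\<^sub>R d)) \<le> V y'))" for t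
  have P: "norm (P t) \<le> R" "U (y0 + t *\<^sub>R d) + P t \<bullet> (y' - (y0 + t *\<^sub>R d)) \<le> U y'"
      "V (y0 + t *\<^sub>R d) + P t \<bullet> (y' - (y0 + t *\<^sub>R d)) \<le> V y'" if t: "0 \<le> t" "t \<le> 1" for t y'
  proof -
    have "(1 - t) *\<^sub>R y0 + t *\<^sub>R y1 \<in> Y" using Y y t by (simp add: convex_alt)
    then have "y0 + t *\<^sub>R d \<in> Y" by (simp add: d_def algebra_simps)
    from someI_ex[OF sub[OF this]]
    show "norm (P t) \<le> R" "U (y0 + t *\<^sub>R d) + P t \<bullet> (y' - (y0 + t *\<^sub>R d)) \<le> U y'"
      "V (y0 + t *\<^sub>R d) + P t \<bullet> (y' - (y0 + t *\<^sub>R d)) \<le> V y'"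
      by (auto simp: P_def)
  qed
  define \<psi> where "\<psi> t = U (y0 + t *\<^sub>R d) - V (y0 + t *\<^sub>R d)" for t
  have step: "\<bar>\<psi> t - \<psi> s\<bar> \<le> (t - s) * (P t \<bullet> d - P s \<bullet> d)" if "0 \<le> s" "s \<le> 1" "0 \<le> t" "t \<le> 1" for s t
  proof -
    have e: "(y0 + t *\<^sub>R d) - (y0 + s *\<^sub>R d) = (t - s) *\<^sub>R d" "(y0 + s *\<^sub>R d) - (y0 + t *\<^sub>R d) = (s - t) *\<^sub>R d"
      by (simp_all add: scaleR_diff_left)
    show ?thesis
      using P(2)[OF that(1,2), of "y0 + t *\<^sub>R d"] P(2)[OF that(3,4), of "y0 + s *\<^sub>R d"]
        P(3)[OF that(1,2), of "y0 + t *\<^sub>R d"] P(3)[OF that(3,4), of "y0 + s *\<^sub>R d"]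
      unfolding e \<psi>_def by (simp add: algebra_simps abs_le_iff)
  qed
  have "\<bar>\<psi> 1 - \<psi> 0\<bar> \<le> 0"
    by (rule increment_bound[of \<psi> "\<lambda>t. P t \<bullet> d"]) (use step in simp)
  then show ?thesis by (simp add: \<psi>_def d_def)
qed

text \<open>The bound \<open>R\<close> gives compactness: common subgradients at points of
  \<open>Q\<close> accumulate at common subgradients at the limit point.\<close>

lemma common_subgradient_closure:
  fixes U V :: "'a::euclidean_space \<Rightarrow> real"
  assumes cont: "continuous_on UNIV U" "continuous_on UNIV V" and y: "y \<in> closure Q"
    and sub: "\<And>y. y \<in> Q \<Longrightarrow> \<exists>x. norm x \<le> R \<and> (\<forall>y'. U y + x \<bullet> (y' - y) \<le> U y') \<and> (\<forall>y'. V y + x \<bullet> (y' - y) \<le> V y')"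
  shows "\<exists>x. norm x \<le> R \<and> (\<forall>y'. U y + x \<bullet> (y' - y) \<le> U y') \<and> (\<forall>y'. V y + x \<bullet> (y' - y) \<le> V y')"
proof -
  obtain ys where ys: "\<And>n. ys n \<in> Q" "ys \<longlonglongrightarrow> y"
    using y unfolding closure_sequential by blast
  obtain xs where xs: "\<And>n. norm (xs n) \<le> R" "\<And>n y'. U (ys n) + xs n \<bullet> (y' - ys n) \<le> U y'"
      "\<And>n y'. V (ys n) + xs n \<bullet> (y' - ys n) \<le> V y'"
    using sub[OF ys(1)] by metis
  have "\<forall>n. xs n \<in> cball 0 R" using xs(1) by simp
  then obtain l \<sigma> where l: "l \<in> cball 0 R" "strict_mono \<sigma>" "(xs \<circ> \<sigma>) \<longlonglongrightarrow> l"
    using compact_cball[of 0 R] unfolding compact_def by metis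
  have xl: "(\<lambda>n. xs (\<sigma> n)) \<longlonglongrightarrow> l" using l(3) by (simp add: o_def)
  have yl: "(\<lambda>n. ys (\<sigma> n)) \<longlonglongrightarrow> y" using LIMSEQ_subseq_LIMSEQ[OF ys(2) l(2)] by (simp add: o_def)
  have lim: "W y + l \<bullet> (y' - y) \<le> W y'"
    if W: "continuous_on UNIV W" "\<And>n. W (ys n) + xs n \<bullet> (y' - ys n) \<le> W y'" for W :: "'a \<Rightarrow> real" and y'
  proof -
    have "(\<lambda>n. W (ys (\<sigma> n))) \<longlonglongrightarrow> W y"
      using continuous_on_tendsto_compose[OF W(1) yl] by simp
    then have "(\<lambda>n. W (ys (\<sigma> n)) + xs (\<sigma> n) \<bullet> (y' - ys (\<sigma> n))) \<longlonglongrightarrow> W y + l \<bullet> (y' - y)"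
      by (intro tendsto_intros xl yl)
    then show ?thesis by (rule LIMSEQ_le_const2) (use W(2) in blast)
  qed
  show ?thesis using l(1) lim[OF cont(1) xs(2)] lim[OF cont(2) xs(3)] by (intro exI[of _ l]) auto
qed

section \<open>Transport maps as pushforwards\<close>

lemma emeasure_density_lebesgue_on:
  fixes k :: "'a::euclidean_space \<Rightarrow> real"
  assumes k: "k absolutely_integrable_on X" "\<And>x. x \<in> X \<Longrightarrow> 0 \<le> k x"
    and X: "X \<in> sets lebesgue" and E: "E \<in> sets lebesgue" "E \<subseteq> X"
  shows "emeasure (density (lebesgue_on X) (\<lambda>x. ennreal (k x))) E = ennreal (integral E k)"
proof -
  have m: "k \<in> borel_measurable (lebesgue_on X)"
    using absolutely_integrable_imp_integrable[OF k(1) X] by auto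
  have kE: "k absolutely_integrable_on E" by (rule set_integrable_subset[OF k(1) E])
  have "emeasure (density (lebesgue_on X) (\<lambda>x. ennreal (k x))) E = (\<integral>\<^sup>+x. ennreal (k x) * indicator E x \<partial>lebesgue_on X)"
    using m X E by (intro emeasure_density) (auto simp: sets_restrict_space_iff)
  also have "\<dots> = (\<integral>\<^sup>+x. ennreal (k x) * indicator E x * indicator X x \<partial>lebesgue)"
    using X by (intro nn_integral_restrict_space) simp
  also have "\<dots> = (\<integral>\<^sup>+x. ennreal (indicator E x *\<^sub>R k x) \<partial>lebesgue)"
    using E(2) by (intro nn_integral_cong) (auto simp: indicator_def)
  also have "\<dots> = ennreal (\<integral>x. indicator E x *\<^sub>R k x \<partial>lebesgue)"
    using kE k(2) E(2) by (intro nn_integral_eq_integral) (auto simp: set_integrable_def indicator_def)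
  also have "(\<integral>x. indicator E x *\<^sub>R k x \<partial>lebesgue) = integral E k"
    using set_lebesgue_integral_eq_integral(2)[OF kE] by (simp add: set_lebesgue_integral_def)
  finally show ?thesis .
qed

lemma AE_lebesgue_on_not_negligible:
  assumes "negligible N" "X \<in> sets lebesgue"
  shows "AE x in lebesgue_on X. x \<notin> N"
proof -
  have "AE x in lebesgue. x \<notin> N"
    using assms(1) by (intro AE_not_in) (simp add: negligible_iff_null_sets)
  then show ?thesis using assms(2) by (subst AE_restrict_space_iff) auto
qed

context monge_data
begin

lemma f_integrable: "integrable (lebesgue_on X) f"
  by (rule absolutely_integrable_imp_integrable[OF f_int X_lebesgue])

lemma integrable_f_mult:
  assumes "h \<in> borel_measurable (lebesgue_on X)" "AE x in lebesgue_on X. f x \<noteq> 0 \<longrightarrow> \<bar>h x\<bar> \<le> K"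
  shows "integrable (lebesgue_on X) (\<lambda>x. f x * h x)"
proof (rule Bochner_Integration.integrable_bound)
  show "integrable (lebesgue_on X) (\<lambda>x. K * f x)" using f_integrable by simp
  show "AE x in lebesgue_on X. norm (f x * h x) \<le> norm (K * f x)"
    using assms(2)
  proof eventually_elim
    case (elim x)
    show ?case
    proof (cases "f x = 0")
      case False
      then have "\<bar>h x\<bar> \<le> \<bar>K\<bar>" using elim by auto
      then have "\<bar>h x\<bar> * \<bar>f x\<bar> \<le> \<bar>K\<bar> * \<bar>f x\<bar>" by (rule mult_right_mono) simp
      then show ?thesis by (simp add: abs_mult mult.commute)
    qed simp
  qed
qed (use assms(1) f_integrable in measurable)

lemma transport_mapsD:
  assumes "S \<in> transport_maps X Y f g"
  shows "x \<in> X \<Longrightarrow> S x \<in> Y" "S \<in> borel_measurable (lebesgue_on X)"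
    "E \<in> sets lebesgue \<Longrightarrow> E \<subseteq> X \<Longrightarrow> S ` E \<in> sets lebesgue"
    "E \<in> sets lebesgue \<Longrightarrow> E \<subseteq> X \<Longrightarrow> integral E f = integral (S ` E) g"
  using assms measurable_on_iff_borel_measurable[OF X_lebesgue] by (auto simp: transport_maps_def)

text \<open>\<open>transport_maps\<close> controls images, while integration needs preimages. The
  image of the preimage of \<open>A\<close> is only the part of \<open>A\<close> inside the range of
  \<open>S\<close>; by equality of the total masses the rest of \<open>Y\<close> carries no mass of
  \<open>g\<close>.\<close>

lemma pushforward_set:
  assumes S: "S \<in> transport_maps X Y f g" and A: "A \<in> sets borel"
  shows "{x \<in> X. S x \<in> A} \<in> sets lebesgue" "integral {x \<in> X. S x \<in> A} f = integral (A \<inter> Y) g"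
proof -
  note SD = transport_mapsD[OF S]
  let ?E = "{x \<in> X. S x \<in> A}"
  have "S -` A \<inter> space (lebesgue_on X) \<in> sets (lebesgue_on X)" by (rule measurable_sets[OF SD(2) A])
  then show E: "?E \<in> sets lebesgue"
    using X_lebesgue by (auto simp: sets_restrict_space_iff vimage_def Collect_conj_eq Int_commute)
  have SX: "S ` X \<in> sets lebesgue" "S ` X \<subseteq> Y" using SD(3)[OF X_lebesgue] SD(1) by auto
  have A': "A \<in> sets lebesgue" using A by auto
  have gi: "g integrable_on Z" if "Z \<in> sets lebesgue" for Z
    using g_int_subset[OF that] set_lebesgue_integral_eq_integral(1) by blast
  have empty: "Z \<inter> S ` X \<inter> (Z - S ` X) = {}" for Z by auto
  have split: "integral Z g = integral (Z \<inter> S ` X) g + integral (Z - S ` X) g" if "Z \<in> sets lebesgue" for Z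
  proof -
    have "integral (Z \<inter> S ` X \<union> (Z - S ` X)) g = integral (Z \<inter> S ` X) g + integral (Z - S ` X) g"
      by (rule integral_Un) (use that SX gi in \<open>auto simp: empty\<close>)
    then show ?thesis by (simp add: Int_Diff_Un)
  qed
  have g0: "0 \<le> g y" for y by (rule g(2))
  have "integral Y g = integral (S ` X) g" using mass SD(4)[OF X_lebesgue] by simp
  moreover have "Y \<inter> S ` X = S ` X" using SX by auto
  ultimately have zero: "integral (Y - S ` X) g = 0" using split[OF Y_lebesgue] by simp
  have AY: "A \<inter> Y \<in> sets lebesgue" using A' Y_lebesgue by auto
  have "integral (A \<inter> Y - S ` X) g \<le> integral (Y - S ` X) g"
    by (rule integral_subset_le) (use gi AY SX Y_lebesgue g0 in auto)
  moreover have "0 \<le> integral (A \<inter> Y - S ` X) g" by (rule integral_nonneg) (use gi AY SX g0 in auto)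
  ultimately have "integral (A \<inter> Y) g = integral (A \<inter> Y \<inter> S ` X) g" using split[OF AY] zero by simp
  also have "A \<inter> Y \<inter> S ` X = S ` ?E" using SX(2) by auto
  finally show "integral ?E f = integral (A \<inter> Y) g" using SD(4)[OF E] by auto
qed

lemma pushforward_integral:
  fixes h :: "real^'n \<Rightarrow> real"
  assumes S: "S \<in> transport_maps X Y f g" and h: "h \<in> borel_measurable borel"
  shows "(\<integral>x. f x * h (S x) \<partial>lebesgue_on X) = (\<integral>y. g y * h y \<partial>lebesgue_on Y)"
proof -
  note Sm = transport_mapsD(2)[OF S]
  have gY: "g absolutely_integrable_on Y" by (rule g_int_subset[OF Y_lebesgue])
  have fm: "f \<in> borel_measurable (lebesgue_on X)" and gm: "g \<in> borel_measurable (lebesgue_on Y)"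
    using f_integrable absolutely_integrable_imp_integrable[OF gY Y_lebesgue] by auto
  have idm: "(\<lambda>y. y) \<in> borel_measurable (lebesgue_on Y)"
    by (intro measurable_restrict_space1 measurable_completion) simp
  define MX MY where "MX = density (lebesgue_on X) (\<lambda>x. ennreal (f x))" and "MY = density (lebesgue_on Y) (\<lambda>x. ennreal (g x))"
  \<comment> \<open>On the side of \<open>Y\<close> the identity map merely restricts the measure to
    Borel sets, on which \<open>pushforward_set\<close> compares the two.\<close>
  have "distr MX borel S = distr MY borel (\<lambda>y. y)"
  proof (rule measure_eqI)
    fix A assume "A \<in> sets (distr MX borel S)"
    then have A: "A \<in> sets borel" by simp
    have "emeasure (distr MX borel S) A = emeasure MX {x \<in> X. S x \<in> A}"
      using Sm A by (subst emeasure_distr) (auto simp: MX_def vimage_def Collect_conj_eq Int_commute)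
    also have "\<dots> = ennreal (integral {x \<in> X. S x \<in> A} f)"
      unfolding MX_def
      by (rule emeasure_density_lebesgue_on[OF f_int f_nonneg X_lebesgue pushforward_set(1)[OF S A]]) auto
    also have "\<dots> = ennreal (integral (A \<inter> Y) g)" by (simp add: pushforward_set(2)[OF S A])
    also have "\<dots> = emeasure MY (A \<inter> Y)"
      unfolding MY_def
      by (rule emeasure_density_lebesgue_on[symmetric, OF gY g(2) Y_lebesgue]) (use A Y_lebesgue in auto)
    also have "\<dots> = emeasure (distr MY borel (\<lambda>y. y)) A"
      using idm A by (subst emeasure_distr) (auto simp: MY_def)
    finally show "emeasure (distr MX borel S) A = emeasure (distr MY borel (\<lambda>y. y)) A" .
  qed simp
  then have "(\<integral>x. h x \<partial>distr MX borel S) = (\<integral>x. h x \<partial>distr MY borel (\<lambda>y. y))" by simp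
  moreover have "(\<integral>x. h x \<partial>distr MX borel S) = (\<integral>x. f x * h (S x) \<partial>lebesgue_on X)"
  proof -
    have "(\<integral>x. h x \<partial>distr MX borel S) = (\<integral>x. h (S x) \<partial>MX)"
      using Sm h by (intro integral_distr) (auto simp: MX_def)
    also have "\<dots> = (\<integral>x. f x *\<^sub>R h (S x) \<partial>lebesgue_on X)"
      unfolding MX_def using Sm h fm f_nonneg by (intro integral_density) auto
    finally show ?thesis by simp
  qed
  moreover have "(\<integral>x. h x \<partial>distr MY borel (\<lambda>y. y)) = (\<integral>y. g y * h y \<partial>lebesgue_on Y)"
  proof -
    have "(\<integral>x. h x \<partial>distr MY borel (\<lambda>y. y)) = (\<integral>x. h x \<partial>MY)"
      using idm h by (intro integral_distr) (auto simp: MY_def)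
    also have "\<dots> = (\<integral>y. g y *\<^sub>R h y \<partial>lebesgue_on Y)"
      unfolding MY_def using measurable_compose[OF idm h] gm g(2) by (intro integral_density) auto
    finally show ?thesis by simp
  qed
  ultimately show ?thesis by simp
qed

section \<open>Legendre transform and the Kantorovich bound\<close>

definition conj :: "real^'n \<Rightarrow> real" where "conj y = (SUP x\<in>X. x \<bullet> y - u x)"

text \<open>The defect in the Fenchel-Young inequality.\<close>

definition gap :: "(real^'n \<Rightarrow> real^'n) \<Rightarrow> real^'n \<Rightarrow> real" where
  "gap S x = u x + conj (S x) - x \<bullet> S x"

definition RX :: real where "RX = (SOME r. \<forall>x\<in>X. norm x \<le> r)"

lemma RX: "x \<in> X \<Longrightarrow> norm x \<le> RX"
proof -
  have "\<exists>r. \<forall>x\<in>X. norm x \<le> r" using bounded_X by (simp add: bounded_iff)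
  from someI_ex[OF this] show "x \<in> X \<Longrightarrow> norm x \<le> RX" by (simp add: RX_def)
qed

text \<open>The supremum must first be finite: one affine minorant of \<open>u\<close> together with
  boundedness of \<open>X\<close> ensures it.\<close>

lemma conj_upper:
  assumes "x \<in> X"
  shows "x \<bullet> y - u x \<le> conj y"
proof -
  obtain p where p: "p \<in> subgrad X u x" using subgrad_exists[OF assms] by blast
  have "bdd_above ((\<lambda>x. x \<bullet> y - u x) ` X)"
  proof (rule bdd_aboveI2)
    fix x' assume x': "x' \<in> X"
    have "x' \<bullet> y \<le> RX * norm y"
      using norm_cauchy_schwarz[of x' y] RX[OF x'] mult_right_mono[OF RX[OF x'] norm_ge_zero[of y]] by linarith
    moreover have "- (p \<bullet> x') \<le> norm p * RX"
      using Cauchy_Schwarz_ineq2[of p x'] mult_left_mono[OF RX[OF x'] norm_ge_zero[of p]] by linarith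
    moreover have "u x + p \<bullet> x' - p \<bullet> x \<le> u x'" using subgradD[OF p x'] by (simp add: inner_diff_right)
    ultimately show "x' \<bullet> y - u x' \<le> RX * norm y + norm p * RX - u x + p \<bullet> x" by linarith
  qed
  then show ?thesis unfolding conj_def by (rule cSUP_upper[OF assms])
qed

lemma conj_least: "X \<noteq> {} \<Longrightarrow> (\<And>x. x \<in> X \<Longrightarrow> x \<bullet> y - u x \<le> c) \<Longrightarrow> conj y \<le> c"
  unfolding conj_def by (rule cSUP_least)

lemma conj_eq_iff:
  assumes x: "x \<in> X"
  shows "conj y = x \<bullet> y - u x \<longleftrightarrow> y \<in> subgrad X u x"
proof
  assume "conj y = x \<bullet> y - u x"
  then show "y \<in> subgrad X u x"
    using conj_upper[of _ y] by (force simp: subgrad_def inner_diff_right inner_commute)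
next
  assume y: "y \<in> subgrad X u x"
  have "conj y \<le> x \<bullet> y - u x"
  proof (rule conj_least)
    fix x' assume "x' \<in> X"
    from subgradD[OF y this] show "x' \<bullet> y - u x' \<le> x \<bullet> y - u x" by (simp add: inner_diff_right inner_commute)
  qed (use x in auto)
  with conj_upper[OF x, of y] show "conj y = x \<bullet> y - u x" by simp
qed

lemma conj_subgrad:
  assumes "x \<in> X" "y \<in> subgrad X u x"
  shows "conj y + x \<bullet> (y' - y) \<le> conj y'"
  using conj_eq_iff[OF assms(1), of y] assms(2) conj_upper[OF assms(1), of y'] by (simp add: inner_diff_right)

lemma conj_lipschitz:
  assumes "X \<noteq> {}"
  shows "\<bar>conj y - conj y'\<bar> \<le> RX * norm (y - y')"
proof -
  have le: "conj y \<le> conj y' + RX * norm (y - y')" for y y'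
  proof (rule conj_least[OF assms])
    fix x assume x: "x \<in> X"
    have "x \<bullet> (y - y') \<le> RX * norm (y - y')"
      using norm_cauchy_schwarz[of x "y - y'"] mult_right_mono[OF RX[OF x] norm_ge_zero[of "y - y'"]] by linarith
    with conj_upper[OF x, of y'] show "x \<bullet> y - u x \<le> conj y' + RX * norm (y - y')"
      by (simp add: inner_diff_right)
  qed
  show ?thesis using le[of y y'] le[of y' y] by (simp add: abs_le_iff norm_minus_commute)
qed

lemma conj_continuous:
  assumes "X \<noteq> {}"
  shows "continuous_on UNIV conj"
proof (rule lipschitz_on_continuous_on, rule lipschitz_onI)
  show "dist (conj x) (conj y) \<le> RX * dist x y" for x y
    using conj_lipschitz[OF assms, of x y] by (simp add: dist_real_def dist_norm)
  show "0 \<le> RX" using assms RX order_trans[OF norm_ge_zero] by blast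
qed

lemma gap_nonneg: "x \<in> X \<Longrightarrow> 0 \<le> gap S x"
  using conj_upper[of x "S x"] by (simp add: gap_def)

lemma gap_zero_iff: "x \<in> X \<Longrightarrow> gap S x = 0 \<longleftrightarrow> S x \<in> subgrad X u x"
  using conj_eq_iff[of x "S x"] by (auto simp: gap_def)

lemma bounded_on_Y:
  fixes h :: "real^'n \<Rightarrow> real"
  assumes "continuous_on UNIV h"
  obtains K where "\<And>y. y \<in> Y \<Longrightarrow> \<bar>h y\<bar> \<le> K"
proof -
  have "compact (h ` closure Y)"
    using Y(2) by (intro compact_continuous_image continuous_on_subset[OF assms]) (auto simp: compact_closure)
  then obtain K where "\<forall>z\<in>h ` closure Y. norm z \<le> K" using compact_imp_bounded bounded_iff by blast
  then show thesis using closure_subset by (intro that[of K]) force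
qed

lemma AE_X_pos: "AE x in lebesgue_on X. f x \<noteq> 0 \<longrightarrow> x \<in> J ` B"
proof -
  have "AE x in lebesgue_on X. x \<notin> Xpos - J ` B"
    by (rule AE_lebesgue_on_not_negligible[OF negligible_Xpos_minus X_lebesgue])
  moreover have "AE x in lebesgue_on X. x \<in> X" by (rule AE_I2) simp
  ultimately show ?thesis
    by eventually_elim (use f_nonneg in \<open>force simp: Xpos_def less_le\<close>)
qed

text \<open>The dual value at the pair of \<open>u\<close> and \<open>conj\<close>: expand the
  square in the cost and replace \<open>x \<bullet> y\<close> by its upper bound
  \<open>u x + conj y\<close>. No transport map occurs in it.\<close>

definition cost_bound :: real where
  "cost_bound = (\<integral>x. f x * (norm x)\<^sup>2 \<partial>lebesgue_on X) - 2 * ((\<integral>x. f x * u x \<partial>lebesgue_on X)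
      + (\<integral>y. g y * conj y \<partial>lebesgue_on Y)) + (\<integral>y. g y * (norm y)\<^sup>2 \<partial>lebesgue_on Y)"

text \<open>The terms in \<open>S x\<close> alone become integrals over \<open>Y\<close> by
  \<open>pushforward_integral\<close>, so the dependence on \<open>S\<close> is confined to the
  gap.\<close>

lemma ot_cost_eq_gap:
  assumes ne: "X \<noteq> {}" and S: "S \<in> transport_maps X Y f g"
  shows "integrable (lebesgue_on X) (\<lambda>x. f x * gap S x)"
    and "ot_cost X f S = cost_bound + 2 * (\<integral>x. f x * gap S x \<partial>lebesgue_on X)"
proof -
  let ?M = "lebesgue_on X"
  note Sm[measurable] = transport_mapsD(2)[OF S]
  have inY: "x \<in> X \<Longrightarrow> S x \<in> Y" for x by (rule transport_mapsD(1)[OF S])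
  have idm[measurable]: "(\<lambda>x. x) \<in> borel_measurable ?M"
    by (intro measurable_restrict_space1 measurable_completion) simp
  have um[measurable]: "u \<in> borel_measurable ?M"
    by (rule continuous_imp_measurable_on_sets_lebesgue[OF cont_u X_lebesgue])
  have cm[measurable]: "conj \<in> borel_measurable borel"
    by (rule borel_measurable_continuous_onI[OF conj_continuous[OF ne]])
  obtain K1 where K1: "\<And>y. y \<in> Y \<Longrightarrow> \<bar>conj y\<bar> \<le> K1" using bounded_on_Y[OF conj_continuous[OF ne]] by blast
  obtain K2 where K2: "\<And>y. y \<in> Y \<Longrightarrow> \<bar>norm y\<bar> \<le> K2" using bounded_on_Y[of norm] continuous_on_norm_id by blast
  have nK2: "norm y \<le> K2" if "y \<in> Y" for y using K2[OF that] by simp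
  have AEX: "AE x in ?M. x \<in> X" by (rule AE_I2) simp
  have xy: "\<bar>x \<bullet> y\<bar> \<le> RX * K2" if "x \<in> X" "y \<in> Y" for x y
  proof -
    have "\<bar>x \<bullet> y\<bar> \<le> norm x * norm y" by (rule Cauchy_Schwarz_ineq2)
    also have "\<dots> \<le> RX * K2" using RX[OF that(1)] nK2[OF that(2)] order_trans[OF norm_ge_zero RX[OF that(1)]] by (intro mult_mono) auto
    finally show ?thesis .
  qed
  have i1: "integrable ?M (\<lambda>x. f x * (norm x)\<^sup>2)"
  proof (rule integrable_f_mult[where K="RX\<^sup>2"])
    show "AE x in ?M. f x \<noteq> 0 \<longrightarrow> \<bar>(norm x)\<^sup>2\<bar> \<le> RX\<^sup>2"
      using AEX by eventually_elim (use RX in \<open>auto intro: power_mono\<close>)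
  qed measurable
  \<comment> \<open>\<open>u\<close> may be unbounded near the boundary of \<open>X\<close>. Where
    \<open>f\<close> does not vanish, almost every \<open>x\<close> is \<open>J b\<close> with
    \<open>b\<close> in \<open>B\<close>, and there
    \<open>u x = x \<bullet> q b - conj (q b)\<close> with \<open>q b\<close> in the bounded set
    \<open>Y\<close>.\<close>
  have i2: "integrable ?M (\<lambda>x. f x * u x)"
  proof (rule integrable_f_mult[where K="RX * K2 + K1"])
    show "AE x in ?M. f x \<noteq> 0 \<longrightarrow> \<bar>u x\<bar> \<le> RX * K2 + K1"
      using AE_X_pos
    proof eventually_elim
      case (elim x)
      show ?case
      proof
        assume "f x \<noteq> 0"
        then obtain b where b: "b \<in> B" "x = J b" using elim by blast
        then have "conj (q b) = x \<bullet> q b - u x" using conj_eq_iff[OF B(5)[OF b(1)], of "q b"] B(7)[OF b(1)] by simp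
        then show "\<bar>u x\<bar> \<le> RX * K2 + K1" using xy[of x "q b"] K1[of "q b"] B[OF b(1)] b(2) by auto
      qed
    qed
  qed measurable
  have i3: "integrable ?M (\<lambda>x. f x * conj (S x))"
  proof (rule integrable_f_mult[where K=K1])
    show "AE x in ?M. f x \<noteq> 0 \<longrightarrow> \<bar>conj (S x)\<bar> \<le> K1"
      using AEX by eventually_elim (use K1 inY in auto)
  qed measurable
  have i4: "integrable ?M (\<lambda>x. f x * (x \<bullet> S x))"
  proof (rule integrable_f_mult[where K="RX * K2"])
    show "AE x in ?M. f x \<noteq> 0 \<longrightarrow> \<bar>x \<bullet> S x\<bar> \<le> RX * K2"
      using AEX by eventually_elim (use xy inY in auto)
  qed measurable
  have i5: "integrable ?M (\<lambda>x. f x * (norm (S x))\<^sup>2)"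
  proof (rule integrable_f_mult[where K="K2\<^sup>2"])
    show "AE x in ?M. f x \<noteq> 0 \<longrightarrow> \<bar>(norm (S x))\<^sup>2\<bar> \<le> K2\<^sup>2"
      using AEX by eventually_elim (use nK2 inY in \<open>auto intro: power_mono\<close>)
  qed measurable
  have gap: "(\<lambda>x. f x * gap S x) = (\<lambda>x. f x * u x + f x * conj (S x) - f x * (x \<bullet> S x))"
    by (simp add: gap_def fun_eq_iff algebra_simps)
  show "integrable ?M (\<lambda>x. f x * gap S x)" unfolding gap using i2 i3 i4 by simp
  have Igap: "(\<integral>x. f x * gap S x \<partial>?M) = (\<integral>x. f x * u x \<partial>?M) + (\<integral>x. f x * conj (S x) \<partial>?M) - (\<integral>x. f x * (x \<bullet> S x) \<partial>?M)"
    unfolding gap using i2 i3 i4 by simp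
  have sq: "(\<lambda>x. (norm (x - S x))\<^sup>2 * f x) = (\<lambda>x. f x * (norm x)\<^sup>2 - 2 * (f x * (x \<bullet> S x)) + f x * (norm (S x))\<^sup>2)"
    by (simp add: fun_eq_iff power2_norm_eq_inner inner_diff_left inner_diff_right inner_commute algebra_simps)
  have isq: "integrable ?M (\<lambda>x. (norm (x - S x))\<^sup>2 * f x)" unfolding sq using i1 i4 i5 by simp
  have "ot_cost X f S = (\<integral>x. (norm (x - S x))\<^sup>2 * f x \<partial>?M)"
    unfolding ot_cost_def by (rule lebesgue_integral_eq_integral[symmetric, OF isq X_lebesgue])
  also have "\<dots> = (\<integral>x. f x * (norm x)\<^sup>2 \<partial>?M) - 2 * (\<integral>x. f x * (x \<bullet> S x) \<partial>?M) + (\<integral>x. f x * (norm (S x))\<^sup>2 \<partial>?M)"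
    unfolding sq using i1 i4 i5 by simp
  also have "(\<integral>x. f x * (norm (S x))\<^sup>2 \<partial>?M) = (\<integral>y. g y * (norm y)\<^sup>2 \<partial>lebesgue_on Y)"
    by (rule pushforward_integral[OF S, of "\<lambda>y. (norm y)\<^sup>2"]) measurable
  finally show "ot_cost X f S = cost_bound + 2 * (\<integral>x. f x * gap S x \<partial>?M)"
    using Igap pushforward_integral[OF S cm] by (simp add: cost_bound_def)
qed

lemma cost_bound_le:
  assumes "X \<noteq> {}" "S \<in> transport_maps X Y f g"
  shows "cost_bound \<le> ot_cost X f S"
proof -
  have "0 \<le> (\<integral>x. f x * gap S x \<partial>lebesgue_on X)"
    by (rule Bochner_Integration.integral_nonneg) (use f_nonneg gap_nonneg in auto)
  then show ?thesis using ot_cost_eq_gap(2)[OF assms] by simp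
qed

lemma cost_bound_attained:
  assumes "X \<noteq> {}" "T \<in> transport_maps X Y f g" "\<forall>x\<in>J ` B. T x \<in> subgrad X u x"
  shows "ot_cost X f T = cost_bound"
proof -
  have "(\<integral>x. f x * gap T x \<partial>lebesgue_on X) = (\<integral>x. 0 \<partial>lebesgue_on X)"
  proof (rule integral_cong_AE)
    show "AE x in lebesgue_on X. f x * gap T x = 0"
      using AE_X_pos by eventually_elim (use gap_zero_iff assms(3) J_image_subset[of B] in auto)
  qed (use ot_cost_eq_gap(1)[OF assms(1,2)] in auto)
  then show ?thesis using ot_cost_eq_gap(2)[OF assms(1,2)] by simp
qed

text \<open>Converse of \<open>cost_bound_attained\<close>, meant for an optimal map that was built
  from another subsolution.\<close>

lemma subgrad_of_cost_bound:
  assumes "X \<noteq> {}" "S \<in> transport_maps X Y f g" "ot_cost X f S = cost_bound"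
  shows "AE x in lebesgue_on X. f x \<noteq> 0 \<longrightarrow> S x \<in> subgrad X u x"
proof -
  have "(\<integral>x. f x * gap S x \<partial>lebesgue_on X) = 0"
    using ot_cost_eq_gap(2)[OF assms(1,2)] assms(3) by simp
  moreover have "AE x in lebesgue_on X. 0 \<le> f x * gap S x"
    by (rule AE_I2) (use f_nonneg gap_nonneg in auto)
  ultimately have "AE x in lebesgue_on X. f x * gap S x = 0"
    using integral_nonneg_eq_0_iff_AE[OF ot_cost_eq_gap(1)[OF assms(1,2)]] by blast
  moreover have "AE x in lebesgue_on X. x \<in> X" by (rule AE_I2) simp
  ultimately show ?thesis by eventually_elim (use gap_zero_iff in auto)
qed

theorem optimal_map_exists:
  "\<exists>T\<in>transport_maps X Y f g. (AE x in lebesgue. x \<in> X \<and> f x > 0 \<longrightarrow> T x \<in> subgrad X u x) \<and>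
     (\<forall>S\<in>transport_maps X Y f g. ot_cost X f T \<le> ot_cost X f S)"
proof -
  obtain T where T: "T \<in> transport_maps X Y f g" "\<forall>x\<in>J ` B. T x \<in> subgrad X u x"
    using transport_map_exists by blast
  have "AE x in lebesgue. x \<in> X \<longrightarrow> f x \<noteq> 0 \<longrightarrow> x \<in> J ` B"
    using AE_X_pos X_lebesgue by (subst (asm) AE_restrict_space_iff) auto
  then have "AE x in lebesgue. x \<in> X \<and> f x > 0 \<longrightarrow> T x \<in> subgrad X u x"
    by eventually_elim (use T(2) in auto)
  moreover have "ot_cost X f T \<le> ot_cost X f S" if S: "S \<in> transport_maps X Y f g" for S
  proof (cases "X = {}")
    case True
    then show ?thesis by (simp add: ot_cost_def)
  next
    case False
    then show ?thesis using cost_bound_attained[OF False T] cost_bound_le[OF False S] by simp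
  qed
  ultimately show ?thesis using T(1) by blast
qed

text \<open>The image of \<open>P\<close> carries all mass of \<open>g\<close>, so a ball in
  \<open>Y\<close> that misses it would have mass 0, impossible as \<open>g > 0\<close> on
  \<open>Y\<close>.\<close>

lemma image_dense:
  assumes T: "T \<in> transport_maps X Y f g" and P: "P \<subseteq> X" "P \<in> sets lebesgue" "negligible (Xpos - P)"
  shows "Y \<subseteq> closure (T ` P)"
proof
  fix y assume y: "y \<in> Y"
  show "y \<in> closure (T ` P)"
  proof (rule ccontr)
    assume "y \<notin> closure (T ` P)"
    then obtain r1 where r1: "r1 > 0" "ball y r1 \<inter> T ` P = {}"
    proof -
      have "open (- closure (T ` P))" "y \<in> - closure (T ` P)" using \<open>y \<notin> closure (T ` P)\<close> by auto
      then obtain r where "r > 0" "ball y r \<subseteq> - closure (T ` P)" using open_contains_ball by blast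
      then show thesis using closure_subset[of "T ` P"] by (intro that[of r]) auto
    qed
    obtain r2 where r2: "r2 > 0" "ball y r2 \<subseteq> Y" using y Y(3) open_contains_ball by blast
    define b where "b = ball y (min r1 r2)"
    have b: "b \<subseteq> Y" "b \<inter> T ` P = {}" "b \<in> sets lebesgue" using r1 r2 by (auto simp: b_def)
    have TP: "T ` P \<in> sets lebesgue" "T ` P \<subseteq> Y"
      using transport_mapsD(3)[OF T P(2,1)] transport_mapsD(1)[OF T] P(1) by auto
    have gi: "g integrable_on Z" if "Z \<in> sets lebesgue" for Z
      using g_int_subset[OF that] set_lebesgue_integral_eq_integral(1) by blast
    have "integral P f = integral X f"
    proof (rule integral_spike_set)
      have "{x \<in> X - P. f x \<noteq> 0} \<subseteq> Xpos - P" using f_nonneg by (force simp: Xpos_def less_le)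
      then show "negligible {x \<in> X - P. f x \<noteq> 0}" using P(3) negligible_subset by blast
      have e: "{x \<in> P - X. f x \<noteq> 0} = {}" using P(1) by auto
      show "negligible {x \<in> P - X. f x \<noteq> 0}" unfolding e by simp
    qed
    then have "integral Y g = integral (T ` P) g" using mass transport_mapsD(4)[OF T P(2,1)] by simp
    moreover have "integral (T ` P \<union> b) g = integral (T ` P) g + integral b g"
      by (rule integral_Un) (use gi TP b in \<open>auto simp: Int_commute\<close>)
    moreover have "integral (T ` P \<union> b) g \<le> integral Y g"
      by (rule integral_subset_le) (use gi TP b Y_lebesgue g(2) in auto)
    moreover have "0 \<le> integral b g" by (rule integral_nonneg) (use gi b g(2) in auto)
    ultimately have "integral b g = 0" by simp
    then have "negligible b"
      using b(1) g_pos by (intro negligible_of_integral_zero[OF g_int_subset[OF b(3)]]) auto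
    moreover have "open b" "b \<noteq> {}" using r1 r2 by (auto simp: b_def)
    ultimately show False using open_not_negligible by blast
  qed
qed

end

theorem unique_on_support:
  assumes "monge_data X f g H u Y" "monge_data X f g H v Y"
  shows "\<exists>c. \<forall>x\<in>fsupp X f. u x = v x + c"
proof (cases "X = {}")
  case True
  then show ?thesis by (simp add: fsupp_def)
next
  case ne: False
  interpret U: monge_data X f g H u Y by fact
  interpret V: monge_data X f g H v Y by fact
  obtain T where T: "T \<in> transport_maps X Y f g" "\<forall>x\<in>U.proxx ` U.B. T x \<in> subgrad X u x"
    using U.transport_map_exists by blast
  obtain T' where T': "T' \<in> transport_maps X Y f g" "\<forall>x\<in>V.proxx ` V.B. T' x \<in> subgrad X v x"
    using V.transport_map_exists by blast
  \<comment> \<open>\<open>T\<close> is optimal, so it costs no more than \<open>T'\<close>, whose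
    cost is the lower bound attached to \<open>v\<close>. Hence \<open>T\<close> attains both bounds
    and selects from both subdifferentials.\<close>
  have "ot_cost X f T \<le> ot_cost X f T'"
    using U.cost_bound_attained[OF ne T] U.cost_bound_le[OF ne T'(1)] by simp
  then have "ot_cost X f T = V.cost_bound"
    using V.cost_bound_attained[OF ne T'] V.cost_bound_le[OF ne T(1)] by simp
  from V.subgrad_of_cost_bound[OF ne T(1) this] U.subgrad_of_cost_bound[OF ne T(1) U.cost_bound_attained[OF ne T]]
  have "AE x in lebesgue_on X. f x \<noteq> 0 \<longrightarrow> T x \<in> subgrad X u x \<inter> subgrad X v x"
    by eventually_elim auto
  then have AE: "AE x in lebesgue. x \<in> X \<longrightarrow> f x \<noteq> 0 \<longrightarrow> T x \<in> subgrad X u x \<inter> subgrad X v x"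
    using U.X_lebesgue by (subst (asm) AE_restrict_space_iff) auto
  define P where "P = {x \<in> U.Xpos. T x \<in> subgrad X u x \<inter> subgrad X v x}"
  have PX: "P \<subseteq> X" by (auto simp: P_def U.Xpos_def)
  have neg: "negligible (U.Xpos - P)"
  proof -
    have "AE x in lebesgue. x \<notin> U.Xpos - P"
      using AE by eventually_elim (auto simp: P_def U.Xpos_def)
    then show ?thesis by (rule negligible_of_AE)
  qed
  have Pleb: "P \<in> sets lebesgue"
  proof -
    have "P = U.Xpos - (U.Xpos - P)" by (auto simp: P_def)
    then show ?thesis using U.open_Xpos negligible_imp_sets[OF neg] by (metis borel_open sets.Diff sets_completionI_sets sets_lborel)
  qed
  let ?R = "\<lambda>y. \<exists>x. norm x \<le> U.RX \<and> (\<forall>y'. U.conj y + x \<bullet> (y' - y) \<le> U.conj y') \<and> (\<forall>y'. V.conj y + x \<bullet> (y' - y) \<le> V.conj y')"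
  have "?R y" if y: "y \<in> T ` P" for y
  proof -
    obtain x where x: "x \<in> P" "y = T x" using y by blast
    then have "x \<in> X" "y \<in> subgrad X u x" "y \<in> subgrad X v x" using PX by (auto simp: P_def)
    then show ?thesis using U.RX U.conj_subgrad V.conj_subgrad by (intro exI[of _ x]) auto
  qed
  then have sub: "?R y" if "y \<in> Y" for y
    using common_subgradient_closure[OF U.conj_continuous[OF ne] V.conj_continuous[OF ne], of y "T ` P"]
      U.image_dense[OF T(1) PX Pleb neg] that by blast
  obtain y0 where y0: "y0 \<in> Y" using U.Y_nonempty[OF ne] by blast
  \<comment> \<open>The sign changes because \<open>u x = x \<bullet> T x - U.conj (T x)\<close> on
    \<open>P\<close>, and likewise for \<open>v\<close>.\<close>
  define c where "c = - (U.conj y0 - V.conj y0)"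
  have onP: "u x - v x = c" if x: "x \<in> P" for x
  proof -
    have xX: "x \<in> X" using x PX by blast
    then have TY: "T x \<in> Y" by (rule U.transport_mapsD(1)[OF T(1)])
    have "U.conj (T x) = x \<bullet> T x - u x" "V.conj (T x) = x \<bullet> T x - v x"
      using x U.conj_eq_iff[OF xX] V.conj_eq_iff[OF xX] by (auto simp: P_def)
    moreover have "U.conj (T x) - V.conj (T x) = U.conj y0 - V.conj y0"
      by (rule difference_constant_of_common_subgradients[OF U.Y(1) y0 TY sub])
    ultimately show ?thesis by (simp add: c_def)
  qed
  \<comment> \<open>\<open>P\<close> has full measure in \<open>Xpos\<close> but need not contain a
    given support point. By continuity a deviation from \<open>c\<close> would persist on an open
    set meeting \<open>Xpos\<close>, and a nonempty open set cannot lie in the null set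
    \<open>Xpos - P\<close>.\<close>
  have "u x - v x = c" if x: "x \<in> fsupp X f" for x
  proof (rule ccontr)
    assume nc: "u x - v x \<noteq> c"
    have xX: "x \<in> X" and cl: "x \<in> closure {x \<in> X. f x \<noteq> 0}" using x by (auto simp: fsupp_def)
    have "continuous_on X (\<lambda>x. u x - v x)" by (intro continuous_intros U.cont_u V.cont_u)
    then have Wo: "open (X \<inter> (\<lambda>x. u x - v x) -` (- {c}))"
      by (intro continuous_open_preimage U.X) auto
    from Wo have W: "open (X \<inter> (\<lambda>x. u x - v x) -` (- {c}) \<inter> U.Xpos)" (is "open ?W") using U.open_Xpos by auto
    have "{x \<in> X. f x \<noteq> 0} = U.Xpos" using U.f_nonneg by (force simp: U.Xpos_def less_le)
    then have "x \<in> closure U.Xpos" using cl by simp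
    then have "?W \<noteq> {}"
      using open_Int_closure_eq_empty[OF Wo, of U.Xpos] xX nc by blast
    moreover have "?W \<subseteq> U.Xpos - P" using onP by auto
    ultimately show False using neg W open_not_negligible negligible_subset by blast
  qed
  then have "\<forall>x\<in>fsupp X f. u x = v x + c" by (auto simp: algebra_simps)
  then show ?thesis ..
qed

theorem mainTheorem1:
  fixes X Y :: "(real^'n) set" and f g H u :: "real^'n \<Rightarrow> real"
  assumes H1: "convex X" "bounded X" "open X" "convex Y" "bounded Y" "open Y"
    and H2: "f absolutely_integrable_on X" "\<forall>x\<in>X. f x \<ge> 0" "lsc_on X f"
    and H3: "g absolutely_integrable_on UNIV" "\<forall>y\<in>Y. g y > 0"
            "\<forall>y. y \<notin> Y \<longrightarrow> g y = 0" "usc_on UNIV g"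
    and H4: "integral X f = integral Y g"
    and HH: "defining_fun Y H"
    and Hu: "usc_on X u" "visc_sub X f g H u"
  shows "(\<forall>v. usc_on X v \<and> visc_sub X f g H v \<longrightarrow>
            (\<exists>c. \<forall>x\<in>fsupp X f. u x = v x + c)) \<and>
         (\<exists>T\<in>transport_maps X Y f g.
            (AE x in lebesgue. x \<in> X \<and> f x > 0 \<longrightarrow> T x \<in> subgrad X u x) \<and>
            (\<forall>S\<in>transport_maps X Y f g. ot_cost X f T \<le> ot_cost X f S))"
proof -
  have data: "monge_data X f g H w Y" if "usc_on X w" "visc_sub X f g H w" for w
  proof unfold_locales
    show "0 \<le> g y" for y using H3 by (cases "y \<in> Y") (auto simp: less_imp_le)
    show "continuous_on UNIV H" using HH by (simp add: defining_fun_def)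
  qed (use assms that in auto)
  show ?thesis
    using unique_on_support[OF data[OF Hu] data] monge_data.optimal_map_exists[OF data[OF Hu]] by blast
qed

end
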